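(* (a) Let $a,b,c\in C(\mathbb{R}^+)$ and let $y\not\equiv0$ be a solution of $\dddot y+a(t)\ddot y+b(t)\dot y+c(t)y=0$ on $\mathbb{R}^+$. Then $$\hat\mu_3(y)\ge\frac{L_\Omega}{2\pi}\hat\nu(y),\qquad \check\mu_3(y)\ge\frac{L_\Omega}{2\pi}\check\nu(y).$$ (b) For every $\varepsilon>0$ there exist smooth functions $a,b,c$ on $\mathbb{R}^+$ and a smooth function $y$ satisfying $\dddot y+a(t)\ddot y+b(t)\dot y+c(t)y=0$ on $\mathbb{R}^+$, for which the exact zero frequency $\nu(y)$ and the exact wandering speed $\mu_3(y)$ exist and $\mu_3(y)<\left(\frac{L_\Omega}{2\pi}+\varepsilon\right)\nu(y)$.
   Context: For a solution $y$, $\nu(y,t)$ is the number of zeros of $y$ on $[0,t]$; the lower and upper zero frequencies are $\check\nu(y)=\liminf_{t\to\infty}\frac{\pi}{t}\nu(y,t)$ and $\hat\nu(y)=\limsup_{t\to\infty}\frac{\pi}{t}\nu(y,t)$, and if they coincide their common value is the exact zero frequency $\nu(y)$. With $x(\tau)=(y,\dot y,\ddot y)(\tau)$ and $\gamma_3(y,t)=\int_0^t\left|\frac{d}{d\tau}\frac{x(\tau)}{|x(\tau)|}\right|d\tau$, the lower and upper wandering speeds are $\check\mu_3(y)=\liminf_{t\to\infty}\frac{1}{t}\gamma_3(y,t)$ and $\hat\mu_3(y)=\limsup_{t\to\infty}\frac1t\gamma_3(y,t)$; if they coincide their common value is the exact wandering speed $\mu_3(y)$. $L_\Omega$ is the length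 of the boundary (on the unit sphere $S^2$) of $\Omega_+=\{(x_0,x_1,x_2)\in S^2: x_0x_2-x_1^2>0,\ x_2>0\}$; explicitly $L_\Omega=4\int_0^\pi\frac{\sqrt{5-\cos\alpha}}{7+\cos\alpha}d\alpha$. *)

theory Defs
  imports "HOL-Analysis.Analysis" "HOL-Library.Liminf_Limsup" "HOL-Library.Extended_Real"
begin

abbreviation Rplus :: "real set" where "Rplus \<equiv> {0..}"

definition D1 :: "(real \<Rightarrow> real) \<Rightarrow> real \<Rightarrow> real" where
  "D1 f t = vector_derivative f (at t within Rplus)"

definition D2 :: "(real \<Rightarrow> real) \<Rightarrow> real \<Rightarrow> real" where
  "D2 f = D1 (D1 f)"

definition D3 :: "(real \<Rightarrow> real) \<Rightarrow> real \<Rightarrow> real" where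
  "D3 f = D1 (D2 f)"

definition is_solution ::
  "(real \<Rightarrow> real) \<Rightarrow> (real \<Rightarrow> real) \<Rightarrow> (real \<Rightarrow> real) \<Rightarrow> (real \<Rightarrow> real) \<Rightarrow> bool" where
  "is_solution a b c y \<longleftrightarrow>
     (\<forall>t\<in>Rplus.
        (y has_vector_derivative D1 y t) (at t within Rplus) \<and>
        (D1 y has_vector_derivative D2 y t) (at t within Rplus) \<and>
        (D2 y has_vector_derivative D3 y t) (at t within Rplus) \<and>
        D3 y t + a t * D2 y t + b t * D1 y t + c t * y t = 0)"

definition smooth_on_Rplus :: "(real \<Rightarrow> real) \<Rightarrow> bool" where
  "smooth_on_Rplus f \<longleftrightarrow>
     (\<exists>Df :: nat \<Rightarrow> real \<Rightarrow> real. Df 0 = f \<and>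
        (\<forall>k. \<forall>t\<in>Rplus. (Df k has_vector_derivative Df (Suc k) t) (at t within Rplus)))"

definition nzeros :: "(real \<Rightarrow> real) \<Rightarrow> real \<Rightarrow> nat" where
  "nzeros y t = card {s \<in> {0..t}. y s = 0}"

definition lower_zero_freq :: "(real \<Rightarrow> real) \<Rightarrow> ereal" where
  "lower_zero_freq y = Liminf at_top (\<lambda>t. ereal (pi / t * real (nzeros y t)))"

definition upper_zero_freq :: "(real \<Rightarrow> real) \<Rightarrow> ereal" where
  "upper_zero_freq y = Limsup at_top (\<lambda>t. ereal (pi / t * real (nzeros y t)))"

definition xvec :: "(real \<Rightarrow> real) \<Rightarrow> real \<Rightarrow> real \<times> real \<times> real" where
  "xvec y \<tau> = (y \<tau>, D1 y \<tau>, D2 y \<tau>)"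

definition xsph :: "(real \<Rightarrow> real) \<Rightarrow> real \<Rightarrow> real \<times> real \<times> real" where
  "xsph y \<tau> = xvec y \<tau> /\<^sub>R norm (xvec y \<tau>)"

definition gamma3 :: "(real \<Rightarrow> real) \<Rightarrow> real \<Rightarrow> real" where
  "gamma3 y t = integral {0..t} (\<lambda>\<tau>. norm (vector_derivative (xsph y) (at \<tau> within Rplus)))"

definition lower_wander :: "(real \<Rightarrow> real) \<Rightarrow> ereal" where
  "lower_wander y = Liminf at_top (\<lambda>t. ereal (gamma3 y t / t))"

definition upper_wander :: "(real \<Rightarrow> real) \<Rightarrow> ereal" where
  "upper_wander y = Limsup at_top (\<lambda>t. ereal (gamma3 y t / t))"

text \<open>Length of the boundary of Omega_+ on S^2 (explicit formula from the paper).\<close>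
definition L_Omega :: real where
  "L_Omega = 4 * integral {0..pi} (\<lambda>\<alpha>. sqrt (5 - cos \<alpha>) / (7 + cos \<alpha>))"

end

theory Submission
  imports Defs "HOL-Computational_Algebra.Polynomial"
begin

text \<open>
  Part (a) is Crofton's formula on the sphere. A plane \<open>\<xi>\<^sub>0 x\<^sub>0 + \<xi>\<^sub>1 x\<^sub>1 + \<xi>\<^sub>2 x\<^sub>2 = 0\<close> meets the cone
  \<open>x\<^sub>0 x\<^sub>2 > x\<^sub>1\<^sup>2\<close> exactly when the polynomial \<open>\<xi>\<^sub>0 + \<xi>\<^sub>1 s + \<xi>\<^sub>2 s\<^sup>2\<close> has distinct real roots \<open>r\<close>, \<open>s\<close>. For
  such a plane the operator \<open>\<xi>\<^sub>0 + \<xi>\<^sub>1 D + \<xi>\<^sub>2 D\<^sup>2\<close> is a multiple of \<open>(D - r) (D - s)\<close>, so by Rolle's theorem,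
  used twice, the curve \<open>(y, y', y'')\<close> crosses the plane at least \<open>n - 2\<close> times if \<open>y\<close> has \<open>n\<close> zeros. The
  boundary of \<open>\<Omega>\<^sub>+\<close> crosses each of these planes at most twice and no other plane. Averaging over all planes
  gives \<open>\<gamma>\<^sub>3 \<ge> (n - 2) L\<^sub>\<Omega> / 2\<close>. Crossing numbers are counted on polygons inscribed in the curves: the set
  of \<open>\<xi>\<close> in the unit ball whose plane separates two unit vectors is a lune, whose volume is
  proportional to the angle by rotation invariance and additivity.

  For part (b) take \<open>y = cosh \<phi> - 2\<close> with \<open>\<phi> = (M / \<delta>) sin (\<delta> t)\<close>, \<open>M\<close> large and \<open>\<delta>\<close> small. While
  \<open>\<phi>\<close> is large, \<open>(y, y', y'')\<close> is almost proportional to \<open>(1, u, u\<^sup>2)\<close> with \<open>u = \<phi>'\<close>, and it runs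
  once along the boundary of \<open>\<Omega>\<^sub>+\<close> as \<open>u\<close> decreases from \<open>M\<close> to \<open>-M\<close>; while \<open>\<phi>\<close> changes sign, the
  curve stays near \<open>(0, 0, 1)\<close> and \<open>y\<close> acquires two zeros.
\<close>

section \<open>The volume of a lune\<close>

text \<open>Part (a) compares both curves with the same volume, that of \<open>hyp_dirs\<close>:
  Crofton's formula enters as a lower bound for the length of the solution curve and as an upper
  bound for the boundary of \<open>\<Omega>\<^sub>+\<close>, so the density of the lunes cancels.
  Planes are averaged over the solid unit ball because separation depends only on the direction of
  the normal and Lebesgue measure is rotation invariant; no surface measure is involved. The
  delicate point is tangency: inscribed polygons detect sign changes, not zeros. Rolle's theorem is
  therefore used in a form that yields sign changes, and the lower bound counts closed lunes, the
  upper bound open ones. In part (b) a half period pi / \<delta> of the phase carries two zeros and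
  a length close to \<open>L_Omega\<close>. So the zero frequency is 2 \<delta> and the speed about
  \<open>L_Omega\<close> \<delta> / pi, whose ratio is \<open>L_Omega\<close> / (2 pi). The excess
  length per half period is of order 1 / M + M^2 \<delta> + \<delta>; the choice \<delta> = M^(-3)
  makes all of it O(1 / M).\<close>

text \<open>Once an orthogonal \<open>R\<close> maps \<open>e\<close> to \<open>e'\<close>, the
  reflection in the hyperplane orthogonal to \<open>R f - f'\<close> finishes: it maps
  \<open>R f\<close> to \<open>f'\<close> because their norms agree, and it fixes \<open>e'\<close>
  because both have the same inner product with \<open>e'\<close>.\<close>

lemma orthogonal_transformation_exists_pair:
  fixes e f e' f' :: "real^'n"
  assumes "norm e = norm e'" "norm f = norm f'" "e \<bullet> f = e' \<bullet> f'"
  obtains T where "orthogonal_transformation T" "T e = e'" "T f = f'"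
proof -
  obtain R where R: "orthogonal_transformation R" "R e = e'"
    using orthogonal_transformation_exists[OF assms(1)] by blast
  define v where "v = R f - f'"
  \<comment> \<open>For \<open>v = 0\<close> division by zero turns \<open>H\<close> into the
    identity, which is then the right map.\<close>
  define H where "H x = x - (2 * (x \<bullet> v) / (v \<bullet> v)) *\<^sub>R v" for x
  have ef: "e' \<bullet> R f = e' \<bullet> f'"
    using R assms(3) by (metis orthogonal_transformation_def)
  have nf: "norm (R f) = norm f'"
    using R assms(2) by (simp add: orthogonal_transformation_norm)
  have "linear H"
    unfolding H_def by (intro linearI) (auto simp: algebra_simps inner_add_left add_divide_distrib scaleR_add_left)
  moreover have "H x \<bullet> H y = x \<bullet> y" for x y
    by (cases "v = 0") (auto simp: H_def inner_diff_left inner_diff_right inner_commute)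
  ultimately have H: "orthogonal_transformation H"
    unfolding orthogonal_transformation_def by simp
  have "H e' = e'"
    using ef by (simp add: H_def v_def inner_diff_right)
  moreover have "H (R f) = f'"
  proof (cases "v = 0")
    case False
    have "v \<bullet> v = 2 * (R f \<bullet> v)"
      using nf by (simp add: v_def inner_diff_left inner_diff_right inner_commute norm_eq)
    then have "H (R f) = R f - (v \<bullet> v / (v \<bullet> v)) *\<^sub>R v"
      unfolding H_def by (simp only:)
    also have "\<dots> = R f - v" using False by simp
    finally have "H (R f) = R f - v" .
    then show ?thesis by (simp add: v_def)
  qed (simp add: H_def v_def)
  ultimately have "orthogonal_transformation (H \<circ> R)" "(H \<circ> R) e = e'" "(H \<circ> R) f = f'"
    using R H by (auto simp: orthogonal_transformation_compose)
  then show thesis using that by blast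
qed

definition lune :: "real^3 \<Rightarrow> real^3 \<Rightarrow> (real^3) set" where
  "lune e f = {\<xi> \<in> ball 0 1. (\<xi> \<bullet> e) * (\<xi> \<bullet> f) < 0}"

text \<open>The closed variant is needed when a sign change is sampled at grid nodes, since the
  function may vanish exactly at a node.\<close>

definition clune :: "real^3 \<Rightarrow> real^3 \<Rightarrow> (real^3) set" where
  "clune e f = {\<xi> \<in> ball 0 1. (\<xi> \<bullet> e) * (\<xi> \<bullet> f) \<le> 0}"

lemma lune_lmeasurable: "lune e f \<in> lmeasurable"
proof -
  have "open {\<xi>. (\<xi> \<bullet> e) * (\<xi> \<bullet> f) < 0}"
    by (intro open_Collect_less continuous_intros)
  then have "open (ball 0 1 \<inter> {\<xi>. (\<xi> \<bullet> e) * (\<xi> \<bullet> f) < 0})"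
    by (intro open_Int open_ball)
  moreover have "lune e f = ball 0 1 \<inter> {\<xi>. (\<xi> \<bullet> e) * (\<xi> \<bullet> f) < 0}"
    by (auto simp: lune_def)
  ultimately have "open (lune e f)" by simp
  moreover have "bounded (lune e f)"
    by (rule bounded_subset[OF bounded_ball[of 0 1]]) (auto simp: lune_def)
  ultimately show ?thesis by (simp add: lmeasurable_open)
qed

lemma clune_lmeasurable: "clune e f \<in> lmeasurable"
proof -
  have "closed {\<xi>. (\<xi> \<bullet> e) * (\<xi> \<bullet> f) \<le> 0}"
    by (intro closed_Collect_le continuous_intros)
  then have "clune e f \<in> sets lebesgue"
    unfolding clune_def by (simp add: Collect_conj_eq sets.Int)
  moreover have "bounded (clune e f)"
    by (rule bounded_subset[OF bounded_ball[of 0 1]]) (auto simp: clune_def)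
  ultimately show ?thesis by (simp add: bounded_set_imp_lmeasurable)
qed

lemma measure_clune:
  assumes "e \<noteq> 0" "f \<noteq> 0"
  shows "measure lebesgue (clune e f) = measure lebesgue (lune e f)"
proof (rule measure_negligible_symdiff)
  have "sym_diff (lune e f) (clune e f) \<subseteq> {\<xi>. e \<bullet> \<xi> = 0} \<union> {\<xi>. f \<bullet> \<xi> = 0}"
    by (auto simp: lune_def clune_def inner_commute less_le)
  then show "negligible (sym_diff (lune e f) (clune e f))"
    by (rule negligible_subset[rotated]) (intro negligible_Un negligible_hyperplane; use assms in simp)
qed (use lune_lmeasurable in auto)

lemma measure_lune_cong:
  assumes "norm e = norm e'" "norm f = norm f'" "e \<bullet> f = e' \<bullet> f'"
  shows "measure lebesgue (lune e f) = measure lebesgue (lune e' f')"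
proof -
  obtain T where T: "orthogonal_transformation T" "T e = e'" "T f = f'"
    using orthogonal_transformation_exists_pair[OF assms] by blast
  have "T ` lune e f = lune e' f'"
  proof (intro equalityI subsetI)
    fix x assume "x \<in> T ` lune e f"
    then show "x \<in> lune e' f'"
      using T by (auto simp: lune_def orthogonal_transformation_def orthogonal_transformation_norm)
  next
    fix x assume x: "x \<in> lune e' f'"
    obtain z where "x = T z"
      using orthogonal_transformation_surj[OF T(1)] by (metis surjD)
    moreover have "norm (T z) = norm z" "T z \<bullet> T e = z \<bullet> e" "T z \<bullet> T f = z \<bullet> f"
      using T(1) by (auto simp: orthogonal_transformation_def orthogonal_transformation_norm)
    ultimately show "x \<in> T ` lune e f"
      using x T by (auto simp: lune_def)
  qed
  then show ?thesis
    using measure_orthogonal_image[OF T(1) lune_lmeasurable] by metis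
qed

text \<open>Cauchy's functional equation on an interval. Nonnegativity makes \<open>f\<close>
  monotone, additivity fixes its values at the rational multiples of \<open>c\<close>, and
  \<open>x\<close> is squeezed between two neighbouring multiples of \<open>c / N\<close>. Nothing
  is known beforehand about the regularity of lune volumes in the angle.\<close>

lemma additive_nonneg_linear:
  fixes f :: "real \<Rightarrow> real"
  assumes c: "c > 0"
    and add: "\<And>x y. 0 \<le> x \<Longrightarrow> 0 \<le> y \<Longrightarrow> x + y \<le> c \<Longrightarrow> f (x + y) = f x + f y"
    and pos: "\<And>x. 0 \<le> x \<Longrightarrow> x \<le> c \<Longrightarrow> 0 \<le> f x"
    and x: "0 \<le> x" "x \<le> c"
  shows "f x = x / c * f c"
proof -
  have f0: "f 0 = 0" using add[of 0 0] c by simp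
  have mult: "f (real n * z) = real n * f z" if "0 \<le> z" "real n * z \<le> c" for n z
    using that
  proof (induction n)
    case (Suc n)
    have le: "real n * z \<le> c" using Suc.prems by (simp add: algebra_simps)
    have "f (real (Suc n) * z) = f (real n * z + z)" by (simp add: algebra_simps)
    also have "\<dots> = f (real n * z) + f z"
      using Suc.prems by (intro add) (auto simp: algebra_simps)
    finally show ?case using Suc.IH[OF Suc.prems(1) le] by (simp add: algebra_simps)
  qed (simp add: f0)
  have mono: "f u \<le> f v" if "0 \<le> u" "u \<le> v" "v \<le> c" for u v
    using add[of u "v - u"] pos[of "v - u"] that by auto
  have frac: "f (real k * (c / real N)) = real k / real N * f c" if "k \<le> N" "N > 0" for k N
  proof -
    have "f (real N * (c / real N)) = real N * f (c / real N)"
      using that c by (intro mult) auto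
    then have "f (c / real N) = f c / real N" using that by (auto simp: field_simps)
    moreover have "f (real k * (c / real N)) = real k * f (c / real N)"
      using that c by (intro mult) (auto simp: field_simps mult_right_mono)
    ultimately show ?thesis by simp
  qed
  have close: "\<bar>f x - x / c * f c\<bar> \<le> f c / real N" if N: "N > 0" for N :: nat
  proof (cases "x = c")
    case True
    then show ?thesis using c pos[of c] by auto
  next
    case False
    define k where "k = nat \<lfloor>real N * x / c\<rfloor>"
    have k: "real k \<le> real N * x / c" "real N * x / c < real k + 1"
      using x c unfolding k_def by auto
    have "real N * x / c < real N" using False x c N by (simp add: field_simps)
    then have kN: "k + 1 \<le> N" using k(1) by linarith
    have b: "real k * (c / real N) \<le> x" "x \<le> real (k + 1) * (c / real N)"
      using k c N by (auto simp: field_simps)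
    have "f (real k * (c / real N)) \<le> f x"
      using b x c by (intro mono) auto
    moreover have "real (k+1) * (c / real N) \<le> c"
      using mult_left_mono[of "real (k + 1)" "real N" c] kN c N by (simp add: field_simps)
    then have "f x \<le> f (real (k + 1) * (c / real N))"
      using b x by (intro mono) auto
    ultimately have A: "real k / real N * f c \<le> f x" "f x \<le> real (k + 1) / real N * f c"
      using frac[of k N] frac[of "k+1" N] kN N by auto
    have p: "0 \<le> f c" using pos[of c] c by auto
    have "real k / real N \<le> x / c" "x / c \<le> real (k+1) / real N"
      using k c N by (auto simp: field_simps)
    then have B: "real k / real N * f c \<le> x / c * f c" "x / c * f c \<le> real (k+1) / real N * f c"
      using p by (meson mult_right_mono)+
    have "real (k+1) / real N * f c = real k / real N * f c + f c / real N"
      by (simp add: add_divide_distrib distrib_right)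
    then show ?thesis using A B by linarith
  qed
  have "(\<lambda>N. f c / real (Suc N)) \<longlonglongrightarrow> 0"
    by (rule LIMSEQ_Suc) (rule lim_const_over_n)
  then have "\<bar>f x - x / c * f c\<bar> \<le> 0"
    by (rule LIMSEQ_le_const) (use close in \<open>auto simp del: of_nat_Suc\<close>)
  then show ?thesis by simp
qed

definition circ :: "real \<Rightarrow> real^3" where
  "circ \<theta> = vector [cos \<theta>, sin \<theta>, 0]"

lemma inner_circ: "\<xi> \<bullet> circ \<theta> = \<xi>$1 * cos \<theta> + \<xi>$2 * sin \<theta>"
  by (simp add: circ_def inner_vec_def sum_3)

lemma circ_circ: "circ a \<bullet> circ b = cos (b - a)"
  by (simp add: inner_circ) (simp add: circ_def cos_diff)

lemma norm_circ [simp]: "norm (circ a) = 1"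
  by (simp add: norm_eq_sqrt_inner circ_circ)

lemma circ_nz [simp]: "circ a \<noteq> 0"
  using norm_circ[of a] by force

text \<open>As \<open>a + b \<le> pi\<close>, the vector \<open>circ a\<close>, scaled by
  \<open>sin (a + b)\<close>, is a positive combination of \<open>circ 0\<close> and
  \<open>circ (a + b)\<close>, so no plane separates it from both. Off three hyperplanes, a plane
  thus separates the outer pair exactly when it separates one of the two inner pairs.\<close>

lemma measure_lune_circ_add:
  assumes "0 \<le> a" "0 \<le> b" "a + b \<le> pi"
  shows "measure lebesgue (lune (circ 0) (circ (a + b))) =
         measure lebesgue (lune (circ 0) (circ a)) + measure lebesgue (lune (circ 0) (circ b))"
proof (cases "a = 0 \<or> b = 0")
  case True
  have "lune (circ 0) (circ 0) = {}" by (auto simp: lune_def mult_less_0_iff)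
  then show ?thesis using True by auto
next
  case False
  then have ab: "0 < a" "0 < b" "a < pi" "b < pi" using assms by auto
  let ?P = "lune (circ 0) (circ a)" and ?Q = "lune (circ a) (circ (a + b))"
    and ?R = "lune (circ 0) (circ (a + b))"
  have rel: "sin (a + b) * (\<xi> \<bullet> circ a) = sin b * (\<xi> \<bullet> circ 0) + sin a * (\<xi> \<bullet> circ (a + b))" for \<xi>
  proof -
    have "sin (a+b) * cos a = sin b + sin a * cos (a+b)"
    proof -
      have "sin b = sin ((a + b) - a)" by simp
      then show ?thesis unfolding sin_diff by simp
    qed
    then have "\<xi>$1 * (sin (a+b) * cos a) = \<xi>$1 * (sin b + sin a * cos (a+b))" by simp
    then show ?thesis by (simp add: inner_circ algebra_simps)
  qed
  have s: "sin a > 0" "sin b > 0" "sin (a + b) \<ge> 0"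
    using ab assms by (auto intro: sin_gt_zero sin_ge_zero)
  have excl: False if p: "(\<xi> \<bullet> circ 0) * (\<xi> \<bullet> circ a) < 0" "(\<xi> \<bullet> circ a) * (\<xi> \<bullet> circ (a + b)) < 0" for \<xi>
  proof (cases "\<xi> \<bullet> circ a > 0")
    case True
    then have "\<xi> \<bullet> circ 0 < 0" "\<xi> \<bullet> circ (a + b) < 0" using p by (auto simp: mult_less_0_iff)
    then have "sin b * (\<xi> \<bullet> circ 0) + sin a * (\<xi> \<bullet> circ (a + b)) < 0"
      using s by (intro add_neg_neg mult_pos_neg)
    then show False using rel[of \<xi>] True s(3) by (metis mult_nonneg_nonneg less_imp_le not_less)
  next
    case False
    then have n: "\<xi> \<bullet> circ a < 0" using p by (auto simp: mult_less_0_iff)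
    then have "\<xi> \<bullet> circ 0 > 0" "\<xi> \<bullet> circ (a + b) > 0" using p by (auto simp: mult_less_0_iff)
    then have "sin b * (\<xi> \<bullet> circ 0) + sin a * (\<xi> \<bullet> circ (a + b)) > 0"
      using s by (intro add_pos_pos mult_pos_pos)
    then show False using rel[of \<xi>] n s(3) by (metis mult_nonneg_nonpos less_imp_le not_less)
  qed
  have "measure lebesgue ?R = measure lebesgue (?P \<union> ?Q)"
  proof (rule measure_negligible_symdiff)
    have "sym_diff (?P \<union> ?Q) ?R \<subseteq> {\<xi>. circ a \<bullet> \<xi> = 0} \<union> ({\<xi>. circ 0 \<bullet> \<xi> = 0} \<union> {\<xi>. circ (a + b) \<bullet> \<xi> = 0})" (is "_ \<subseteq> ?N")
    proof
      fix \<xi> assume \<xi>: "\<xi> \<in> sym_diff (?P \<union> ?Q) ?R"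
      show "\<xi> \<in> ?N"
      proof (rule ccontr)
        assume "\<xi> \<notin> ?N"
        then have "\<xi> \<bullet> circ a \<noteq> 0" "\<xi> \<bullet> circ 0 \<noteq> 0" "\<xi> \<bullet> circ (a + b) \<noteq> 0"
          by (simp_all add: inner_commute)
        then show False using \<xi> excl[of \<xi>]
          by (auto simp: lune_def mult_less_0_iff not_less le_less)
      qed
    qed
    then show "negligible (sym_diff (?P \<union> ?Q) ?R)"
      by (rule negligible_subset[rotated]) (intro negligible_Un negligible_hyperplane; simp)
  qed (use lune_lmeasurable in auto)
  also have "\<dots> = measure lebesgue ?P + measure lebesgue ?Q"
  proof -
    have "?P \<inter> ?Q = {}" using excl by (auto simp: lune_def)
    then show ?thesis
      by (simp add: measure_Un3 lune_lmeasurable)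
  qed
  also have "measure lebesgue ?Q = measure lebesgue (lune (circ 0) (circ b))"
    by (rule measure_lune_cong) (auto simp: circ_circ)
  finally show ?thesis .
qed

lemma measure_lune_pi: "measure lebesgue (lune (circ 0) (circ pi)) = measure lebesgue (ball 0 1 :: (real^3) set)"
proof (rule measure_negligible_symdiff)
  have "circ pi = - circ 0" by (simp add: circ_def vec_eq_iff forall_3)
  then have "lune (circ 0) (circ pi) = {\<xi>\<in>ball 0 1. \<xi> \<bullet> circ 0 \<noteq> 0}"
    by (auto simp: lune_def) (metis mult_less_0_iff not_square_less_zero linorder_neqE_linordered_idom zero_less_mult_iff)
  then have "sym_diff (ball 0 1) (lune (circ 0) (circ pi)) \<subseteq> {\<xi>. circ 0 \<bullet> \<xi> = 0}"
    by (auto simp: inner_commute)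
  then show "negligible (sym_diff (ball 0 1) (lune (circ 0) (circ pi)))"
    by (rule negligible_subset[rotated]) (intro negligible_hyperplane; simp)
qed auto

text \<open>Volume per unit of angle: at angle pi the lune fills the ball up to a null set.\<close>

definition lune_density :: real where
  "lune_density = measure lebesgue (ball 0 1 :: (real^3) set) / pi"

lemma lune_density_pos: "lune_density > 0"
  unfolding lune_density_def using content_ball_pos[of 1 "0 :: real^3"] by simp

lemma measure_lune:
  assumes "norm e = 1" "norm f = 1"
  shows "measure lebesgue (lune e f) = lune_density * arccos (e \<bullet> f)"
proof -
  have b: "\<bar>e \<bullet> f\<bar> \<le> 1" using Cauchy_Schwarz_ineq2[of e f] assms by simp
  then have ar: "0 \<le> arccos (e \<bullet> f)" "arccos (e \<bullet> f) \<le> pi" "cos (arccos (e \<bullet> f)) = e \<bullet> f"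
    by (auto simp: abs_le_iff arccos_lbound arccos_ubound)
  let ?F = "\<lambda>\<theta>. measure lebesgue (lune (circ 0) (circ \<theta>))"
  have "measure lebesgue (lune e f) = ?F (arccos (e \<bullet> f))"
    by (rule measure_lune_cong) (auto simp: circ_circ ar assms)
  also have "\<dots> = arccos (e \<bullet> f) / pi * ?F pi"
    using ar by (intro additive_nonneg_linear) (auto simp: measure_lune_circ_add)
  finally show ?thesis by (simp add: measure_lune_pi lune_density_def)
qed

section \<open>Crofton's inequalities for spherical curves\<close>

definition grid :: "real \<Rightarrow> real \<Rightarrow> nat \<Rightarrow> nat \<Rightarrow> real" where
  "grid a b N j = a + (b - a) * (real j / real N)"

lemma grid_0 [simp]: "grid a b N 0 = a"
  and grid_top [simp]: "N > 0 \<Longrightarrow> grid a b N N = b"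
  by (auto simp: grid_def)

lemma grid_mono: "a \<le> b \<Longrightarrow> i \<le> j \<Longrightarrow> grid a b N i \<le> grid a b N j"
  by (auto simp: grid_def intro!: mult_left_mono divide_right_mono)

lemma grid_le_iff:
  assumes "a < b" "N > 0"
  shows "grid a b N i \<le> grid a b N j \<longleftrightarrow> i \<le> j"
  using assms by (auto simp: grid_def divide_le_cancel)

lemma grid_in: "a \<le> b \<Longrightarrow> j \<le> N \<Longrightarrow> grid a b N j \<in> {a..b}"
  using grid_mono[of a b 0 j N] grid_mono[of a b j N N]
  by (cases "N = 0") (auto simp: grid_def)

lemma grid_step: "grid a b N (Suc j) - grid a b N j = (b - a) / real N"
  by (simp add: grid_def field_simps add_divide_distrib)

lemma sum_integral_consecutive:
  fixes g :: "real \<Rightarrow> real"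
  assumes "\<And>i. i < n \<Longrightarrow> p i \<le> p (Suc i)" "g integrable_on {p 0..p n}"
  shows "(\<Sum>i<n. integral {p i..p (Suc i)} g) = integral {p 0..p n} g \<and> p 0 \<le> p n"
  using assms
proof (induction n)
  case (Suc n)
  have "g integrable_on {p 0..p n}"
    by (rule integrable_on_subinterval[OF Suc.prems(2)]) (use Suc.prems(1)[of n] in auto)
  with Suc have "(\<Sum>i<n. integral {p i..p (Suc i)} g) = integral {p 0..p n} g" and le: "p 0 \<le> p n" by auto
  then show ?case
    using Suc.prems le by (auto simp: Henstock_Kurzweil_Integration.integral_combine intro: order_trans)
qed auto

locale sphere_curve =
  fixes E E' :: "real \<Rightarrow> real^3" and a b :: real
  assumes ab: "a < b"
    and unit: "\<And>t. t \<in> {a..b} \<Longrightarrow> norm (E t) = 1"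
    and deriv: "\<And>t. t \<in> {a..b} \<Longrightarrow> (E has_vector_derivative E' t) (at t within {a..b})"
    and cont': "continuous_on {a..b} E'"
begin

lemma cont: "continuous_on {a..b} E"
  using deriv by (rule continuous_on_vector_derivative)

lemma has_integral_deriv:
  assumes "a \<le> c" "c \<le> d" "d \<le> b"
  shows "(E' has_integral (E d - E c)) {c..d}"
  using assms
  by (intro fundamental_theorem_of_calculus)
     (auto intro!: has_vector_derivative_within_subset[OF deriv])

lemma integrable_norm:
  assumes "a \<le> c" "d \<le> b"
  shows "(\<lambda>t. norm (E' t)) integrable_on {c..d}"
  using assms by (intro integrable_continuous_interval continuous_on_norm continuous_on_subset[OF cont']) auto

lemma chord_le:
  assumes "a \<le> c" "c \<le> d" "d \<le> b"
  shows "norm (E c - E d) \<le> integral {c..d} (\<lambda>t. norm (E' t))"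
proof -
  have "norm (integral {c..d} E') \<le> integral {c..d} (\<lambda>t. norm (E' t))"
    using has_integral_deriv[OF assms] integrable_norm assms
    by (intro integral_norm_bound_integral) auto
  then show ?thesis
    using integral_unique[OF has_integral_deriv[OF assms]] by (simp add: norm_minus_commute)
qed

text \<open>Uniform continuity of \<open>E'\<close> replaces it on a short interval by its value at
  \<open>c\<close>. This costs \<open>r * (d - c)\<close> once in the chord and once in the length,
  hence the factor 2.\<close>

lemma chord_ge:
  assumes "r > 0"
  obtains \<delta> where "\<delta> > 0"
    "\<And>c d. a \<le> c \<Longrightarrow> c \<le> d \<Longrightarrow> d \<le> b \<Longrightarrow> d - c < \<delta> \<Longrightarrow>
       integral {c..d} (\<lambda>t. norm (E' t)) - 2 * r * (d - c) \<le> norm (E c - E d)"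
proof -
  have "uniformly_continuous_on {a..b} E'"
    using cont' by (simp add: compact_uniformly_continuous)
  then obtain \<delta> where \<delta>: "\<delta> > 0" "\<And>s t. s \<in> {a..b} \<Longrightarrow> t \<in> {a..b} \<Longrightarrow> dist t s < \<delta> \<Longrightarrow> dist (E' t) (E' s) < r"
    using assms unfolding uniformly_continuous_on_def by metis
  show thesis
  proof (rule that[OF \<delta>(1)])
    fix c d assume cd: "a \<le> c" "c \<le> d" "d \<le> b" "d - c < \<delta>"
    have close: "norm (E' t - E' c) \<le> r" if "t \<in> {c..d}" for t
      using \<delta>(2)[of c t] cd that by (auto simp: dist_norm)
    have "((\<lambda>t. E' t - E' c) has_integral (E d - E c - (d - c) *\<^sub>R E' c)) {c..d}"
      using has_integral_diff[OF has_integral_deriv[of c d] has_integral_const_real[of "E' c" c d]] cd by simp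
    then have "norm (E d - E c - (d - c) *\<^sub>R E' c) \<le> r * (d - c)"
      using has_integral_bound[of r "\<lambda>t. E' t - E' c" _ c d] close assms cd by (simp add: cbox_interval)
    moreover have "norm ((d - c) *\<^sub>R E' c) \<le> norm (E d - E c - (d - c) *\<^sub>R E' c) + norm (E d - E c)"
      by (metis norm_triangle_sub norm_minus_commute add.commute)
    ultimately have 1: "(d - c) * norm (E' c) - r * (d - c) \<le> norm (E c - E d)"
      using cd by (simp add: norm_minus_commute)
    have "norm (E' t) \<le> norm (E' c) + r" if "t \<in> {c..d}" for t
      using close[OF that] norm_triangle_sub[of "E' t" "E' c"] by simp
    then have "integral {c..d} (\<lambda>t. norm (E' t)) \<le> integral {c..d} (\<lambda>t. norm (E' c) + r)"
      using cd by (intro integral_le integrable_norm) auto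
    then have "integral {c..d} (\<lambda>t. norm (E' t)) \<le> (d - c) * (norm (E' c) + r)"
      using cd by simp
    then show "integral {c..d} (\<lambda>t. norm (E' t)) - 2 * r * (d - c) \<le> norm (E c - E d)"
      using 1 by (simp add: algebra_simps)
  qed
qed

end

lemma norm_diff_unit:
  fixes e f :: "real^3"
  assumes "norm e = 1" "norm f = 1"
  shows "norm (e - f) = 2 * sin (arccos (e \<bullet> f) / 2)"
proof -
  have b: "\<bar>e \<bullet> f\<bar> \<le> 1" using Cauchy_Schwarz_ineq2[of e f] assms by simp
  let ?t = "arccos (e \<bullet> f)"
  have t: "0 \<le> ?t" "?t \<le> pi" "cos ?t = e \<bullet> f"
    using b by (auto simp: abs_le_iff arccos_lbound arccos_ubound)
  have "(norm (e - f))\<^sup>2 = 2 - 2 * cos ?t"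
    using assms t(3) by (simp add: power2_norm_eq_inner inner_diff_left inner_diff_right inner_commute norm_eq_1)
  also have "\<dots> = (2 * sin (?t / 2))\<^sup>2"
    using cos_double_sin[of "?t / 2"] by (simp add: power_mult_distrib)
  finally show ?thesis
    using t by (intro power2_eq_imp_eq[of "norm (e - f)"]) (auto intro!: sin_ge_zero)
qed

lemma chord_le_angle:
  fixes e f :: "real^3"
  assumes "norm e = 1" "norm f = 1"
  shows "norm (e - f) \<le> arccos (e \<bullet> f)"
proof -
  have b: "\<bar>e \<bullet> f\<bar> \<le> 1" using Cauchy_Schwarz_ineq2[of e f] assms by simp
  then show ?thesis
    using norm_diff_unit[OF assms] sin_x_le_x[of "arccos (e \<bullet> f) / 2"]
    by (simp add: abs_le_iff arccos_lbound)
qed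

text \<open>A chord is twice the sine of half its angle, and \<open>sin x / x\<close> tends to 1 at
  0.\<close>

lemma angle_le_chord:
  assumes "r > 0"
  obtains \<eta> where "\<eta> > 0"
    "\<And>e f :: real^3. norm e = 1 \<Longrightarrow> norm f = 1 \<Longrightarrow> norm (e - f) < \<eta> \<Longrightarrow>
       arccos (e \<bullet> f) \<le> (1 + r) * norm (e - f)"
proof -
  have "((\<lambda>x::real. sin x / x) \<longlongrightarrow> 1) (at 0)" 
    using DERIV_sin[of "0::real"] by (simp add: DERIV_def)
  then have "eventually (\<lambda>x. sin x / x > 1 / (1 + r)) (at (0::real))"
    using assms by (intro order_tendstoD) auto
  then obtain d where d: "d > 0" "\<And>x. x \<noteq> 0 \<Longrightarrow> dist x 0 < d \<Longrightarrow> sin x / x > 1 / (1 + r)"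
    unfolding eventually_at by auto
  \<comment> \<open>Below pi / 2 the sine is increasing, so a chord shorter than
    \<open>2 * sin d'\<close> forces the half angle below \<open>d'\<close>.\<close>
  define d' where "d' = min d 1 / 2"
  have d': "0 < d'" "d' < d" "d' < pi / 2" using d pi_gt3 by (auto simp: d'_def)
  have small: "x \<le> (1 + r) * sin x" if "0 \<le> x" "x < d" for x
  proof (cases "x = 0")
    case False
    then show ?thesis using d(2)[of x] that assms by (auto simp: field_simps)
  qed simp
  show thesis
  proof (rule that[of "2 * sin d'"])
    show "2 * sin d' > 0" using d' by (simp add: sin_gt_zero)
    fix e f :: "real^3" assume ef: "norm e = 1" "norm f = 1" "norm (e - f) < 2 * sin d'"
    have b: "\<bar>e \<bullet> f\<bar> \<le> 1" using Cauchy_Schwarz_ineq2[of e f] ef by simp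
    let ?t = "arccos (e \<bullet> f)"
    have t: "0 \<le> ?t" "?t \<le> pi"
      using b by (auto simp: abs_le_iff arccos_lbound arccos_ubound)
    have "sin (?t / 2) < sin d'" using ef norm_diff_unit by simp
    then have "?t / 2 < d'" using sin_monotone_2pi_le[of d' "?t / 2"] t d' by force
    then have "?t / 2 \<le> (1 + r) * sin (?t / 2)" using small[of "?t / 2"] t(1) d'(2) by linarith
    then show "?t \<le> (1 + r) * norm (e - f)" using norm_diff_unit[OF ef(1,2)] by simp
  qed
qed

context sphere_curve
begin

abbreviation "len \<equiv> integral {a..b} (\<lambda>t. norm (E' t))"
abbreviation "node N j \<equiv> E (grid a b N j)"
abbreviation "angles N \<equiv> \<Sum>j<N. arccos (node N j \<bullet> node N (Suc j))"

lemma len_sum: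
  assumes "N > 0"
  shows "(\<Sum>j<N. integral {grid a b N j..grid a b N (Suc j)} (\<lambda>t. norm (E' t))) = len"
  using sum_integral_consecutive[of N "grid a b N" "\<lambda>t. norm (E' t)"] grid_mono[of a b _ _ N] ab assms
    integrable_norm by auto

lemma grid_bounds:
  assumes "j < N"
  shows "a \<le> grid a b N j" "grid a b N j \<le> grid a b N (Suc j)" "grid a b N (Suc j) \<le> b"
  using assms ab grid_in[of a b j N] grid_in[of a b "Suc j" N] grid_mono[of a b j "Suc j" N] by auto

lemma unit_node: "j \<le> N \<Longrightarrow> norm (node N j) = 1"
  using grid_in[of a b j N] ab by (auto intro: unit)

lemma mesh_tendsto: "\<delta> > 0 \<Longrightarrow> eventually (\<lambda>N. N > 0 \<and> (b - a) / real N < \<delta>) sequentially"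
  using lim_const_over_n[of "b - a"] eventually_gt_at_top[of 0]
  by (auto intro!: eventually_conj order_tendstoD(2)[where y = 0])

lemma angles_le:
  assumes "r > 0"
  shows "eventually (\<lambda>N. angles N \<le> (1 + r) * len) sequentially"
proof -
  obtain \<eta> where \<eta>: "\<eta> > 0" and ang: "\<And>e f :: real^3. norm e = 1 \<Longrightarrow> norm f = 1 \<Longrightarrow> norm (e - f) < \<eta> \<Longrightarrow>
       arccos (e \<bullet> f) \<le> (1 + r) * norm (e - f)"
    using angle_le_chord[OF assms] by metis
  have "uniformly_continuous_on {a..b} E"
    using cont by (simp add: compact_uniformly_continuous)
  then obtain \<delta> where \<delta>: "\<delta> > 0" "\<And>s t. s \<in> {a..b} \<Longrightarrow> t \<in> {a..b} \<Longrightarrow> dist t s < \<delta> \<Longrightarrow> dist (E t) (E s) < \<eta>"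
    using \<eta> unfolding uniformly_continuous_on_def by metis
  show ?thesis
    using mesh_tendsto[OF \<delta>(1)]
  proof eventually_elim
    case (elim N)
    have "arccos (node N j \<bullet> node N (Suc j)) \<le>
        (1 + r) * integral {grid a b N j..grid a b N (Suc j)} (\<lambda>t. norm (E' t))" if "j < N" for j
    proof -
      note g = grid_bounds[OF that]
      have "dist (node N j) (node N (Suc j)) < \<eta>"
        using g elim grid_step[of a b N j] by (intro \<delta>(2)) (auto simp: dist_real_def)
      then have "arccos (node N j \<bullet> node N (Suc j)) \<le> (1 + r) * norm (node N j - node N (Suc j))"
        using that by (intro ang unit_node) (auto simp: dist_norm)
      also have "\<dots> \<le> (1 + r) * integral {grid a b N j..grid a b N (Suc j)} (\<lambda>t. norm (E' t))"
        using assms by (intro mult_left_mono chord_le g) auto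
      finally show ?thesis .
    qed
    then have "angles N \<le> (\<Sum>j<N. (1 + r) * integral {grid a b N j..grid a b N (Suc j)} (\<lambda>t. norm (E' t)))"
      by (intro sum_mono) auto
    then show ?case using len_sum elim by (simp flip: sum_distrib_left)
  qed
qed

lemma angles_ge:
  assumes "r > 0"
  shows "eventually (\<lambda>N. len - r \<le> angles N) sequentially"
proof -
  \<comment> \<open>With this rate each of the \<open>N\<close> steps, of length
    \<open>(b - a) / N\<close>, loses \<open>r / N\<close>, so the total loss is
    \<open>r\<close>.\<close>
  have "r / (2 * (b - a)) > 0" using assms ab by simp
  then obtain \<delta> where \<delta>: "\<delta> > 0"
    "\<And>c d. a \<le> c \<Longrightarrow> c \<le> d \<Longrightarrow> d \<le> b \<Longrightarrow> d - c < \<delta> \<Longrightarrow>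
       integral {c..d} (\<lambda>t. norm (E' t)) - 2 * (r / (2 * (b - a))) * (d - c) \<le> norm (E c - E d)"
    using chord_ge by metis
  show ?thesis
    using mesh_tendsto[OF \<delta>(1)]
  proof eventually_elim
    case (elim N)
    have "integral {grid a b N j..grid a b N (Suc j)} (\<lambda>t. norm (E' t)) - r / N
        \<le> arccos (node N j \<bullet> node N (Suc j))" if "j < N" for j
    proof -
      note g = grid_bounds[OF that]
      have "integral {grid a b N j..grid a b N (Suc j)} (\<lambda>t. norm (E' t)) - r / N \<le> norm (node N j - node N (Suc j))"
      proof -
        have "2 * (r / (2 * c)) * (c / real N) = r / N" if "c \<noteq> 0" for c using that by simp
        from this[of "b - a"] have "2 * (r / (2 * (b - a))) * ((b - a) / real N) = r / N" using ab by simp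
        then show ?thesis using \<delta>(2)[OF g] elim unfolding grid_step by simp
      qed
      also have "\<dots> \<le> arccos (node N j \<bullet> node N (Suc j))"
        using that by (intro chord_le_angle unit_node) auto
      finally show ?thesis .
    qed
    then have "(\<Sum>j<N. integral {grid a b N j..grid a b N (Suc j)} (\<lambda>t. norm (E' t)) - r / N) \<le> angles N"
      by (intro sum_mono) auto
    then show ?case using len_sum[of N] elim by (simp add: sum_subtractf)
  qed
qed

end

section \<open>Sign changes seen by a grid\<close>

text \<open>Counts strict sign changes over successive intervals, which may share endpoints. Unlike
  zeros, which can be tangential, strict sign changes survive sampling on a fine grid.\<close>

definition crosses :: "(real \<Rightarrow> real) \<Rightarrow> nat \<Rightarrow> real \<Rightarrow> real \<Rightarrow> bool" where
  "crosses h m a b \<longleftrightarrow> (\<exists>p q. (\<forall>i<m. a \<le> p i \<and> p i < q i \<and> q i \<le> b \<and> h (p i) * h (q i) < 0) \<and>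
     (\<forall>i j. i < j \<longrightarrow> j < m \<longrightarrow> q i \<le> p j))"

lemma discrete_sign_change:
  fixes u :: "nat \<Rightarrow> real"
  assumes "u k * u l < 0" "k \<le> l"
  obtains j where "k \<le> j" "j < l" "u j * u (Suc j) \<le> 0"
proof -
  have "\<exists>j. k \<le> j \<and> j < l \<and> u j * u (Suc j) \<le> 0"
  proof (rule ccontr)
    assume c: "\<not> ?thesis"
    have "u k * u j > 0" if "k \<le> j" "j \<le> l" for j
      using that
    proof (induction j rule: dec_induct)
      case base
      then show ?case using assms by (auto simp: zero_less_mult_iff mult_less_0_iff)
    next
      case (step j)
      then have "u k * u j > 0" "j < l" by auto
      moreover have "u j * u (Suc j) > 0" using c step(1) \<open>j < l\<close> by (meson not_le)
      ultimately have "u k * u j > 0" "u j * u (Suc j) > 0" by auto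
      then show ?case by (auto simp: zero_less_mult_iff)
    qed
    then show False using assms by force
  qed
  then show thesis using that by blast
qed

text \<open>Nodes just inside \<open>p\<close> and \<open>q\<close> eventually inherit the opposite
  strict signs by continuity; among the nodes between them some consecutive pair must change sign or
  touch zero.\<close>

lemma grid_sign_change:
  fixes h :: "real \<Rightarrow> real"
  assumes ab: "a < b" and h: "continuous_on {a..b} h"
    and pq: "a \<le> p" "p < q" "q \<le> b" "h p * h q < 0"
  shows "eventually (\<lambda>N. \<exists>j<N. p \<le> grid a b N j \<and> grid a b N (Suc j) \<le> q \<and>
            h (grid a b N j) * h (grid a b N (Suc j)) \<le> 0) sequentially"
proof -
  \<comment> \<open>\<open>k N\<close> indexes the first node at or after \<open>p\<close>,
    \<open>l N\<close> the last node at or before \<open>q\<close>.\<close>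
  define k where "k N = nat \<lceil>(p - a) * real N / (b - a)\<rceil>" for N
  define l where "l N = nat \<lfloor>(q - a) * real N / (b - a)\<rfloor>" for N
  have k0: "0 \<le> (p - a) * real N / (b - a)" and l0: "0 \<le> (q - a) * real N / (b - a)" for N
    using pq ab by auto
  have k: "(p - a) * real N / (b - a) \<le> real (k N)" "real (k N) \<le> (p - a) * real N / (b - a) + 1" for N
    using k0[of N] unfolding k_def by linarith+
  have l: "real (l N) \<le> (q - a) * real N / (b - a)" "(q - a) * real N / (b - a) \<le> real (l N) + 1" for N
    using l0[of N] unfolding l_def by linarith+
  have grid_eq: "grid a b N j = a + (b - a) / N * j" for N j by (simp add: grid_def)
  have cancel: "(b - a) / N * ((x - a) * real N / (b - a)) = x - a" if "N > 0" for N x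
    using that ab by simp
  have gk: "p \<le> grid a b N (k N)" "grid a b N (k N) \<le> p + (b - a) / N" if "N > 0" for N
    using mult_left_mono[OF k(1)[of N], of "(b - a) / N"] mult_left_mono[OF k(2)[of N], of "(b - a) / N"] ab that
    unfolding grid_eq distrib_left cancel[OF that] by auto
  have gl: "grid a b N (l N) \<le> q" "q - (b - a) / N \<le> grid a b N (l N)" if "N > 0" for N
    using mult_left_mono[OF l(1)[of N], of "(b - a) / N"] mult_left_mono[OF l(2)[of N], of "(b - a) / N"] ab that
    unfolding grid_eq distrib_left cancel[OF that] by auto
  have lN: "l N \<le> N" for N
  proof -
    have "(q - a) * real N / (b - a) \<le> real N" using pq ab by (simp add: field_simps mult_right_mono)
    then show ?thesis using l(1)[of N] by linarith
  qed
  have ev: "eventually (\<lambda>N. N > 0) sequentially" by (rule eventually_gt_at_top)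
  have tk: "(\<lambda>N. grid a b N (k N)) \<longlonglongrightarrow> p"
  proof (rule tendsto_sandwich[of "\<lambda>_. p" _ _ "\<lambda>N. p + (b - a) / real N"])
    show "(\<lambda>N. p + (b - a) / real N) \<longlonglongrightarrow> p"
      using tendsto_add[OF tendsto_const[of p] lim_const_over_n[of "b - a"]] by simp
    show "eventually (\<lambda>N. p \<le> grid a b N (k N)) sequentially"
      using ev by eventually_elim (rule gk)
    show "eventually (\<lambda>N. grid a b N (k N) \<le> p + (b - a) / real N) sequentially"
      using ev by eventually_elim (rule gk)
  qed simp
  have tl: "(\<lambda>N. grid a b N (l N)) \<longlonglongrightarrow> q"
  proof (rule tendsto_sandwich[of "\<lambda>N. q - (b - a) / real N" _ _ "\<lambda>_. q"])
    show "(\<lambda>N. q - (b - a) / real N) \<longlonglongrightarrow> q"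
      using tendsto_diff[OF tendsto_const[of q] lim_const_over_n[of "b - a"]] by simp
    show "eventually (\<lambda>N. q - (b - a) / real N \<le> grid a b N (l N)) sequentially"
      using ev by eventually_elim (rule gl)
    show "eventually (\<lambda>N. grid a b N (l N) \<le> q) sequentially"
      using ev by eventually_elim (rule gl)
  qed simp
  have less: "eventually (\<lambda>N. grid a b N (k N) < grid a b N (l N)) sequentially"
  proof -
    have "eventually (\<lambda>N. grid a b N (k N) < (p + q) / 2) sequentially"
      using pq by (intro order_tendstoD[OF tk]) auto
    moreover have "eventually (\<lambda>N. (p + q) / 2 < grid a b N (l N)) sequentially"
      using pq by (intro order_tendstoD[OF tl]) auto
    ultimately show ?thesis by eventually_elim simp
  qed
  have ins: "eventually (\<lambda>N. grid a b N (k N) \<in> {a..b} \<and> grid a b N (l N) \<in> {a..b}) sequentially"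
    using less ev
  proof eventually_elim
    case (elim N)
    show ?case using gk(1)[OF elim(2)] gl(1)[OF elim(2)] elim(1) pq by auto
  qed
  have in1: "eventually (\<lambda>N. grid a b N (k N) \<in> {a..b}) sequentially"
    and in2: "eventually (\<lambda>N. grid a b N (l N) \<in> {a..b}) sequentially"
    using ins by (auto elim: eventually_mono)
  have "(\<lambda>N. h (grid a b N (k N))) \<longlonglongrightarrow> h p"
    by (rule continuous_on_tendsto_compose[OF h tk _ in1]) (use pq in auto)
  moreover have "(\<lambda>N. h (grid a b N (l N))) \<longlonglongrightarrow> h q"
    by (rule continuous_on_tendsto_compose[OF h tl _ in2]) (use pq in auto)
  ultimately have "(\<lambda>N. h (grid a b N (k N)) * h (grid a b N (l N))) \<longlonglongrightarrow> h p * h q"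
    by (rule tendsto_mult)
  then have "eventually (\<lambda>N. h (grid a b N (k N)) * h (grid a b N (l N)) < 0) sequentially"
    using pq by (intro order_tendstoD) auto
  then show ?thesis using less ev
  proof eventually_elim
    case (elim N)
    have kl: "k N \<le> l N" using elim grid_le_iff[OF ab, of N "k N" "l N"] by simp
    obtain j where j: "k N \<le> j" "j < l N" "h (grid a b N j) * h (grid a b N (Suc j)) \<le> 0"
      using discrete_sign_change[of "\<lambda>j. h (grid a b N j)", OF elim(1) kl] by metis
    have "p \<le> grid a b N j" using gk(1)[OF elim(3)] grid_mono[of a b "k N" j N] j ab by auto
    moreover have "grid a b N (Suc j) \<le> q" using gl(1)[OF elim(3)] grid_mono[of a b "Suc j" "l N" N] j ab by auto
    ultimately show ?case using j lN[of N] by (intro exI[of _ j]) auto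
  qed
qed

text \<open>The finitely many intervals each acquire a grid step of their own; since the intervals
  are ordered, the steps are distinct.\<close>

lemma crosses_grid:
  assumes ab: "a < b" and h: "continuous_on {a..b} h" and c: "crosses h m a b"
  shows "eventually (\<lambda>N. m \<le> card {j\<in>{..<N}. h (grid a b N j) * h (grid a b N (Suc j)) \<le> 0}) sequentially"
proof -
  obtain p q where pq: "\<And>i. i < m \<Longrightarrow> a \<le> p i \<and> p i < q i \<and> q i \<le> b \<and> h (p i) * h (q i) < 0"
    and dis: "\<And>i j. i < j \<Longrightarrow> j < m \<Longrightarrow> q i \<le> p j"
    using c unfolding crosses_def by blast
  have "eventually (\<lambda>N. \<forall>i\<in>{..<m}. \<exists>j<N. p i \<le> grid a b N j \<and> grid a b N (Suc j) \<le> q i \<and>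
            h (grid a b N j) * h (grid a b N (Suc j)) \<le> 0) sequentially"
    using pq by (intro eventually_ball_finite) (auto intro!: grid_sign_change[OF ab h])
  then show ?thesis using eventually_gt_at_top[of 0]
  proof eventually_elim
    case (elim N)
    then obtain J where J: "\<And>i. i < m \<Longrightarrow> J i < N \<and> p i \<le> grid a b N (J i) \<and> grid a b N (Suc (J i)) \<le> q i \<and>
            h (grid a b N (J i)) * h (grid a b N (Suc (J i))) \<le> 0"
      by (metis lessThan_iff)
    have lt: "J i < J i'" if "i < i'" "i' < m" for i i'
    proof -
      have "grid a b N (Suc (J i)) \<le> grid a b N (J i')"
        using J[of i] J[of i'] dis[of i i'] that by auto
      then show ?thesis using grid_le_iff[OF ab elim(2)] by auto
    qed
    have "inj_on J {..<m}"
      by (rule linorder_inj_onI) (use lt in \<open>auto simp: less_imp_neq\<close>)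
    then have "card {..<m} \<le> card {j\<in>{..<N}. h (grid a b N j) * h (grid a b N (Suc j)) \<le> 0}"
      using J by (intro card_inj_on_le[of J]) auto
    then show ?case by simp
  qed
qed

lemma sum_indicator_card:
  "finite J \<Longrightarrow> (\<Sum>j\<in>J. indicat_real (C j) x) = real (card {j\<in>J. x \<in> C j})"
  by (simp add: indicator_def sum.If_cases Int_def)

context sphere_curve
begin

lemma inner_cont: "continuous_on {a..b} (\<lambda>t. \<xi> \<bullet> E t)"
  by (intro continuous_intros cont)

text \<open>Integrating over \<xi> the number of polygon sides that the plane of \<xi> separates
  gives the density times the sum of angles. On \<open>A\<close> this number is eventually at least
  \<open>m\<close>, so passing to the limit in the integral gives the bound.\<close>

theorem Crofton_length_ge:
  assumes A: "A \<in> lmeasurable" "A \<subseteq> ball 0 1"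
    and cr: "\<And>\<xi>. \<xi> \<in> A \<Longrightarrow> crosses (\<lambda>t. \<xi> \<bullet> E t) m a b"
  shows "real m * measure lebesgue A \<le> lune_density * len"
proof -
  define S where "S N \<xi> = (\<Sum>j<N. indicat_real (clune (node N j) (node N (Suc j))) \<xi>)" for N \<xi>
  have clm: "clune e f \<in> sets lebesgue" for e f using clune_lmeasurable by auto
  have Sm: "S N \<in> borel_measurable lebesgue" for N
    unfolding S_def using clm by measurable
  have Si: "integrable lebesgue (S N)" for N
    unfolding S_def using clune_lmeasurable by (intro Bochner_Integration.integrable_sum integrable_real_indicator) (auto simp: fmeasurable_def simp del: emeasure_completion)
  have Ai: "integrable lebesgue (\<lambda>\<xi>. real m * indicat_real A \<xi>)"
    using A by (auto simp: fmeasurable_def)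
  have Sint: "integral\<^sup>L lebesgue (S N) = lune_density * angles N" for N
  proof -
    have "integral\<^sup>L lebesgue (S N) = (\<Sum>j<N. measure lebesgue (clune (node N j) (node N (Suc j))))"
      unfolding S_def using clune_lmeasurable
      by (subst Bochner_Integration.integral_sum) (auto simp: fmeasurable_def simp del: emeasure_completion)
    also have "\<dots> = (\<Sum>j<N. lune_density * arccos (node N j \<bullet> node N (Suc j)))"
    proof (rule sum.cong)
      fix j assume "j \<in> {..<N}"
      then have u: "norm (node N j) = 1" "norm (node N (Suc j)) = 1" by (auto intro: unit_node)
      then have "node N j \<noteq> 0" "node N (Suc j) \<noteq> 0" by auto
      then show "measure lebesgue (clune (node N j) (node N (Suc j))) = lune_density * arccos (node N j \<bullet> node N (Suc j))"
        using measure_clune measure_lune u by metis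
    qed simp
    finally show ?thesis by (simp add: sum_distrib_left)
  qed
  \<comment> \<open>Truncation at the desired value provides the integrable bound for dominated
    convergence, while \<open>F N \<le> S N\<close> keeps the comparison with the angles.\<close>
  define F where "F N \<xi> = min (real m * indicat_real A \<xi>) (S N \<xi>)" for N \<xi>
  have Fm: "F N \<in> borel_measurable lebesgue" for N
    unfolding F_def using Sm A by measurable
  have lim: "(\<lambda>N. integral\<^sup>L lebesgue (F N)) \<longlonglongrightarrow> integral\<^sup>L lebesgue (\<lambda>\<xi>. real m * indicat_real A \<xi>)"
  proof (rule integral_dominated_convergence[where w = "\<lambda>\<xi>. real m * indicat_real A \<xi>"])
    show "AE \<xi> in lebesgue. (\<lambda>N. F N \<xi>) \<longlonglongrightarrow> real m * indicat_real A \<xi>"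
    proof (rule AE_I2)
      fix \<xi> :: "real^3"
      have S0: "0 \<le> S N \<xi>" for N unfolding S_def by (intro sum_nonneg) auto
      have "eventually (\<lambda>N. real m * indicat_real A \<xi> \<le> S N \<xi>) sequentially"
      proof (cases "\<xi> \<in> A")
        case True
        show ?thesis
          using crosses_grid[OF ab inner_cont cr[OF True]]
        proof eventually_elim
          case (elim N)
          have "S N \<xi> = real (card {j\<in>{..<N}. (\<xi> \<bullet> node N j) * (\<xi> \<bullet> node N (Suc j)) \<le> 0})"
            unfolding S_def using True A by (subst sum_indicator_card) (auto simp: clune_def subset_iff)
          then show ?case using elim True by simp
        qed
      qed (use S0 in auto)
      then have "eventually (\<lambda>N. F N \<xi> = real m * indicat_real A \<xi>) sequentially"
        by eventually_elim (simp add: F_def)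
      then show "(\<lambda>N. F N \<xi>) \<longlonglongrightarrow> real m * indicat_real A \<xi>"
        by (rule tendsto_eventually)
    qed
    show "AE \<xi> in lebesgue. norm (F N \<xi>) \<le> real m * indicat_real A \<xi>" for N
    proof (rule AE_I2)
      fix \<xi> :: "real^3"
      have "0 \<le> S N \<xi>" unfolding S_def by (intro sum_nonneg) auto
      then show "norm (F N \<xi>) \<le> real m * indicat_real A \<xi>" by (auto simp: F_def min_def)
    qed
  qed (use Ai Fm in auto)
  have le: "real m * measure lebesgue A \<le> lune_density * ((1 + r) * len)" if "r > 0" for r
  proof -
    have "eventually (\<lambda>N. integral\<^sup>L lebesgue (F N) \<le> lune_density * ((1 + r) * len)) sequentially"
      using angles_le[OF that]
    proof eventually_elim
      case (elim N)
      have "integrable lebesgue (F N)" unfolding F_def using Ai Si by (intro integrable_min) auto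
      then have "integral\<^sup>L lebesgue (F N) \<le> integral\<^sup>L lebesgue (S N)"
        using Si by (intro integral_mono) (auto simp: F_def)
      also have "\<dots> \<le> lune_density * ((1 + r) * len)"
        unfolding Sint using elim lune_density_pos by simp
      finally show ?case .
    qed
    then show ?thesis
      using tendsto_upperbound[OF lim, of "lune_density * ((1 + r) * len)"] A by (simp add: fmeasurable_def)
  qed
  have "((\<lambda>r. lune_density * ((1 + r) * len)) \<longlongrightarrow> lune_density * ((1 + 0) * len)) (at_right 0)"
    by (intro tendsto_intros)
  moreover have "eventually (\<lambda>r. real m * measure lebesgue A \<le> lune_density * ((1 + r) * len)) (at_right 0)"
    using le by (auto simp: eventually_at_right_field intro: exI[of _ 1])
  ultimately have "real m * measure lebesgue A \<le> lune_density * ((1 + 0) * len)"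
    by (rule tendsto_lowerbound) simp
  then show ?thesis by simp
qed

text \<open>A side strictly separated by a plane contains a zero strictly inside its grid step. The
  count is therefore at most \<open>m\<close> on \<open>A\<close> and 0 elsewhere in the ball, for
  every \<open>N\<close>; only the sum of angles has to approach the length.\<close>

theorem Crofton_length_le:
  assumes A: "A \<in> lmeasurable"
    and out: "\<And>\<xi> s t. \<xi> \<in> ball 0 1 - A \<Longrightarrow> s \<in> {a..b} \<Longrightarrow> t \<in> {a..b} \<Longrightarrow> (\<xi> \<bullet> E s) * (\<xi> \<bullet> E t) \<ge> 0"
    and inA: "\<And>\<xi>. \<xi> \<in> A \<Longrightarrow> finite {t\<in>{a<..<b}. \<xi> \<bullet> E t = 0} \<and> card {t\<in>{a<..<b}. \<xi> \<bullet> E t = 0} \<le> m"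
  shows "lune_density * len \<le> real m * measure lebesgue A"
proof -
  have bound: "lune_density * angles N \<le> real m * measure lebesgue A" if N: "N > 0" for N
  proof -
    let ?S = "\<lambda>\<xi>. (\<Sum>j<N. indicat_real (lune (node N j) (node N (Suc j))) \<xi>)"
    have pw: "?S \<xi> \<le> real m * indicat_real A \<xi>" for \<xi>
    proof (cases "\<xi> \<in> A")
      case True
      let ?J = "{j\<in>{..<N}. \<xi> \<in> lune (node N j) (node N (Suc j))}"
      let ?Z = "{t\<in>{a<..<b}. \<xi> \<bullet> E t = 0}"
      have "\<exists>t. grid a b N j < t \<and> t < grid a b N (Suc j) \<and> \<xi> \<bullet> E t = 0" if "j \<in> ?J" for j
      proof -
        have jN: "j < N" and neg: "(\<xi> \<bullet> node N j) * (\<xi> \<bullet> node N (Suc j)) < 0"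
          using that by (auto simp: lune_def)
        note g = grid_bounds[OF jN]
        have c: "continuous_on {grid a b N j..grid a b N (Suc j)} (\<lambda>t. \<xi> \<bullet> E t)"
          using g by (intro continuous_on_subset[OF inner_cont]) auto
        have "\<exists>t. grid a b N j \<le> t \<and> t \<le> grid a b N (Suc j) \<and> \<xi> \<bullet> E t = 0"
        proof (cases "\<xi> \<bullet> node N j < 0")
          case True
          then show ?thesis using neg g c by (intro IVT') (auto simp: mult_less_0_iff)
        next
          case False
          then show ?thesis using neg g c by (intro IVT2') (auto simp: mult_less_0_iff)
        qed
        then obtain t where t: "grid a b N j \<le> t" "t \<le> grid a b N (Suc j)" "\<xi> \<bullet> E t = 0" by blast
        moreover have "t \<noteq> grid a b N j" "t \<noteq> grid a b N (Suc j)" using neg t(3) by auto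
        ultimately show ?thesis by (intro exI[of _ t]) auto
      qed
      then have "\<exists>z. \<forall>j\<in>?J. grid a b N j < z j \<and> z j < grid a b N (Suc j) \<and> \<xi> \<bullet> E (z j) = 0"
        by (intro bchoice) blast
      then obtain z where z: "\<And>j. j \<in> ?J \<Longrightarrow> grid a b N j < z j \<and> z j < grid a b N (Suc j) \<and> \<xi> \<bullet> E (z j) = 0"
        by blast
      have "z i < z j" if "i < j" "i \<in> ?J" "j \<in> ?J" for i j
        using z[OF that(2)] z[OF that(3)] grid_mono[of a b "Suc i" j N] that(1) ab by auto
      then have "inj_on z ?J"
        by (intro linorder_inj_onI) (auto simp: less_imp_neq)
      moreover have "z ` ?J \<subseteq> ?Z"
      proof
        fix t assume "t \<in> z ` ?J"
        then obtain j where j: "j \<in> ?J" "t = z j" by blast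
        then have "j < N" by auto
        then show "t \<in> ?Z" using z[OF j(1)] j(2) grid_bounds[of j N] by auto
      qed
      ultimately have "card ?J \<le> card ?Z"
        using inA[OF True] by (intro card_inj_on_le[of z]) auto
      then have "card ?J \<le> m" using inA[OF True] by linarith
      then show ?thesis
        using True by (simp add: sum_indicator_card)
    next
      case False
      have "\<xi> \<notin> lune (node N j) (node N (Suc j))" if "j < N" for j
      proof
        assume "\<xi> \<in> lune (node N j) (node N (Suc j))"
        then have "(\<xi> \<bullet> node N j) * (\<xi> \<bullet> node N (Suc j)) < 0" "\<xi> \<in> ball 0 1" by (auto simp: lune_def)
        then show False
          using out[of \<xi> "grid a b N j" "grid a b N (Suc j)"] False grid_bounds[OF that] by auto
      qed
      then show ?thesis using False by simp
    qed
    have "lune_density * angles N = (\<Sum>j<N. measure lebesgue (lune (node N j) (node N (Suc j))))"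
      unfolding sum_distrib_left
      by (intro sum.cong refl measure_lune[symmetric] unit_node) auto
    also have "\<dots> = integral\<^sup>L lebesgue ?S"
      using lune_lmeasurable
      by (subst Bochner_Integration.integral_sum) (auto simp: fmeasurable_def simp del: emeasure_completion)
    also have "\<dots> \<le> integral\<^sup>L lebesgue (\<lambda>\<xi>. real m * indicat_real A \<xi>)"
    proof (rule integral_mono)
      show "integrable lebesgue ?S"
        using lune_lmeasurable by (intro Bochner_Integration.integrable_sum integrable_real_indicator) (auto simp: fmeasurable_def simp del: emeasure_completion)
      show "integrable lebesgue (\<lambda>\<xi>. real m * indicat_real A \<xi>)"
        using A by (auto simp: fmeasurable_def)
    qed (rule pw)
    also have "\<dots> = real m * measure lebesgue A" using A by (simp add: fmeasurable_def)
    finally show ?thesis .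
  qed
  have le: "lune_density * (len - r) \<le> real m * measure lebesgue A" if "r > 0" for r
  proof -
    have "eventually (\<lambda>N. N > 0 \<and> len - r \<le> angles N) sequentially"
      using angles_ge[OF that] eventually_gt_at_top[of 0] by eventually_elim auto
    then obtain N where "N > 0" "len - r \<le> angles N"
      using eventually_happens[of _ sequentially] by auto
    then show ?thesis
      using bound[of N] mult_left_mono[of "len - r" "angles N" lune_density] lune_density_pos by linarith
  qed
  have "((\<lambda>r. lune_density * (len - r)) \<longlongrightarrow> lune_density * (len - 0)) (at_right 0)"
    by (intro tendsto_intros)
  moreover have "eventually (\<lambda>r. lune_density * (len - r) \<le> real m * measure lebesgue A) (at_right 0)"
    using le by (auto simp: eventually_at_right_field intro: exI[of _ 1])
  ultimately have "lune_density * (len - 0) \<le> real m * measure lebesgue A"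
    by (rule tendsto_upperbound) simp
  then show ?thesis by simp
qed

end

section \<open>The boundary of \<open>\<Omega>\<^sub>+\<close>\<close>

text \<open>The derivative of \<open>x / |x|\<close> in direction \<open>v\<close>: the component of
  \<open>v\<close> orthogonal to \<open>x\<close>, divided by \<open>|x|\<close>.\<close>

definition sph_deriv :: "'a::real_inner \<Rightarrow> 'a \<Rightarrow> 'a" where
  "sph_deriv x v = v /\<^sub>R norm x - ((x \<bullet> v) / norm x ^ 3) *\<^sub>R x"

lemma has_vector_derivative_sph:
  fixes X :: "real \<Rightarrow> 'a::real_inner"
  assumes X: "(X has_vector_derivative X') (at t within S)" and nz: "X t \<noteq> 0"
  shows "((\<lambda>s. X s /\<^sub>R norm (X s)) has_vector_derivative sph_deriv (X t) X') (at t within S)"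
proof -
  have 1: "((\<lambda>s. norm (X s)) has_derivative (\<lambda>h. (h *\<^sub>R X') \<bullet> sgn (X t))) (at t within S)"
    by (rule has_derivative_compose[OF X[unfolded has_vector_derivative_def] has_derivative_norm[OF nz]])
  then have "((\<lambda>s. norm (X s)) has_field_derivative (X' \<bullet> X t) / norm (X t)) (at t within S)"
    unfolding has_field_derivative_def
    by (rule has_derivative_eq_rhs) (auto simp: sgn_div_norm fun_eq_iff divide_inverse)
  then have "((\<lambda>s. inverse (norm (X s))) has_field_derivative
      - (inverse (norm (X t)) * ((X' \<bullet> X t) / norm (X t)) * inverse (norm (X t)))) (at t within S)"
    using nz by (intro DERIV_inverse') auto
  then have "((\<lambda>s. inverse (norm (X s)) *\<^sub>R X s) has_vector_derivative
      inverse (norm (X t)) *\<^sub>R X' + (- (inverse (norm (X t)) * ((X' \<bullet> X t) / norm (X t)) * inverse (norm (X t)))) *\<^sub>R X t)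
     (at t within S)"
    by (rule has_vector_derivative_scaleR[OF _ X])
  then show ?thesis
    by (rule has_vector_derivative_eq_rhs)
       (simp add: sph_deriv_def inner_commute divide_inverse power3_eq_cube power_inverse mult_ac)
qed

text \<open>The root is the area of the parallelogram spanned by \<open>x\<close> and
  \<open>v\<close> (Gram determinant).\<close>

lemma norm_sph_deriv:
  assumes "x \<noteq> 0"
  shows "norm (sph_deriv x v) = sqrt ((norm x)\<^sup>2 * (norm v)\<^sup>2 - (x \<bullet> v)\<^sup>2) / (norm x)\<^sup>2"
proof -
  have n: "norm x > 0" using assms by simp
  have "(norm (sph_deriv x v))\<^sup>2 = (norm v)\<^sup>2 / (norm x)\<^sup>2 - (x \<bullet> v)\<^sup>2 / (norm x) ^ 4"
  proof -
    have "(norm (p *\<^sub>R v - q *\<^sub>R x))\<^sup>2 = p\<^sup>2 * (norm v)\<^sup>2 - 2 * p * q * (x \<bullet> v) + q\<^sup>2 * (norm x)\<^sup>2" for p q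
      by (simp add: power2_norm_eq_inner inner_diff_left inner_diff_right inner_commute[of v x])
         (simp add: power2_eq_square algebra_simps)
    from this[of "inverse (norm x)" "(x \<bullet> v) / norm x ^ 3"] show ?thesis
      using n unfolding sph_deriv_def by (simp add: field_simps eval_nat_numeral)
  qed
  also have "\<dots> = ((norm x)\<^sup>2 * (norm v)\<^sup>2 - (x \<bullet> v)\<^sup>2) / ((norm x)\<^sup>2)\<^sup>2"
    using n by (simp add: field_simps eval_nat_numeral)
  finally have "norm (sph_deriv x v) = sqrt (((norm x)\<^sup>2 * (norm v)\<^sup>2 - (x \<bullet> v)\<^sup>2) / ((norm x)\<^sup>2)\<^sup>2)"
    by (metis norm_ge_zero real_sqrt_unique)
  then show ?thesis by (simp only: real_sqrt_divide real_sqrt_abs abs_power2)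
qed

text \<open>Carries the triples of \<open>xvec\<close> isometrically into \<open>real^3\<close>,
  where the lunes and their volumes are defined.\<close>

definition emb :: "real \<times> real \<times> real \<Rightarrow> real^3" where
  "emb p = vector [fst p, fst (snd p), snd (snd p)]"

lemma inner_emb: "\<xi> \<bullet> emb (p, q, r) = \<xi>$1 * p + \<xi>$2 * q + \<xi>$3 * r"
  by (simp add: emb_def inner_vec_def sum_3)

lemma norm_emb [simp]: "norm (emb p) = norm p"
  by (cases p rule: prod_cases3)
     (simp add: emb_def norm_vec_def L2_set_def sum_3 norm_Pair power2_eq_square)

lemma linear_emb: "linear emb"
  by (rule linearI) (auto simp: emb_def vec_eq_iff forall_3)

lemma bounded_linear_emb: "bounded_linear emb"
  using linear_emb by (rule linear_conv_bounded_linear[THEN iffD1])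

lemma sphere_curve_normalized:
  fixes X X' :: "real \<Rightarrow> real \<times> real \<times> real"
  assumes "a < b"
    and X: "\<And>t. t \<in> {a..b} \<Longrightarrow> (X has_vector_derivative X' t) (at t within {a..b})"
    and nz: "\<And>t. t \<in> {a..b} \<Longrightarrow> X t \<noteq> 0"
    and X': "continuous_on {a..b} X'"
  shows "sphere_curve (\<lambda>t. emb (X t /\<^sub>R norm (X t))) (\<lambda>t. emb (sph_deriv (X t) (X' t))) a b"
proof
  have cX: "continuous_on {a..b} X" using X by (rule continuous_on_vector_derivative)
  show "continuous_on {a..b} (\<lambda>t. emb (sph_deriv (X t) (X' t)))"
    unfolding sph_deriv_def using nz
    by (intro linear_continuous_on_compose[OF _ linear_emb] continuous_intros cX X') auto
  show "norm (emb (X t /\<^sub>R norm (X t))) = 1" if "t \<in> {a..b}" for t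
    using nz[OF that] by simp
  show "((\<lambda>t. emb (X t /\<^sub>R norm (X t))) has_vector_derivative emb (sph_deriv (X t) (X' t))) (at t within {a..b})"
    if "t \<in> {a..b}" for t
    by (rule bounded_linear.has_vector_derivative[OF bounded_linear_emb has_vector_derivative_sph[OF X[OF that] nz[OF that]]])
qed (use assms in auto)

text \<open>Indices are shifted by one against the quadratic polynomial of the overview. Directions
  with \<open>\<xi>$3 = 0\<close> and \<open>\<xi>$2 \<noteq> 0\<close> belong to it: one root is
  then at infinity.\<close>

definition hyp_dirs :: "(real^3) set" where
  "hyp_dirs = {\<xi> \<in> ball 0 1. 4 * \<xi>$1 * \<xi>$3 < (\<xi>$2)\<^sup>2}"

lemma hyp_dirs_lmeasurable: "hyp_dirs \<in> lmeasurable"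
proof -
  have "open {\<xi>::real^3. 4 * \<xi>$1 * \<xi>$3 < (\<xi>$2)\<^sup>2}"
    by (intro open_Collect_less continuous_intros)
  then have "open (ball 0 1 \<inter> {\<xi>::real^3. 4 * \<xi>$1 * \<xi>$3 < (\<xi>$2)\<^sup>2})"
    by (intro open_Int open_ball)
  moreover have eq: "hyp_dirs = ball 0 1 \<inter> {\<xi>. 4 * \<xi>$1 * \<xi>$3 < (\<xi>$2)\<^sup>2}"
    by (auto simp: hyp_dirs_def)
  moreover have "bounded (ball 0 1 \<inter> {\<xi>::real^3. 4 * \<xi>$1 * \<xi>$3 < (\<xi>$2)\<^sup>2})"
    by (rule bounded_subset[OF bounded_ball]) auto
  ultimately show ?thesis by (simp add: lmeasurable_open)
qed

text \<open>With u = tan \<theta> this is cos^2 \<theta> times (1, u, u^2). Half a turn of \<theta>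
  traces the boundary of the cone once, and the point (0, 0, 1), where u is infinite, becomes
  regular.\<close>

definition conic :: "real \<Rightarrow> real \<times> real \<times> real" where
  "conic \<theta> = ((cos \<theta>)\<^sup>2, sin \<theta> * cos \<theta>, (sin \<theta>)\<^sup>2)"

definition conic' :: "real \<Rightarrow> real \<times> real \<times> real" where
  "conic' \<theta> = (- sin (2 * \<theta>), cos (2 * \<theta>), sin (2 * \<theta>))"

lemma conic_deriv: "(conic has_vector_derivative conic' \<theta>) (at \<theta> within S)"
  unfolding conic_def[abs_def] conic'_def
  by (intro has_vector_derivative_Pair)
     (auto simp flip: has_real_derivative_iff_has_vector_derivative intro!: derivative_eq_intros
       simp: sin_double cos_double power2_eq_square)

lemma sin_cos_double_sq: "(sin \<theta>)\<^sup>2 * (cos \<theta>)\<^sup>2 = (1 - cos (4 * \<theta>)) / 8" for \<theta> :: real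
proof -
  have "cos (4 * \<theta>) = 1 - 2 * (sin (2 * \<theta>))\<^sup>2" using cos_double_sin[of "2 * \<theta>"] by simp
  moreover have "(sin (2 * \<theta>))\<^sup>2 = 4 * ((sin \<theta>)\<^sup>2 * (cos \<theta>)\<^sup>2)" by (simp add: sin_double power_mult_distrib)
  ultimately show ?thesis by simp
qed

text \<open>The angle 4 \<theta> appearing here is the integration variable \<alpha> of
  \<open>L_Omega\<close>.\<close>

lemma norm_conic: "(norm (conic \<theta>))\<^sup>2 = (7 + cos (4 * \<theta>)) / 8"
proof -
  have "(norm (conic \<theta>))\<^sup>2 = ((sin \<theta>)\<^sup>2 + (cos \<theta>)\<^sup>2)\<^sup>2 - (sin \<theta>)\<^sup>2 * (cos \<theta>)\<^sup>2"
  proof -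
    have "(norm (conic \<theta>))\<^sup>2 = ((cos \<theta>)\<^sup>2)\<^sup>2 + ((sin \<theta> * cos \<theta>)\<^sup>2 + ((sin \<theta>)\<^sup>2)\<^sup>2)"
      by (simp add: conic_def norm_Pair)
    also have "\<dots> = ((sin \<theta>)\<^sup>2 + (cos \<theta>)\<^sup>2)\<^sup>2 - (sin \<theta>)\<^sup>2 * (cos \<theta>)\<^sup>2" by algebra
    finally show ?thesis .
  qed
  then show ?thesis using sin_cos_double_sq[of \<theta>] by (simp add: field_simps)
qed

lemma conic_nz: "conic \<theta> \<noteq> 0"
proof
  assume "conic \<theta> = 0"
  then have "7 + cos (4 * \<theta>) = 0" using norm_conic[of \<theta>] by simp
  then show False using cos_ge_minus_one[of "4 * \<theta>"] by linarith
qed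

definition conic_speed :: "real \<Rightarrow> real" where
  "conic_speed \<alpha> = sqrt (5 - cos \<alpha>) / (7 + cos \<alpha>)"

lemma norm_sph_deriv_conic: "norm (sph_deriv (conic \<theta>) (conic' \<theta>)) = 4 * conic_speed (4 * \<theta>)"
proof -
  let ?s = "sin \<theta>" and ?c = "cos \<theta>"
  have "(norm (conic \<theta>))\<^sup>2 * (norm (conic' \<theta>))\<^sup>2 - (conic \<theta> \<bullet> conic' \<theta>)\<^sup>2
      = (?c^4 + ?s\<^sup>2 * ?c\<^sup>2 + ?s^4) * (8 * ?s\<^sup>2 * ?c\<^sup>2 + (?c\<^sup>2 - ?s\<^sup>2)\<^sup>2)
        - (?s * ?c * (?s\<^sup>2 - ?c\<^sup>2))\<^sup>2"
    by (simp add: conic_def conic'_def norm_Pair sin_double cos_double power_mult_distrib)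
       (simp add: power2_eq_square algebra_simps eval_nat_numeral)
  also have "\<dots> = (?s\<^sup>2 + ?c\<^sup>2)\<^sup>2 * (?s^4 + 4 * ?s\<^sup>2 * ?c\<^sup>2 + ?c^4)"
    by algebra
  also have "\<dots> = (?s\<^sup>2 + ?c\<^sup>2)\<^sup>2 + 2 * (?s\<^sup>2 * ?c\<^sup>2)"
  proof -
    have "?s^4 + 4 * ?s\<^sup>2 * ?c\<^sup>2 + ?c^4 = (?s\<^sup>2 + ?c\<^sup>2)\<^sup>2 + 2 * (?s\<^sup>2 * ?c\<^sup>2)" by algebra
    then show ?thesis by simp
  qed
  also have "\<dots> = (5 - cos (4 * \<theta>)) / 4" unfolding sin_cos_double_sq by simp
  finally show ?thesis
    by (simp only: norm_sph_deriv[OF conic_nz]) (simp add: norm_conic conic_speed_def real_sqrt_divide)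
qed

lemma conic_speed_cont: "continuous_on S conic_speed"
proof -
  have "7 + cos x \<noteq> 0" for x :: real using cos_ge_minus_one[of x] by linarith
  then show ?thesis unfolding conic_speed_def[abs_def] by (intro continuous_intros) auto
qed

lemma conic_speed_pos: "conic_speed x > 0"
  using cos_ge_minus_one[of x] cos_le_one[of x] unfolding conic_speed_def
  by (intro divide_pos_pos) (auto simp del: cos_le_one cos_ge_minus_one)

lemma conic_speed_integrable: "conic_speed integrable_on {a..b}"
  by (intro integrable_continuous_interval conic_speed_cont)

text \<open>As \<theta> runs over half a turn, \<alpha> = 4 \<theta> covers two periods of an even
  function, that is four copies of [0, pi]; this is the factor 4 in \<open>L_Omega\<close>.\<close>

lemma integral_conic_speed: "integral {-2*pi..2*pi} conic_speed = L_Omega"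
proof -
  let ?f = conic_speed
  have I: "?f integrable_on {a..b}" for a b by (rule conic_speed_integrable)
  have ev: "?f (- x) = ?f x" for x by (simp add: conic_speed_def)
  have "(?f has_integral integral {0..pi} ?f) {0..pi}" using I by (rule integrable_integral)
  then have 0: "integral {-pi..0} ?f = integral {0..pi} ?f"
    using Henstock_Kurzweil_Integration.integral_reflect_real[of pi 0 ?f] by (simp add: ev)
  have sh: "integral {c - 2*pi..d - 2*pi} ?f = integral {c..d} ?f" for c d
  proof -
    have "integral {c..d} (?f \<circ> (\<lambda>x. x + (- 2 * pi))) = integral {c + (- 2*pi)..d + (- 2*pi)} ?f"
      using integral_shift[of c "-2*pi" d ?f] conic_speed_cont by simp
    moreover have "?f \<circ> (\<lambda>x. x + (- 2 * pi)) = ?f"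
      using cos_periodic by (auto simp: fun_eq_iff conic_speed_def cos_diff)
    ultimately show ?thesis by simp
  qed
  have "integral {-2*pi..2*pi} ?f = integral {-2*pi..-pi} ?f + integral {-pi..0} ?f + integral {0..pi} ?f + integral {pi..2*pi} ?f"
    using I by (simp add: Henstock_Kurzweil_Integration.integral_combine)
  also have "integral {-2*pi..-pi} ?f = integral {0..pi} ?f" using sh[of 0 pi] by simp
  also have "integral {pi..2*pi} ?f = integral {-pi..0} ?f" using sh[of pi "2*pi"] by simp
  finally have "integral {-2*pi..2*pi} ?f = 4 * integral {0..pi} ?f" by (simp add: 0)
  then show ?thesis by (simp add: L_Omega_def conic_speed_def[abs_def])
qed

lemma L_Omega_pos: "L_Omega > 0"
proof -
  have "integral {0..pi} (\<lambda>_. 1/16) \<le> integral {0..pi} conic_speed"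
  proof (intro integral_le conic_speed_integrable integrable_const_ivl)
    fix x :: real
    have "1 \<le> 5 - cos x" using cos_le_one[of x] by linarith
    then have "1 \<le> sqrt (5 - cos x)" by (simp only: real_sqrt_ge_1_iff)
    moreover have "7 + cos x \<le> 16" "0 < 7 + cos x" using cos_le_one[of x] cos_ge_minus_one[of x] by linarith+
    ultimately show "1/16 \<le> conic_speed x" unfolding conic_speed_def by (metis frac_le zero_le_one order_trans)
  qed
  then have "pi * (1 / 16) \<le> integral {0..pi} conic_speed" by simp
  then have "0 < integral {0..pi} conic_speed" using pi_gt_zero by linarith
  then show ?thesis unfolding L_Omega_def conic_speed_def[abs_def] by simp
qed

lemma conic_speed_stretch:
  assumes "- pi / 2 \<le> a" "a \<le> b" "b \<le> pi / 2"
  shows "((\<lambda>\<theta>. 4 * conic_speed (4 * \<theta>)) has_integral integral {4*a..4*b} conic_speed) {a..b}"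
proof -
  let ?F = "\<lambda>x. integral {4*a..x} conic_speed"
  have "((\<lambda>\<theta>. ?F (4 * \<theta>)) has_vector_derivative 4 * conic_speed (4 * \<theta>)) (at \<theta> within {a..b})"
    if "\<theta> \<in> {a..b}" for \<theta>
  proof -
    have "(?F has_vector_derivative conic_speed (4 * \<theta>)) (at (4 * \<theta>) within {4*a..4*b})"
      using that by (intro integral_has_vector_derivative conic_speed_cont) auto
    then have "(?F has_vector_derivative conic_speed (4 * \<theta>)) (at (4 * \<theta>) within (*) 4 ` {a..b})"
      by simp
    moreover have "((*) 4 has_vector_derivative 4) (at \<theta> within {a..b})"
      by (auto simp flip: has_real_derivative_iff_has_vector_derivative intro!: derivative_eq_intros)
    ultimately have "((?F \<circ> (*) 4) has_vector_derivative 4 *\<^sub>R conic_speed (4 * \<theta>)) (at \<theta> within {a..b})"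
      by (intro vector_diff_chain_within)
    then show ?thesis by (simp add: o_def)
  qed
  then have "((\<lambda>\<theta>. 4 * conic_speed (4 * \<theta>)) has_integral (?F (4 * b) - ?F (4 * a))) {a..b}"
    using assms by (intro fundamental_theorem_of_calculus) auto
  then show ?thesis by simp
qed

interpretation conic: sphere_curve "\<lambda>\<theta>. emb (conic \<theta> /\<^sub>R norm (conic \<theta>))"
  "\<lambda>\<theta>. emb (sph_deriv (conic \<theta>) (conic' \<theta>))" "- pi / 2" "pi / 2"
proof (rule sphere_curve_normalized)
  show "continuous_on {- pi / 2..pi / 2} conic'"
    unfolding conic'_def[abs_def] by (intro continuous_intros)
qed (use conic_deriv conic_nz in auto)

lemma inner_conic: "\<xi> \<bullet> emb (conic \<theta> /\<^sub>R norm (conic \<theta>)) =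
   (\<xi>$1 * (cos \<theta>)\<^sup>2 + \<xi>$2 * (sin \<theta> * cos \<theta>) + \<xi>$3 * (sin \<theta>)\<^sup>2) / norm (conic \<theta>)"
proof -
  have "\<xi> \<bullet> emb (conic \<theta>) = \<xi>$1 * (cos \<theta>)\<^sup>2 + \<xi>$2 * (sin \<theta> * cos \<theta>) + \<xi>$3 * (sin \<theta>)\<^sup>2"
    by (simp add: conic_def inner_emb)
  then show ?thesis
    by (simp only: linear_scale[OF linear_emb] inner_scaleR_right divide_inverse mult.commute)
qed

text \<open>A binary form of nonpositive discriminant is semidefinite: completing the square shows
  that \<open>x\<close> and \<open>z\<close> times any value are nonnegative. If both vanish, so
  does \<open>y\<close>; otherwise a nonzero one fixes the common sign.\<close>

lemma semidefinite_form_mult_nonneg: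
  fixes x y z :: real
  assumes "y\<^sup>2 \<le> 4 * x * z"
  shows "(x * c\<^sup>2 + y * (s * c) + z * s\<^sup>2) * (x * d\<^sup>2 + y * (r * d) + z * r\<^sup>2) \<ge> 0"
    (is "?q c s * ?q d r \<ge> 0")
proof -
  have x: "x * ?q c s \<ge> 0" for c s
  proof -
    have "4 * (x * ?q c s) = (2 * x * c + y * s)\<^sup>2 + (4 * x * z - y\<^sup>2) * s\<^sup>2"
      by (simp add: power2_eq_square algebra_simps)
    moreover have "\<dots> \<ge> 0" using assms by (intro add_nonneg_nonneg mult_nonneg_nonneg) auto
    ultimately show ?thesis by linarith
  qed
  have z: "z * ?q c s \<ge> 0" for c s
  proof -
    have "4 * (z * ?q c s) = (2 * z * s + y * c)\<^sup>2 + (4 * x * z - y\<^sup>2) * c\<^sup>2"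
      by (simp add: power2_eq_square algebra_simps)
    moreover have "\<dots> \<ge> 0" using assms by (intro add_nonneg_nonneg mult_nonneg_nonneg) auto
    ultimately show ?thesis by linarith
  qed
  show ?thesis
  proof (cases "x = 0 \<and> z = 0")
    case True
    then show ?thesis using assms by simp
  next
    case False
    then obtain w where w: "w \<noteq> 0" "w * ?q c s \<ge> 0" "w * ?q d r \<ge> 0"
    proof (cases "x = 0")
      case True
      show ?thesis by (rule that[OF _ z z]) (use True False in simp)
    next
      case False
      show ?thesis by (rule that[OF False x x])
    qed
    then have "(w * ?q c s) * (w * ?q d r) \<ge> 0" by (intro mult_nonneg_nonneg[of "w * ?q c s" "w * ?q d r"])
    then have "w\<^sup>2 * 0 \<le> w\<^sup>2 * (?q c s * ?q d r)" by (simp add: power2_eq_square mult_ac)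
    then show ?thesis
      by (rule mult_left_le_imp_le) (use w(1) in simp)
  qed
qed

text \<open>Division by cos^2 \<theta> turns interior zeros into roots tan \<theta> of a nonzero
  quadratic, at most two. The endpoints, excluded from this count, both represent the direction (0,
  0, 1), where the curve closes.\<close>

lemma L_Omega_le_hyp_dirs: "lune_density * L_Omega \<le> 2 * measure lebesgue hyp_dirs"
proof -
  have len: "conic.len = L_Omega"
  proof -
    have "((\<lambda>\<theta>. 4 * conic_speed (4 * \<theta>)) has_integral L_Omega) {- pi / 2..pi / 2}"
      using conic_speed_stretch[of "- pi / 2" "pi / 2"] integral_conic_speed by simp
    then show ?thesis unfolding norm_emb norm_sph_deriv_conic by (rule integral_unique)
  qed
  have "lune_density * conic.len \<le> real 2 * measure lebesgue hyp_dirs"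
  proof (rule conic.Crofton_length_le[OF hyp_dirs_lmeasurable])
    fix \<xi> s t assume "\<xi> \<in> ball 0 1 - hyp_dirs"
    then have "(\<xi>$2)\<^sup>2 \<le> 4 * \<xi>$1 * \<xi>$3" by (auto simp: hyp_dirs_def)
    from semidefinite_form_mult_nonneg[OF this, of "cos s" "sin s" "cos t" "sin t"]
    show "(\<xi> \<bullet> emb (conic s /\<^sub>R norm (conic s))) * (\<xi> \<bullet> emb (conic t /\<^sub>R norm (conic t))) \<ge> 0"
      unfolding inner_conic times_divide_times_eq by (rule divide_nonneg_nonneg) simp
  next
    fix \<xi> assume \<xi>: "\<xi> \<in> hyp_dirs"
    let ?Z = "{\<theta> \<in> {- pi / 2<..<pi / 2}. \<xi> \<bullet> emb (conic \<theta> /\<^sub>R norm (conic \<theta>)) = 0}"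
    let ?p = "[:\<xi>$1, \<xi>$2, \<xi>$3:]"
    have p: "?p \<noteq> 0" using \<xi> by (auto simp: hyp_dirs_def)
    have sub: "tan ` ?Z \<subseteq> {x. poly ?p x = 0}"
    proof (rule image_subsetI)
      fix \<theta> assume "\<theta> \<in> ?Z"
      then have \<theta>: "- pi / 2 < \<theta>" "\<theta> < pi / 2" and z: "\<xi> \<bullet> emb (conic \<theta> /\<^sub>R norm (conic \<theta>)) = 0"
        by auto
      have c: "cos \<theta> \<noteq> 0" using \<theta> cos_gt_zero_pi[of \<theta>] by auto
      have "\<xi>$1 * (cos \<theta>)\<^sup>2 + \<xi>$2 * (sin \<theta> * cos \<theta>) + \<xi>$3 * (sin \<theta>)\<^sup>2 = 0"
        using z conic_nz[of \<theta>] unfolding inner_conic by simp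
      then have "(\<xi>$1 * (cos \<theta>)\<^sup>2 + \<xi>$2 * (sin \<theta> * cos \<theta>) + \<xi>$3 * (sin \<theta>)\<^sup>2) / (cos \<theta>)\<^sup>2 = 0" by simp
      then show "tan \<theta> \<in> {x. poly ?p x = 0}"
        using c by (simp add: tan_def power2_eq_square field_simps)
    qed
    have inj: "inj_on tan ?Z"
      by (rule inj_on_inverseI[of _ arctan]) (auto intro: arctan_tan)
    have fin: "finite {x. poly ?p x = 0}" by (rule poly_roots_finite[OF p])
    have "card ?Z \<le> card {x. poly ?p x = 0}" by (rule card_inj_on_le[OF inj sub fin])
    also have "\<dots> \<le> degree ?p" by (rule card_poly_roots_bound[OF p])
    also have "\<dots> \<le> 2" by simp
    finally have c: "card ?Z \<le> 2" .
    show "finite ?Z \<and> card ?Z \<le> 2"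
      using inj_on_finite[OF inj sub fin] c by simp
  qed
  then show ?thesis using len by simp
qed

section \<open>Lower bounds for the wandering speed\<close>

text \<open>The nonzero value between any two listed zeros rules out intervals of zeros, on which
  Rolle's theorem would give no sign change of the derivative.\<close>

definition zero_seq :: "(real \<Rightarrow> real) \<Rightarrow> nat \<Rightarrow> real \<Rightarrow> real \<Rightarrow> bool" where
  "zero_seq f m a b \<longleftrightarrow> (\<exists>r. (\<forall>i<m. a \<le> r i \<and> r i \<le> b \<and> f (r i) = 0) \<and>
     (\<forall>i j. i < j \<longrightarrow> j < m \<longrightarrow> r i < r j \<and> (\<exists>x. r i < x \<and> x < r j \<and> f x \<noteq> 0)))"

text \<open>The mean value theorem on both sides of \<open>x\<close> gives one slope with the sign
  of \<open>F x\<close> and one with the opposite sign.\<close>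

lemma deriv_sign_change_between_zeros:
  fixes F F' :: "real \<Rightarrow> real"
  assumes c: "continuous_on {u..v} F"
    and d: "\<And>t. u < t \<Longrightarrow> t < v \<Longrightarrow> (F has_real_derivative F' t) (at t)"
    and z: "F u = 0" "F v = 0" and x: "u < x" "x < v" "F x \<noteq> 0"
  obtains p q where "u < p" "p < q" "q < v" "F' p * F' q < 0"
proof -
  have d': "(F has_derivative (*) (F' t)) (at t)" if "u < t" "t < v" for t
    using d[OF that] by (simp add: has_field_derivative_def)
  obtain p where p: "u < p" "p < x" "F x - F u = F' p * (x - u)"
  proof (rule mvt[OF x(1)])
    show "continuous_on {u..x} F" using x by (intro continuous_on_subset[OF c]) auto
    show "(F has_derivative (*) (F' w)) (at w)" if "u < w" "w < x" for w
      using d'[of w] that x by auto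
  qed auto
  obtain q where q: "x < q" "q < v" "F v - F x = F' q * (v - x)"
  proof (rule mvt[OF x(2)])
    show "continuous_on {x..v} F" using x by (intro continuous_on_subset[OF c]) auto
    show "(F has_derivative (*) (F' w)) (at w)" if "x < w" "w < v" for w
      using d'[of w] that x by auto
  qed auto
  have pv: "F' p = F x / (x - u)" and qv: "F' q = - (F x / (v - x))"
    using p q x z by (auto simp: field_simps)
  have "F' p * F' q = - ((F x)\<^sup>2 / ((x - u) * (v - x)))"
    unfolding pv qv by (simp add: power2_eq_square)
  also have "\<dots> < 0" using x by simp
  finally show thesis using that p q by (metis less_trans)
qed

text \<open>The factor \<open>exp (- s * t)\<close> changes no zeros of \<open>f\<close> and turns
  \<open>f' - s * f\<close> into a derivative, up to a positive factor. One zero is lost, as in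
  Rolle's theorem.\<close>

lemma zero_seq_imp_crosses:
  assumes d: "\<And>t. t \<in> {a..b} \<Longrightarrow> (f has_real_derivative f' t) (at t within {a..b})"
    and zs: "zero_seq f (Suc m) a b"
  shows "crosses (\<lambda>t. f' t - s * f t) m a b"
proof -
  obtain r where r: "\<And>i. i < Suc m \<Longrightarrow> a \<le> r i \<and> r i \<le> b \<and> f (r i) = 0"
    and nz: "\<And>i j. i < j \<Longrightarrow> j < Suc m \<Longrightarrow> r i < r j \<and> (\<exists>x. r i < x \<and> x < r j \<and> f x \<noteq> 0)"
    using zs unfolding zero_seq_def by blast
  define F where "F t = exp (- s * t) * f t" for t
  define F' where "F' t = exp (- s * t) * (f' t - s * f t)" for t
  have dF: "(F has_real_derivative F' t) (at t within {a..b})" if "t \<in> {a..b}" for t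
    unfolding F_def F'_def by (rule derivative_eq_intros d that refl | simp add: algebra_simps)+
  have cF: "continuous_on {a..b} F"
    using dF by (meson DERIV_continuous_on)
  have "\<exists>p q. r i < p \<and> p < q \<and> q < r (Suc i) \<and> (f' p - s * f p) * (f' q - s * f q) < 0" if "i < m" for i
  proof -
    obtain x where x: "r i < x" "x < r (Suc i)" "f x \<noteq> 0" using nz[of i "Suc i"] \<open>i < m\<close> by auto
    have ri: "a \<le> r i" "r (Suc i) \<le> b" "f (r i) = 0" "f (r (Suc i)) = 0"
      using r[of i] r[of "Suc i"] that by auto
    have "(F has_real_derivative F' t) (at t)" if "r i < t" "t < r (Suc i)" for t
      using dF[of t] that ri at_within_Icc_at[of a t b] by auto
    moreover have "continuous_on {r i..r (Suc i)} F"
      using ri by (intro continuous_on_subset[OF cF]) auto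
    moreover have "F (r i) = 0" "F (r (Suc i)) = 0" "F x \<noteq> 0" using ri x by (auto simp: F_def)
    ultimately obtain p q where pq: "r i < p" "p < q" "q < r (Suc i)" "F' p * F' q < 0"
      using deriv_sign_change_between_zeros[of "r i" "r (Suc i)" F F' x] x by blast
    have "F' p * F' q = (exp (- s * p) * exp (- s * q)) * ((f' p - s * f p) * (f' q - s * f q))"
      by (simp add: F'_def)
    then have "(f' p - s * f p) * (f' q - s * f q) < 0"
      using pq(4) by (simp add: mult_less_0_iff zero_less_mult_iff)
    then show ?thesis using pq by blast
  qed
  then obtain p q where pq: "\<And>i. i < m \<Longrightarrow> r i < p i \<and> p i < q i \<and> q i < r (Suc i) \<and>
      (f' (p i) - s * f (p i)) * (f' (q i) - s * f (q i)) < 0"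
    by metis
  have "q i \<le> p j" if "i < j" "j < m" for i j
  proof -
    have "r (Suc i) \<le> r j" using nz[of "Suc i" j] that by (cases "Suc i = j") auto
    then show ?thesis using pq[of i] pq[of j] that by auto
  qed
  moreover have "a \<le> p i \<and> q i \<le> b" if "i < m" for i
    using pq[OF that] r[of i] r[of "Suc i"] that by auto
  ultimately show ?thesis unfolding crosses_def using pq by blast
qed

text \<open>The intermediate value theorem gives a zero inside each interval; its right endpoint
  \<open>q i\<close>, where \<open>h\<close> is nonzero, separates it from the later ones.\<close>

lemma crosses_imp_zero_seq:
  assumes c: "continuous_on {a..b} h" and cr: "crosses h m a b"
  shows "zero_seq h m a b"
proof -
  obtain p q where pq: "\<And>i. i < m \<Longrightarrow> a \<le> p i \<and> p i < q i \<and> q i \<le> b \<and> h (p i) * h (q i) < 0"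
    and dis: "\<And>i j. i < j \<Longrightarrow> j < m \<Longrightarrow> q i \<le> p j"
    using cr unfolding crosses_def by blast
  have "\<exists>x. p i < x \<and> x < q i \<and> h x = 0" if "i < m" for i
  proof -
    have h: "a \<le> p i" "p i < q i" "q i \<le> b" "h (p i) * h (q i) < 0" using pq[OF that] by auto
    have ci: "continuous_on {p i..q i} h" using h by (intro continuous_on_subset[OF c]) auto
    have "\<exists>x\<ge>p i. x \<le> q i \<and> h x = 0"
    proof (cases "h (p i) < 0")
      case True
      then show ?thesis using h ci by (intro IVT') (auto simp: mult_less_0_iff)
    next
      case False
      then show ?thesis using h ci by (intro IVT2') (auto simp: mult_less_0_iff)
    qed
    then obtain x where "p i \<le> x" "x \<le> q i" "h x = 0" by blast
    moreover have "x \<noteq> p i" "x \<noteq> q i" using h(4) \<open>h x = 0\<close> by auto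
    ultimately show ?thesis by (intro exI[of _ x]) auto
  qed
  then obtain r where r: "\<And>i. i < m \<Longrightarrow> p i < r i \<and> r i < q i \<and> h (r i) = 0" by metis
  have "r i < r j \<and> (\<exists>x. r i < x \<and> x < r j \<and> h x \<noteq> 0)" if "i < j" "j < m" for i j
  proof -
    have "r i < q i" "q i < r j" "h (q i) \<noteq> 0"
      using r[of i] r[of j] dis[OF that] pq[of i] that by auto
    then show ?thesis by (meson less_trans)
  qed
  moreover have "a \<le> r i \<and> r i \<le> b \<and> h (r i) = 0" if "i < m" for i
    using r[OF that] pq[OF that] by auto
  ultimately show ?thesis unfolding zero_seq_def by blast
qed

lemma finite_zeros_zero_seq:
  fixes f :: "real \<Rightarrow> real"
  assumes fin: "finite {t\<in>{a..b}. f t = 0}"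
  shows "zero_seq f (card {t\<in>{a..b}. f t = 0}) a b"
proof -
  let ?Z = "{t\<in>{a..b}. f t = 0}"
  let ?l = "sorted_list_of_set ?Z"
  have mem: "?l ! i \<in> ?Z" if "i < card ?Z" for i
  proof -
    have "?l ! i \<in> set ?l"
      by (rule nth_mem) (simp only: length_sorted_list_of_set that)
    then show ?thesis by (simp only: set_sorted_list_of_set[OF fin])
  qed
  have mono: "?l ! i < ?l ! j" if "i < j" "j < card ?Z" for i j
    by (rule sorted_wrt_nth_less[OF strict_sorted_list_of_set that(1)])
       (simp only: length_sorted_list_of_set that)
  have gap: "\<exists>x. ?l ! i < x \<and> x < ?l ! j \<and> f x \<noteq> 0" if "i < j" "j < card ?Z" for i j
  proof (rule ccontr)
    assume c: "\<not> ?thesis"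
    define u v where "u = ?l ! i" and "v = ?l ! j"
    have "u \<in> ?Z" "v \<in> ?Z" "u < v"
      unfolding u_def v_def by (fact mem[OF less_trans[OF that]] mem[OF that(2)] mono[OF that])+
    then have uv: "a \<le> u" "v \<le> b" "u < v" by auto
    have c': "f x = 0" if "u < x" "x < v" for x using c that unfolding u_def v_def by blast
    have "{u<..<v} \<subseteq> ?Z" using uv c' by auto
    then have "finite {u<..<v}" using fin by (rule finite_subset)
    then show False using infinite_Ioo[OF uv(3)] by simp
  qed
  show ?thesis
    unfolding zero_seq_def
  proof (rule exI[of _ "\<lambda>i. ?l ! i"], intro conjI allI impI)
    fix i assume "i < card ?Z"
    then have "?l ! i \<in> ?Z" by (rule mem)
    then show "a \<le> ?l ! i" "?l ! i \<le> b" "f (?l ! i) = 0"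
      by (simp_all only: mem_Collect_eq atLeastAtMost_iff)
  qed (fact mono gap)+
qed

section \<open>Uniqueness for the linear equation\<close>

text \<open>\<open>exp (- C * t) * g t\<close> does not increase and
  \<open>exp (C * t) * g t\<close> does not decrease, so a zero of the nonnegative \<open>g\<close>
  spreads forwards by the first and backwards by the second.\<close>

lemma gronwall_vanish:
  fixes g g' :: "real \<Rightarrow> real"
  assumes d: "\<And>t. 0 < t \<Longrightarrow> t < b \<Longrightarrow> (g has_real_derivative g' t) (at t)"
    and c: "continuous_on {0..b} g" and pos: "\<And>t. t \<in> {0..b} \<Longrightarrow> 0 \<le> g t"
    and bd: "\<And>t. t \<in> {0..b} \<Longrightarrow> \<bar>g' t\<bar> \<le> C * g t"
    and z: "t0 \<in> {0..b}" "g t0 = 0" and t: "t \<in> {0..b}"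
  shows "g t = 0"
proof (cases "t0 \<le> t")
  case True
  have "exp (- C * t) * g t \<le> exp (- C * t0) * g t0"
  proof (rule DERIV_nonpos_imp_decreasing_open[OF True])
    fix x assume x: "t0 < x" "x < t"
    have "((\<lambda>t. exp (- C * t) * g t) has_real_derivative exp (- C * x) * (g' x - C * g x)) (at x)"
      by (rule derivative_eq_intros d refl | use x z t in \<open>simp add: algebra_simps\<close>)+
    moreover have "exp (- C * x) * (g' x - C * g x) \<le> 0"
      using bd[of x] x z t by (intro mult_nonneg_nonpos) auto
    ultimately show "\<exists>y. ((\<lambda>t. exp (- C * t) * g t) has_real_derivative y) (at x) \<and> y \<le> 0" by blast
  qed (use z t in \<open>auto intro!: continuous_intros continuous_on_subset[OF c]\<close>)
  then have "g t \<le> 0" using z by (simp add: mult_le_0_iff)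
  then show ?thesis using pos[OF t] by simp
next
  case False
  then have le: "t \<le> t0" by simp
  have "exp (C * t) * g t \<le> exp (C * t0) * g t0"
  proof (rule DERIV_nonneg_imp_increasing_open[OF le])
    fix x assume x: "t < x" "x < t0"
    have "((\<lambda>t. exp (C * t) * g t) has_real_derivative exp (C * x) * (g' x + C * g x)) (at x)"
      by (rule derivative_eq_intros d refl | use x z t in \<open>simp add: algebra_simps\<close>)+
    moreover have "exp (C * x) * (g' x + C * g x) \<ge> 0"
      using bd[of x] x z t by (intro mult_nonneg_nonneg) auto
    ultimately show "\<exists>y. ((\<lambda>t. exp (C * t) * g t) has_real_derivative y) (at x) \<and> y \<ge> 0" by blast
  qed (use z t in \<open>auto intro!: continuous_intros continuous_on_subset[OF c]\<close>)
  then have "g t \<le> 0" using z by (simp add: mult_le_0_iff)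
  then show ?thesis using pos[OF t] by simp
qed

text \<open>The term inside the absolute value is the derivative of
  \<open>y\<^sup>2 + y'\<^sup>2 + y''\<^sup>2\<close> along a solution. Each product is estimated by
  2 |x y| <= x^2 + y^2.\<close>

lemma linear_vector_field_bound:
  fixes p q r :: real
  assumes "\<bar>a\<bar> \<le> K" "\<bar>b\<bar> \<le> K" "\<bar>c\<bar> \<le> K"
  shows "\<bar>2 * (p * q + q * r + r * (- a * r - b * q - c * p))\<bar> \<le> (2 + 4 * K) * (p\<^sup>2 + q\<^sup>2 + r\<^sup>2)"
proof -
  have am: "2 * \<bar>x * y\<bar> \<le> x\<^sup>2 + y\<^sup>2" for x y :: real
    using sum_squares_bound[of "\<bar>x\<bar>" "\<bar>y\<bar>"] by (simp add: abs_mult)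
  have K: "K \<ge> 0" using assms by linarith
  have k: "2 * \<bar>z * (x * y)\<bar> \<le> K * (x\<^sup>2 + y\<^sup>2)" if "\<bar>z\<bar> \<le> K" for x y z
  proof -
    have "2 * \<bar>z * (x * y)\<bar> = \<bar>z\<bar> * (2 * \<bar>x * y\<bar>)" by (simp add: abs_mult)
    also have "\<dots> \<le> K * (x\<^sup>2 + y\<^sup>2)" using that am K by (intro mult_mono) auto
    finally show ?thesis .
  qed
  have "2 * (p * q + q * r + r * (- a * r - b * q - c * p))
      = 2 * (p * q) + 2 * (q * r) - 2 * (a * (r * r)) - 2 * (b * (r * q)) - 2 * (c * (r * p))"
    by (simp add: algebra_simps)
  then have "\<bar>2 * (p * q + q * r + r * (- a * r - b * q - c * p))\<bar>
      \<le> 2 * \<bar>p * q\<bar> + 2 * \<bar>q * r\<bar> + 2 * \<bar>a * (r * r)\<bar> + 2 * \<bar>b * (r * q)\<bar> + 2 * \<bar>c * (r * p)\<bar>"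
    by linarith
  also have "\<dots> \<le> (p\<^sup>2 + q\<^sup>2) + (q\<^sup>2 + r\<^sup>2) + K * (r\<^sup>2 + r\<^sup>2) + K * (r\<^sup>2 + q\<^sup>2) + K * (r\<^sup>2 + p\<^sup>2)"
    by (intro add_mono am k assms)
  also have "\<dots> \<le> (2 + 4 * K) * (p\<^sup>2 + q\<^sup>2 + r\<^sup>2)"
  proof -
    have "(2 + 4 * K) * (p\<^sup>2 + q\<^sup>2 + r\<^sup>2) - ((p\<^sup>2 + q\<^sup>2) + (q\<^sup>2 + r\<^sup>2) + K * (r\<^sup>2 + r\<^sup>2) + K * (r\<^sup>2 + q\<^sup>2) + K * (r\<^sup>2 + p\<^sup>2))
       = p\<^sup>2 + r\<^sup>2 + K * (3 * p\<^sup>2 + 3 * q\<^sup>2)" by (simp add: algebra_simps)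
    moreover have "\<dots> \<ge> 0" using K by simp
    ultimately show ?thesis by linarith
  qed
  finally show ?thesis .
qed

lemma vector_derivative_Rplus:
  assumes "(f has_vector_derivative f') (at t within Rplus)" "t \<ge> 0"
  shows "vector_derivative f (at t within Rplus) = f'"
proof (rule vector_derivative_within)
  show "at t within Rplus \<noteq> bot"
  proof -
    have "{t<..<t + 1} \<subseteq> Rplus" using assms(2) by auto
    then have "t islimpt Rplus"
      using islimpt_subset islimpt_greaterThanLessThan1[of t "t + 1"] by auto
    then show ?thesis by (simp add: trivial_limit_within)
  qed
qed (rule assms)

locale ode3 =
  fixes a b c y :: "real \<Rightarrow> real"
  assumes cont: "continuous_on Rplus a" "continuous_on Rplus b" "continuous_on Rplus c"
    and sol: "is_solution a b c y"
    and nontrivial: "\<exists>t\<in>Rplus. y t \<noteq> 0"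
begin

lemma derivs:
  assumes "t \<ge> 0"
  shows "(y has_vector_derivative D1 y t) (at t within Rplus)"
    "(D1 y has_vector_derivative D2 y t) (at t within Rplus)"
    "(D2 y has_vector_derivative D3 y t) (at t within Rplus)"
    "D3 y t = - a t * D2 y t - b t * D1 y t - c t * y t"
proof -
  have "t \<in> Rplus" using assms by simp
  with sol have *: "(y has_vector_derivative D1 y t) (at t within Rplus) \<and>
        (D1 y has_vector_derivative D2 y t) (at t within Rplus) \<and>
        (D2 y has_vector_derivative D3 y t) (at t within Rplus) \<and>
        D3 y t + a t * D2 y t + b t * D1 y t + c t * y t = 0"
    unfolding is_solution_def by blast
  show "(y has_vector_derivative D1 y t) (at t within Rplus)"
    "(D1 y has_vector_derivative D2 y t) (at t within Rplus)"
    "(D2 y has_vector_derivative D3 y t) (at t within Rplus)"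
    using * by blast+
  show "D3 y t = - a t * D2 y t - b t * D1 y t - c t * y t"
    using * by linarith
qed

lemma cont_derivs: "continuous_on Rplus y" "continuous_on Rplus (D1 y)" "continuous_on Rplus (D2 y)"
  using derivs(1-3) by (auto intro!: continuous_on_vector_derivative)

lemma cont_D3: "continuous_on Rplus (D3 y)"
proof -
  have "continuous_on Rplus (\<lambda>t. - a t * D2 y t - b t * D1 y t - c t * y t)"
    by (intro continuous_intros cont cont_derivs)
  then show ?thesis by (rule continuous_on_eq) (simp add: derivs(4))
qed

text \<open>On the compact interval reaching both \<open>t0\<close> and a point where
  \<open>y\<close> is nonzero the coefficients are bounded, so Gronwall's argument would carry a
  zero of the state from one to the other. The normalized curve is thus defined everywhere.\<close>

lemma xvec_nz:
  assumes t0: "t0 \<ge> 0"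
  shows "xvec y t0 \<noteq> 0"
proof
  assume z: "xvec y t0 = 0"
  obtain t where t: "t \<ge> 0" "y t \<noteq> 0" using nontrivial by auto
  define B where "B = max t0 t"
  have sub: "{0..B} \<subseteq> Rplus" by auto
  have bdd: "\<exists>K. \<forall>t\<in>{0..B}. \<bar>f t\<bar> \<le> K" if "continuous_on Rplus f" for f :: "real \<Rightarrow> real"
  proof -
    have "bounded (f ` {0..B})"
      by (intro compact_imp_bounded compact_continuous_image continuous_on_subset[OF that sub]) auto
    then show ?thesis by (auto simp: bounded_iff)
  qed
  obtain Ka where Ka: "\<forall>t\<in>{0..B}. \<bar>a t\<bar> \<le> Ka" using bdd[OF cont(1)] ..
  obtain Kb where Kb: "\<forall>t\<in>{0..B}. \<bar>b t\<bar> \<le> Kb" using bdd[OF cont(2)] ..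
  obtain Kc where Kc: "\<forall>t\<in>{0..B}. \<bar>c t\<bar> \<le> Kc" using bdd[OF cont(3)] ..
  define K where "K = max Ka (max Kb Kc)"
  define g where "g t = (y t)\<^sup>2 + (D1 y t)\<^sup>2 + (D2 y t)\<^sup>2" for t
  define g' where "g' t = 2 * (y t * D1 y t + D1 y t * D2 y t + D2 y t * D3 y t)" for t
  have "g t = 0"
  proof (rule gronwall_vanish[where g = g and g' = g' and t = t and t0 = t0 and b = B and C = "2 + 4 * K"])
    fix s assume s: "0 < s" "s < B"
    have "at s within Rplus = at s" using s by (intro at_within_open_subset[of s "{0<..}"]) auto
    then have "(y has_real_derivative D1 y s) (at s)" "(D1 y has_real_derivative D2 y s) (at s)"
      "(D2 y has_real_derivative D3 y s) (at s)"
      using derivs[of s] s by (auto simp: has_real_derivative_iff_has_vector_derivative)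
    then show "(g has_real_derivative g' s) (at s)"
      unfolding g_def[abs_def] g'_def by (auto intro!: derivative_eq_intros simp: algebra_simps)
  next
    show "continuous_on {0..B} g"
      unfolding g_def[abs_def] by (intro continuous_intros continuous_on_subset[OF _ sub] cont_derivs)
  next
    fix s assume s: "s \<in> {0..B}"
    have "\<bar>a s\<bar> \<le> K" "\<bar>b s\<bar> \<le> K" "\<bar>c s\<bar> \<le> K"
      using bspec[OF Ka s] bspec[OF Kb s] bspec[OF Kc s] by (auto simp: K_def)
    moreover have "D3 y s = - a s * D2 y s - b s * D1 y s - c s * y s" using derivs(4) s by simp
    ultimately show "\<bar>g' s\<bar> \<le> (2 + 4 * K) * g s"
      unfolding g'_def g_def by (simp only: linear_vector_field_bound)
  next
    show "g t0 = 0" using z by (simp add: g_def xvec_def zero_prod_def)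
  qed (use t0 t in \<open>auto simp: B_def g_def\<close>)
  then have "y t = 0" by (simp add: g_def add_nonneg_eq_0_iff)
  then show False using t by simp
qed

definition xvec' where "xvec' t = (D1 y t, D2 y t, D3 y t)"

lemma xvec_deriv: "t \<ge> 0 \<Longrightarrow> (xvec y has_vector_derivative xvec' t) (at t within Rplus)"
  unfolding xvec_def[abs_def] xvec'_def using derivs by (intro has_vector_derivative_Pair) auto

lemma gamma3_eq: "gamma3 y T = integral {0..T} (\<lambda>t. norm (sph_deriv (xvec y t) (xvec' t)))"
  unfolding gamma3_def
proof (rule integral_cong)
  fix t assume "t \<in> {0..T}"
  then have t: "t \<ge> 0" by simp
  have "(xsph y has_vector_derivative sph_deriv (xvec y t) (xvec' t)) (at t within Rplus)"
    unfolding xsph_def[abs_def] by (rule has_vector_derivative_sph[OF xvec_deriv[OF t] xvec_nz[OF t]])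
  then show "norm (vector_derivative (xsph y) (at t within Rplus)) = norm (sph_deriv (xvec y t) (xvec' t))"
    by (simp only: vector_derivative_Rplus[OF _ t])
qed

lemma gamma3_lower_bound:
  assumes T: "T > 0"
  shows "L_Omega / 2 * (real (nzeros y T) - 2) \<le> gamma3 y T"
\<comment> \<open>An infinite zero set has \<open>card\<close> 0 and falls under the trivial case; a
  count of two or more implies that the set is finite.\<close>
proof (cases "\<exists>m. nzeros y T = Suc (Suc m)")
  case False
  then have "nzeros y T \<noteq> Suc (Suc (nzeros y T - 2))" by blast
  then have "nzeros y T \<le> 2" by linarith
  then have "L_Omega / 2 * (real (nzeros y T) - 2) \<le> 0"
    using L_Omega_pos by (intro mult_nonneg_nonpos) auto
  also have "0 \<le> gamma3 y T"
    \<comment> \<open>The integral of a non-integrable function is 0 by default, so nonnegativity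
      holds in either case.\<close>
    unfolding gamma3_def by (cases "(\<lambda>\<tau>. norm (vector_derivative (xsph y) (at \<tau> within Rplus))) integrable_on {0..T}")
       (auto simp: integral_nonneg not_integrable_integral)
  finally show ?thesis .
next
  case True
  then obtain m where m: "nzeros y T = Suc (Suc m)" by blast
  have sub: "{0..T} \<subseteq> Rplus" by auto
  interpret curve: sphere_curve "\<lambda>t. emb (xvec y t /\<^sub>R norm (xvec y t))" "\<lambda>t. emb (sph_deriv (xvec y t) (xvec' t))" 0 T
  proof (rule sphere_curve_normalized)
    show "continuous_on {0..T} xvec'"
      unfolding xvec'_def[abs_def]
      by (intro continuous_on_Pair continuous_on_subset[OF _ sub] cont_derivs cont_D3)
  qed (use T xvec_nz xvec_deriv in \<open>auto intro: has_vector_derivative_within_subset[OF _ sub]\<close>)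
  have d: "(y has_real_derivative D1 y t) (at t within {0..T})" "(D1 y has_real_derivative D2 y t) (at t within {0..T})"
    if "t \<in> {0..T}" for t
    using derivs[of t] that
    by (auto simp: has_real_derivative_iff_has_vector_derivative intro: has_vector_derivative_within_subset[OF _ sub])
  have zs: "zero_seq y (Suc (Suc m)) 0 T"
  proof -
    have "finite {t \<in> {0..T}. y t = 0}"
      using m card.infinite unfolding nzeros_def by force
    from finite_zeros_zero_seq[OF this] show ?thesis using m unfolding nzeros_def by simp
  qed
  \<comment> \<open>Rolle's theorem is used once for each linear factor, which leaves
    \<open>m\<close> crossings out of \<open>m + 2\<close> zeros.\<close>
  have cr: "crosses (\<lambda>t. (D2 y t - s * D1 y t) - r * (D1 y t - s * y t)) m 0 T" for r s
  proof (rule zero_seq_imp_crosses)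
    have "crosses (\<lambda>t. D1 y t - s * y t) (Suc m) 0 T"
      by (rule zero_seq_imp_crosses[OF d(1) zs])
    then show "zero_seq (\<lambda>t. D1 y t - s * y t) (Suc m) 0 T"
      by (rule crosses_imp_zero_seq[rotated])
         (intro continuous_intros continuous_on_subset[OF _ sub] cont_derivs)
  qed (auto intro!: derivative_eq_intros d)
  \<comment> \<open>Removing a null set leaves polynomials of exact degree two, with two finite
    roots.\<close>
  let ?A = "hyp_dirs - {\<xi>. axis 3 1 \<bullet> \<xi> = 0}"
  have neg: "negligible {\<xi>::real^3. axis 3 1 \<bullet> \<xi> = 0}"
    by (intro negligible_hyperplane) (simp add: axis_eq_0_iff)
  have A: "?A \<in> lmeasurable" "measure lebesgue ?A = measure lebesgue hyp_dirs"
    using neg hyp_dirs_lmeasurable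
    by (auto intro!: fmeasurable_Diff negligible_imp_sets measure_negligible_symdiff intro: negligible_subset)
  have "real m * measure lebesgue ?A \<le> lune_density * curve.len"
  proof (rule curve.Crofton_length_ge[OF A(1)])
    show "?A \<subseteq> ball 0 1" by (auto simp: hyp_dirs_def)
    fix \<xi> assume "\<xi> \<in> ?A"
    then have \<xi>3: "\<xi>$3 \<noteq> 0" and disc: "4 * \<xi>$1 * \<xi>$3 < (\<xi>$2)\<^sup>2"
      by (auto simp: hyp_dirs_def inner_axis')
    define D where "D = sqrt ((\<xi>$2)\<^sup>2 - 4 * \<xi>$1 * \<xi>$3)"
    define r where "r = (- \<xi>$2 + D) / (2 * \<xi>$3)"
    define s where "s = (- \<xi>$2 - D) / (2 * \<xi>$3)"
    have D2: "D\<^sup>2 = (\<xi>$2)\<^sup>2 - 4 * \<xi>$1 * \<xi>$3" using disc by (simp add: D_def)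
    have sum: "\<xi>$3 * (r + s) = - \<xi>$2" using \<xi>3 by (simp add: r_def s_def field_simps)
    have "4 * (\<xi>$3 * (\<xi>$3 * (r * s))) = (- \<xi>$2 + D) * (- \<xi>$2 - D)"
      using \<xi>3 by (simp add: r_def s_def)
    also have "\<dots> = 4 * (\<xi>$3 * \<xi>$1)" using D2 by (simp add: algebra_simps power2_eq_square)
    finally have prod: "\<xi>$3 * (r * s) = \<xi>$1" using \<xi>3 by simp
    \<comment> \<open>By Vieta's formulas the inner product is a nonzero multiple of the
      twice-factored operator in \<open>cr\<close>; the multiplier has the constant sign of
      \<open>\<xi>$3\<close>.\<close>
    have form: "\<xi> \<bullet> emb (xvec y t /\<^sub>R norm (xvec y t)) =
       (\<xi>$3 / norm (xvec y t)) * ((D2 y t - s * D1 y t) - r * (D1 y t - s * y t))" for t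
    proof -
      have "\<xi> \<bullet> emb (xvec y t) = \<xi>$1 * y t + \<xi>$2 * D1 y t + \<xi>$3 * D2 y t"
        by (simp add: xvec_def inner_emb)
      also have "\<dots> = \<xi>$3 * ((D2 y t - s * D1 y t) - r * (D1 y t - s * y t))"
      proof -
        have "\<xi>$2 = - (\<xi>$3 * (r + s))" using sum by simp
        then show ?thesis unfolding prod[symmetric] by (simp only:) (simp add: algebra_simps)
      qed
      finally show ?thesis
        by (simp add: linear_scale[OF linear_emb] divide_inverse mult_ac)
    qed
    obtain p q where pq: "\<And>i. i < m \<Longrightarrow> 0 \<le> p i \<and> p i < q i \<and> q i \<le> T \<and>
        ((D2 y (p i) - s * D1 y (p i)) - r * (D1 y (p i) - s * y (p i))) *
        ((D2 y (q i) - s * D1 y (q i)) - r * (D1 y (q i) - s * y (q i))) < 0"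
      and dis: "\<And>i j. i < j \<Longrightarrow> j < m \<Longrightarrow> q i \<le> p j"
      using cr[of s r] unfolding crosses_def by blast
    have "(\<xi> \<bullet> emb (xvec y (p i) /\<^sub>R norm (xvec y (p i)))) * (\<xi> \<bullet> emb (xvec y (q i) /\<^sub>R norm (xvec y (q i)))) < 0"
      if i: "i < m" for i
    proof -
      have "0 < (\<xi>$3 / norm (xvec y (p i))) * (\<xi>$3 / norm (xvec y (q i)))"
        using not_real_square_gt_zero[of "\<xi>$3"] \<xi>3 xvec_nz[of "p i"] xvec_nz[of "q i"] pq[OF i]
        by (simp add: zero_less_divide_iff del: not_real_square_gt_zero)
      then have "((\<xi>$3 / norm (xvec y (p i))) * (\<xi>$3 / norm (xvec y (q i)))) *
        (((D2 y (p i) - s * D1 y (p i)) - r * (D1 y (p i) - s * y (p i))) *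
        ((D2 y (q i) - s * D1 y (q i)) - r * (D1 y (q i) - s * y (q i)))) < 0"
        by (rule mult_pos_neg) (use pq[OF i] in blast)
      then show ?thesis unfolding form by (simp only: mult_ac)
    qed
    then show "crosses (\<lambda>t. \<xi> \<bullet> emb (xvec y t /\<^sub>R norm (xvec y t))) m 0 T"
      unfolding crosses_def using pq dis by (intro exI[of _ p] exI[of _ q]) auto
  qed
  then have 1: "real m * measure lebesgue hyp_dirs \<le> lune_density * gamma3 y T"
    using A(2) by (simp add: gamma3_eq)
  have "real m * (lune_density * L_Omega) \<le> real m * (2 * measure lebesgue hyp_dirs)"
    using L_Omega_le_hyp_dirs by (intro mult_left_mono) auto
  with 1 have "lune_density * (real m * L_Omega) \<le> lune_density * (2 * gamma3 y T)"
    by (simp add: algebra_simps)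
  then have "real m * L_Omega \<le> 2 * gamma3 y T" using lune_density_pos by simp
  then show ?thesis by (simp add: m algebra_simps)
qed

end

section \<open>Passage to the limit\<close>

text \<open>The error \<open>k / t\<close> eventually drops below any \<open>e > 0\<close>, and both
  limits commute with the nonnegative factor \<open>c\<close> and the finite shift
  \<open>e\<close>.\<close>

lemma
  fixes f g :: "real \<Rightarrow> real"
  assumes c: "c \<ge> 0" and le: "\<And>t. t > 0 \<Longrightarrow> c * f t - k / t \<le> g t"
  shows Limsup_le_of_error: "ereal c * Limsup at_top (\<lambda>t. ereal (f t)) \<le> Limsup at_top (\<lambda>t. ereal (g t))"
    and Liminf_le_of_error: "ereal c * Liminf at_top (\<lambda>t. ereal (f t)) \<le> Liminf at_top (\<lambda>t. ereal (g t))"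
proof -
  have ev: "eventually (\<lambda>t. ereal c * ereal (f t) \<le> ereal (g t) + ereal e) at_top" if "e > 0" for e
  proof -
    have "((\<lambda>t. k / t) \<longlongrightarrow> 0) at_top" by (rule tendsto_divide_0[OF tendsto_const filterlim_at_top_imp_at_infinity[OF filterlim_ident]])
    then have "eventually (\<lambda>t. k / t < e) at_top" using that by (rule order_tendstoD)
    then show ?thesis using eventually_gt_at_top[of 0]
    proof eventually_elim
      case (elim t)
      then show ?case using le[of t] by simp
    qed
  qed
  show "ereal c * Limsup at_top (\<lambda>t. ereal (f t)) \<le> Limsup at_top (\<lambda>t. ereal (g t))"
  proof (rule ereal_le_epsilon2)
    fix e :: real assume "e > 0"
    have "ereal c * Limsup at_top (\<lambda>t. ereal (f t)) = Limsup at_top (\<lambda>t. ereal c * ereal (f t))"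
      using c by (subst Limsup_ereal_mult_left) auto
    also have "\<dots> \<le> Limsup at_top (\<lambda>t. ereal (g t) + ereal e)"
      using ev[OF \<open>e > 0\<close>] by (rule Limsup_mono)
    also have "\<dots> = Limsup at_top (\<lambda>t. ereal (g t)) + ereal e"
      by (subst Limsup_add_ereal_right) auto
    finally show "ereal c * Limsup at_top (\<lambda>t. ereal (f t)) \<le> Limsup at_top (\<lambda>t. ereal (g t)) + ereal e" .
  qed
  show "ereal c * Liminf at_top (\<lambda>t. ereal (f t)) \<le> Liminf at_top (\<lambda>t. ereal (g t))"
  proof (rule ereal_le_epsilon2)
    fix e :: real assume "e > 0"
    have "ereal c * Liminf at_top (\<lambda>t. ereal (f t)) = Liminf at_top (\<lambda>t. ereal c * ereal (f t))"
      using c by (subst Liminf_ereal_mult_left) auto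
    also have "\<dots> \<le> Liminf at_top (\<lambda>t. ereal (g t) + ereal e)"
      using ev[OF \<open>e > 0\<close>] by (rule Liminf_mono)
    also have "\<dots> = Liminf at_top (\<lambda>t. ereal (g t)) + ereal e"
      by (subst Liminf_add_ereal_right) auto
    finally show "ereal c * Liminf at_top (\<lambda>t. ereal (f t)) \<le> Liminf at_top (\<lambda>t. ereal (g t)) + ereal e" .
  qed
qed

lemma (in ode3) wander_ge:
  "ereal (L_Omega / (2 * pi)) * upper_zero_freq y \<le> upper_wander y"
  "ereal (L_Omega / (2 * pi)) * lower_zero_freq y \<le> lower_wander y"
proof -
  have c: "L_Omega / (2 * pi) \<ge> 0" using L_Omega_pos by simp
  \<comment> \<open>The two zeros lost to Rolle's theorem cost a length of \<open>L_Omega\<close> in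
    total, whence the error \<open>L_Omega / t\<close>.\<close>
  have le: "L_Omega / (2 * pi) * (pi / t * real (nzeros y t)) - L_Omega / t \<le> gamma3 y t / t" if "t > 0" for t
  proof -
    have "L_Omega / (2 * pi) * (pi / t * real (nzeros y t)) - L_Omega / t = (L_Omega / 2 * (real (nzeros y t) - 2)) / t"
      using that by (simp add: field_simps)
    also have "\<dots> \<le> gamma3 y t / t"
      using gamma3_lower_bound[OF that] that by (intro divide_right_mono) auto
    finally show ?thesis .
  qed
  show "ereal (L_Omega / (2 * pi)) * upper_zero_freq y \<le> upper_wander y"
    unfolding upper_zero_freq_def upper_wander_def by (rule Limsup_le_of_error[OF c le])
  show "ereal (L_Omega / (2 * pi)) * lower_zero_freq y \<le> lower_wander y"
    unfolding lower_zero_freq_def lower_wander_def by (rule Liminf_le_of_error[OF c le])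
qed

section \<open>Smoothness, periodicity and perturbation\<close>

text \<open>The algebra of functions generated by \<open>B\<close> and the constants. If the
  generators have derivatives inside it, it is closed under differentiation, and no higher
  derivative has to be written down.\<close>

inductive_set fun_algebra :: "(real \<Rightarrow> real) set \<Rightarrow> (real \<Rightarrow> real) set" for B where
  base: "f \<in> B \<Longrightarrow> f \<in> fun_algebra B"
| const: "(\<lambda>t. k) \<in> fun_algebra B"
| add: "f \<in> fun_algebra B \<Longrightarrow> g \<in> fun_algebra B \<Longrightarrow> (\<lambda>t. f t + g t) \<in> fun_algebra B"
| mult: "f \<in> fun_algebra B \<Longrightarrow> g \<in> fun_algebra B \<Longrightarrow> (\<lambda>t. f t * g t) \<in> fun_algebra B"

lemma fun_algebra_uminus: "f \<in> fun_algebra B \<Longrightarrow> (\<lambda>t. - f t) \<in> fun_algebra B"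
  using fun_algebra.mult[OF fun_algebra.const[of "-1"], of f B] by simp

lemma fun_algebra_diff:
  "f \<in> fun_algebra B \<Longrightarrow> g \<in> fun_algebra B \<Longrightarrow> (\<lambda>t. f t - g t) \<in> fun_algebra B"
  using fun_algebra.add[of f B "\<lambda>t. - g t"] fun_algebra_uminus[of g B] by simp

lemma fun_algebra_power: "f \<in> fun_algebra B \<Longrightarrow> (\<lambda>t. f t ^ n) \<in> fun_algebra B"
  by (induction n) (auto intro: fun_algebra.intros)

text \<open>The product rule extends differentiability from generators to the algebra. Choosing the
  derivative inside the algebra allows the choice to be iterated, which yields the whole sequence of
  derivatives.\<close>

lemma fun_algebra_smooth:
  assumes B: "\<And>f. f \<in> B \<Longrightarrow> \<exists>f'\<in>fun_algebra B. \<forall>t\<in>Rplus. (f has_real_derivative f' t) (at t within Rplus)"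
    and f: "f \<in> fun_algebra B"
  shows "smooth_on_Rplus f"
proof -
  let ?D = "\<lambda>f f'. f' \<in> fun_algebra B \<and> (\<forall>t\<in>Rplus. (f has_real_derivative f' t) (at t within Rplus))"
  have ex: "\<exists>f'. ?D f f'" if "f \<in> fun_algebra B" for f
    using that
  proof induction
    case (base f)
    then show ?case using B by blast
  next
    case (const k)
    show ?case by (rule exI[of _ "\<lambda>t. 0"]) (auto intro: fun_algebra.intros)
  next
    case (add f g)
    then obtain f' g' where "?D f f'" "?D g g'" by blast
    then show ?case
      by (intro exI[of _ "\<lambda>t. f' t + g' t"]) (auto intro: fun_algebra.intros DERIV_add)
  next
    case (mult f g)
    then obtain f' g' where "?D f f'" "?D g g'" by blast
    then show ?case using mult
      by (intro exI[of _ "\<lambda>t. f' t * g t + g' t * f t"]) (auto intro: fun_algebra.intros DERIV_mult)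
  qed
  define d where "d f = (SOME f'. ?D f f')" for f
  have d: "?D f (d f)" if "f \<in> fun_algebra B" for f
    unfolding d_def by (rule someI_ex[OF ex[OF that]])
  have mem: "(d ^^ k) f \<in> fun_algebra B" for k
    by (induction k) (use f d in auto)
  show ?thesis
    unfolding smooth_on_Rplus_def
  proof (rule exI[of _ "\<lambda>k. (d ^^ k) f"], intro conjI allI ballI)
    fix k :: nat and t :: real assume "t \<in> Rplus"
    then show "((d ^^ k) f has_vector_derivative (d ^^ Suc k) f t) (at t within Rplus)"
      using d[OF mem[of k]] by (simp add: has_real_derivative_iff_has_vector_derivative)
  qed simp
qed

lemma smooth_imp_continuous: "smooth_on_Rplus f \<Longrightarrow> continuous_on Rplus f"
  unfolding smooth_on_Rplus_def
proof (elim exE conjE)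
  fix Df :: "nat \<Rightarrow> real \<Rightarrow> real"
  assume f: "Df 0 = f" and D: "\<forall>k. \<forall>t\<in>Rplus. (Df k has_vector_derivative Df (Suc k) t) (at t within Rplus)"
  have "(f has_vector_derivative Df (Suc 0) t) (at t within Rplus)" if "t \<in> Rplus" for t
    using D[rule_format, of t 0] that f by simp
  then show "continuous_on Rplus f" by (rule continuous_on_vector_derivative)
qed

text \<open>\<open>D1\<close> is controlled only on \<open>Rplus\<close>, so each further derivative
  is transferred along the agreement of functions on that set.\<close>

lemma derivatives_unique:
  assumes d1: "\<And>t. t \<in> Rplus \<Longrightarrow> (y has_vector_derivative y1 t) (at t within Rplus)"
    and d2: "\<And>t. t \<in> Rplus \<Longrightarrow> (y1 has_vector_derivative y2 t) (at t within Rplus)"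
    and d3: "\<And>t. t \<in> Rplus \<Longrightarrow> (y2 has_vector_derivative y3 t) (at t within Rplus)"
    and t: "t \<in> Rplus"
  shows "D1 y t = y1 t" "D2 y t = y2 t" "D3 y t = y3 t"
    "(y has_vector_derivative D1 y t) (at t within Rplus)"
    "(D1 y has_vector_derivative D2 y t) (at t within Rplus)"
    "(D2 y has_vector_derivative D3 y t) (at t within Rplus)"
proof -
  have 1: "D1 y t = y1 t" if "t \<in> Rplus" for t
    unfolding D1_def using vector_derivative_Rplus[OF d1[OF that]] that by simp
  have e1: "(D1 y has_vector_derivative y2 t) (at t within Rplus)" if "t \<in> Rplus" for t
    by (rule has_vector_derivative_transform[OF that _ d2[OF that]]) (rule 1)
  have 2: "D2 y t = y2 t" if "t \<in> Rplus" for t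
    unfolding D2_def D1_def[of "D1 y"] using vector_derivative_Rplus[OF e1[OF that]] that by simp
  have e2: "(D2 y has_vector_derivative y3 t) (at t within Rplus)" if "t \<in> Rplus" for t
    by (rule has_vector_derivative_transform[OF that _ d3[OF that]]) (rule 2)
  have 3: "D3 y t = y3 t" if "t \<in> Rplus" for t
    unfolding D3_def D1_def[of "D2 y"] using vector_derivative_Rplus[OF e2[OF that]] that by simp
  show "D1 y t = y1 t" "D2 y t = y2 t" "D3 y t = y3 t"
    "(y has_vector_derivative D1 y t) (at t within Rplus)"
    "(D1 y has_vector_derivative D2 y t) (at t within Rplus)"
    "(D2 y has_vector_derivative D3 y t) (at t within Rplus)"
    using 1[OF t] 2[OF t] 3[OF t] d1[OF t] e1[OF t] e2[OF t] by simp_all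
qed

text \<open>Subtracting the line of slope \<open>A / H\<close> leaves an \<open>H\<close>-periodic,
  hence bounded, function. This serves both the zero count and the arc length of the
  example.\<close>

lemma quasi_periodic_linear_growth:
  fixes F :: "real \<Rightarrow> real"
  assumes H: "H > 0" and per: "\<And>t. t \<ge> 0 \<Longrightarrow> F (t + H) = F t + A"
    and bd: "\<And>t. 0 \<le> t \<Longrightarrow> t \<le> H \<Longrightarrow> \<bar>F t\<bar> \<le> C"
  shows "((\<lambda>t. F t / t) \<longlongrightarrow> A / H) at_top"
proof -
  define P where "P t = F t - A / H * t" for t
  have P1: "P (t + H) = P t" if "t \<ge> 0" for t
    using per[OF that] H by (simp add: P_def field_simps)
  have Pn: "P (s + real n * H) = P s" if "s \<ge> 0" for s n
  proof (induction n)
    case (Suc n)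
    have "P (s + real (Suc n) * H) = P ((s + real n * H) + H)" by (simp add: algebra_simps)
    also have "\<dots> = P (s + real n * H)" using that H by (intro P1) simp
    finally show ?case using Suc by simp
  qed simp
  have Pb: "\<bar>P t\<bar> \<le> C + \<bar>A\<bar>" if t: "t \<ge> 0" for t
  proof -
    define n where "n = nat \<lfloor>t / H\<rfloor>"
    define s where "s = t - real n * H"
    have q: "0 \<le> t / H" using t H by simp
    have "real n \<le> t / H" unfolding n_def by (rule of_nat_floor[OF q])
    moreover have "t / H \<le> real n + 1" using q unfolding n_def by linarith
    ultimately have "real n \<le> t / H" "t / H \<le> real n + 1" .
    then have s: "0 \<le> s" "s \<le> H" using H by (auto simp: s_def field_simps)
    have "P t = P s" using Pn[OF s(1), of n] by (simp add: s_def)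
    moreover have "\<bar>A / H * s\<bar> \<le> \<bar>A\<bar>"
    proof -
      have "\<bar>A / H * s\<bar> = \<bar>A\<bar> * (s / H)" using s H by (simp add: abs_mult)
      also have "\<dots> \<le> \<bar>A\<bar> * 1" using s H by (intro mult_left_mono) auto
      finally show ?thesis by simp
    qed
    ultimately show ?thesis using bd[OF s] unfolding P_def by linarith
  qed
  have "((\<lambda>t. P t / t) \<longlongrightarrow> 0) at_top"
  proof (rule Lim_null_comparison)
    show "eventually (\<lambda>t. norm (P t / t) \<le> (C + \<bar>A\<bar>) / t) at_top"
      using eventually_gt_at_top[of 0]
    proof eventually_elim
      case (elim t)
      then show ?case using divide_right_mono[OF Pb[of t], of t] by simp
    qed
    show "((\<lambda>t. (C + \<bar>A\<bar>) / t) \<longlongrightarrow> 0) at_top"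
      by (rule tendsto_divide_0[OF tendsto_const filterlim_at_top_imp_at_infinity[OF filterlim_ident]])
  qed
  then have "((\<lambda>t. A / H + P t / t) \<longlongrightarrow> A / H + 0) at_top" by (intro tendsto_intros)
  then have "((\<lambda>t. A / H + P t / t) \<longlongrightarrow> A / H) at_top" by simp
  then show ?thesis
  proof (rule Lim_transform_eventually)
    show "eventually (\<lambda>t. A / H + P t / t = F t / t) at_top"
      using eventually_gt_at_top[of 0]
    proof eventually_elim
      case (elim t)
      then show ?case by (simp add: P_def diff_divide_distrib)
    qed
  qed
qed

section \<open>Perturbation of the spherical velocity\<close>

lemma sph_deriv_add: "sph_deriv x (v + w) = sph_deriv x v + sph_deriv x w"
  by (simp add: sph_deriv_def inner_add_right add_divide_distrib algebra_simps)

lemma sph_deriv_scaleR: "sph_deriv x (k *\<^sub>R v) = k *\<^sub>R sph_deriv x v"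
  by (simp add: sph_deriv_def algebra_simps)

text \<open>Normalization ignores radial motion, so multiples of the base point may be dropped from
  a velocity.\<close>

lemma sph_deriv_self: "sph_deriv x x = 0"
proof (cases "x = 0")
  case False
  then have "(x \<bullet> x) / norm x ^ 3 = inverse (norm x)"
    by (simp add: power2_norm_eq_inner[symmetric] field_simps power3_eq_cube power2_eq_square)
  then show ?thesis by (simp add: sph_deriv_def)
qed (simp add: sph_deriv_def)

lemma sph_deriv_scaleR_base: "k > 0 \<Longrightarrow> sph_deriv (k *\<^sub>R x) v = (1 / k) *\<^sub>R sph_deriv x v"
  by (simp add: sph_deriv_def scaleR_diff_right power_mult_distrib power3_eq_cube field_simps)

lemma norm_sph_deriv_le: "norm (sph_deriv x v) \<le> norm v / norm x"
proof (cases "x = 0")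
  case False
  have "sqrt ((norm x)\<^sup>2 * (norm v)\<^sup>2 - (x \<bullet> v)\<^sup>2) \<le> sqrt ((norm x * norm v)\<^sup>2)"
    by (intro real_sqrt_le_mono) (simp add: power_mult_distrib)
  then have "norm (sph_deriv x v) \<le> (norm x * norm v) / (norm x)\<^sup>2"
    unfolding norm_sph_deriv[OF False] by (intro divide_right_mono) auto
  then show ?thesis using False by (simp add: power2_eq_square)
qed (simp add: sph_deriv_def)

text \<open>With \<open>i = x / |x|\<^sup>2\<close>, the norm of \<open>sph_deriv x d\<close> is \<open>|d|\<close> times the length of the component of
  \<open>i\<close> orthogonal to \<open>d\<close>, and the inversion \<open>x \<mapsto> i\<close> distorts distances by the factor \<open>1 / (|x| |z|)\<close>.\<close>
lemma norm_sph_deriv_perturb: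
  assumes "x \<noteq> 0" "z \<noteq> 0"
  shows "norm (sph_deriv x d) \<le> norm (sph_deriv z d) + norm d * norm (x - z) / (norm x * norm z)"
proof (cases "d = 0")
  case True
  then show ?thesis by (simp add: sph_deriv_def)
next
  case False
  define Q where "Q i = norm d *\<^sub>R i - ((i \<bullet> d) / norm d) *\<^sub>R d" for i
  define inv where "inv x = (1 / (norm x)\<^sup>2) *\<^sub>R x" for x :: 'a
  have Q2: "(norm (Q i))\<^sup>2 = (norm d)\<^sup>2 * (norm i)\<^sup>2 - (i \<bullet> d)\<^sup>2" for i
  proof -
    have "(norm (p *\<^sub>R i - q *\<^sub>R d))\<^sup>2 = p\<^sup>2 * (norm i)\<^sup>2 - 2 * p * q * (i \<bullet> d) + q\<^sup>2 * (norm d)\<^sup>2" for p q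
      by (simp add: power2_norm_eq_inner inner_diff_left inner_diff_right inner_commute[of d i])
         (simp add: power2_eq_square algebra_simps)
    from this[of "norm d" "(i \<bullet> d) / norm d"] show ?thesis
      using False unfolding Q_def by (simp add: field_simps power2_eq_square)
  qed
  have Qd: "Q (i - j) = Q i - Q j" for i j
    by (simp add: Q_def inner_diff_left diff_divide_distrib algebra_simps)
  have Qle: "norm (Q i) \<le> norm d * norm i" for i
    by (rule power2_le_imp_le) (simp_all add: Q2 power_mult_distrib)
  have inv: "norm (sph_deriv x d) = norm (Q (inv x))" if "x \<noteq> 0" for x
  proof -
    have ni: "norm (inv x) = 1 / norm x" using that by (simp add: inv_def power2_eq_square)
    have "(norm (sph_deriv x d))\<^sup>2 = ((norm x)\<^sup>2 * (norm d)\<^sup>2 - (x \<bullet> d)\<^sup>2) / ((norm x)\<^sup>2)\<^sup>2"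
      unfolding norm_sph_deriv[OF that] using Cauchy_Schwarz_ineq[of x d]
      by (simp add: power_divide power2_norm_eq_inner)
    also have "\<dots> = (norm d)\<^sup>2 * (norm (inv x))\<^sup>2 - (inv x \<bullet> d)\<^sup>2"
    proof -
      have "(n\<^sup>2 * D\<^sup>2 - k\<^sup>2) / (n\<^sup>2)\<^sup>2 = D\<^sup>2 * (1 / n)\<^sup>2 - ((1 / n\<^sup>2) * k)\<^sup>2" if "n \<noteq> 0" for n D k :: real
        using that by (simp add: diff_divide_distrib power_divide power_mult_distrib power2_eq_square)
      from this[of "norm x" "norm d" "x \<bullet> d"] show ?thesis
        using that unfolding ni by (simp add: inv_def)
    qed
    finally have "(norm (sph_deriv x d))\<^sup>2 = (norm (Q (inv x)))\<^sup>2" unfolding Q2 .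
    then show ?thesis by (simp add: power2_eq_iff_nonneg)
  qed
  have dist: "norm (inv x - inv z) = norm (x - z) / (norm x * norm z)"
  proof -
    have gen: "(norm (p *\<^sub>R x - q *\<^sub>R z))\<^sup>2 = p\<^sup>2 * (norm x)\<^sup>2 - 2 * p * q * (x \<bullet> z) + q\<^sup>2 * (norm z)\<^sup>2" for p q
      by (simp add: power2_norm_eq_inner inner_diff_left inner_diff_right inner_commute[of z x])
         (simp add: power2_eq_square algebra_simps)
    have "(norm (inv x - inv z))\<^sup>2 = (norm (x - z))\<^sup>2 / (norm x * norm z)\<^sup>2"
    proof -
      have "(1 / r\<^sup>2)\<^sup>2 * r\<^sup>2 - 2 * (1 / r\<^sup>2) * (1 / s\<^sup>2) * m + (1 / s\<^sup>2)\<^sup>2 * s\<^sup>2 = (r\<^sup>2 - 2 * m + s\<^sup>2) / (r * s)\<^sup>2"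
        if "r \<noteq> 0" "s \<noteq> 0" for r s m :: real
        using that by (simp add: divide_simps) algebra
      from this[of "norm x" "norm z" "x \<bullet> z"] show ?thesis
        using gen[of "1 / (norm x)\<^sup>2" "1 / (norm z)\<^sup>2"] gen[of 1 1] assms
        unfolding inv_def by simp
    qed
    then have "(norm (inv x - inv z))\<^sup>2 = (norm (x - z) / (norm x * norm z))\<^sup>2"
      by (simp add: power_divide)
    then show ?thesis by (simp add: power2_eq_iff_nonneg)
  qed
  have "norm (Q (inv x)) \<le> norm (Q (inv z)) + norm (Q (inv x - inv z))"
    unfolding Qd by (metis norm_triangle_sub)
  also have "\<dots> \<le> norm (Q (inv z)) + norm d * norm (inv x - inv z)"
    using Qle by simp
  finally show ?thesis using inv assms dist by simp
qed

definition std :: "real \<Rightarrow> real \<times> real \<times> real" where "std u = (1, u, u\<^sup>2)"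

definition std' :: "real \<Rightarrow> real \<times> real \<times> real" where "std' u = (0, 1, 2 * u)"

text \<open>With u = tan \<theta>, \<open>conic\<close> is cos^2 \<theta> times
  \<open>std u\<close>, and its derivative is \<open>std' u\<close> up to a radial term. Hence the
  two speeds differ by the factor cos^2 \<theta> = 1 / (1 + u^2).\<close>

lemma norm_sph_deriv_std:
  "norm (sph_deriv (std u) (std' u)) = 4 * conic_speed (4 * arctan u) / (1 + u\<^sup>2)"
proof -
  let ?\<theta> = "arctan u"
  have c: "cos ?\<theta> \<noteq> 0" by simp
  have cp: "(cos ?\<theta>)\<^sup>2 > 0" using c by simp
  have u: "u = sin ?\<theta> / cos ?\<theta>" using tan_arctan[of u] by (simp add: tan_def)
  have s: "sin ?\<theta> = u * cos ?\<theta>" using u c by (simp add: field_simps)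
  have c2: "(cos ?\<theta>)\<^sup>2 * (1 + u\<^sup>2) = 1"
  proof -
    have "(cos ?\<theta>)\<^sup>2 * (1 + u\<^sup>2) = (sin ?\<theta>)\<^sup>2 + (cos ?\<theta>)\<^sup>2"
      unfolding s by (simp add: power_mult_distrib algebra_simps)
    then show ?thesis by simp
  qed
  have con: "conic ?\<theta> = (cos ?\<theta>)\<^sup>2 *\<^sub>R std u"
    by (simp add: conic_def std_def s power2_eq_square)
  have "conic' ?\<theta> = std' u + (- 2 * u) *\<^sub>R conic ?\<theta>"
  proof -
    let ?c2 = "(cos ?\<theta>)\<^sup>2"
    have sd: "sin (2 * ?\<theta>) = 2 * u * ?c2" by (simp add: sin_double s power2_eq_square)
    have "cos (2 * ?\<theta>) = 1 - 2 * u * (u * ?c2)"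
      unfolding cos_double_sin by (simp add: s power_mult_distrib power2_eq_square)
    moreover have "sin (2 * ?\<theta>) = 2 * u - 2 * u * (u\<^sup>2 * ?c2)"
    proof -
      have uu: "u\<^sup>2 * ?c2 = 1 - ?c2" using c2 by (simp add: algebra_simps)
      show ?thesis by (simp only: sd uu) (simp add: algebra_simps)
    qed
    moreover note sd
    ultimately show ?thesis
      unfolding conic'_def std'_def con by (simp add: std_def mult_ac)
  qed
  then have "sph_deriv (conic ?\<theta>) (conic' ?\<theta>) = sph_deriv (conic ?\<theta>) (std' u)"
    by (simp only: sph_deriv_add sph_deriv_scaleR sph_deriv_self) simp
  also have "\<dots> = (1 / (cos ?\<theta>)\<^sup>2) *\<^sub>R sph_deriv (std u) (std' u)"
    unfolding con by (rule sph_deriv_scaleR_base[OF cp])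
  finally have "norm (sph_deriv (conic ?\<theta>) (conic' ?\<theta>)) = (1 / (cos ?\<theta>)\<^sup>2) * norm (sph_deriv (std u) (std' u))"
    by simp
  then have "norm (sph_deriv (std u) (std' u)) = (cos ?\<theta>)\<^sup>2 * (4 * conic_speed (4 * ?\<theta>))"
    using c unfolding norm_sph_deriv_conic by simp
  also have "(cos ?\<theta>)\<^sup>2 = 1 / (1 + u\<^sup>2)"
    using c2 by (metis nonzero_eq_divide_eq mult_zero_right zero_neq_one)
  finally show ?thesis by simp
qed

lemma abs_fst_le_norm: "\<bar>p\<bar> \<le> norm (p, q, r)" for p q r :: real
  using norm_fst_le[of p "(q, r)"] by simp

lemma abs_thd_le_norm: "\<bar>r\<bar> \<le> norm (p, q, r)" for p q r :: real
  using norm_snd_le[of "(q, r)" p] norm_snd_le[of r q] by simp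

lemma norm_triple_le: "norm (p, q, r) \<le> \<bar>p\<bar> + \<bar>q\<bar> + \<bar>r\<bar>" for p q r :: real
  using norm_Pair_le[of p "(q, r)"] norm_Pair_le[of q r] by simp

text \<open>\<open>U\<close>, \<open>P\<close>, \<open>Q\<close> stand for the first three derivatives of the phase \<open>\<phi>\<close>, \<open>T = tanh \<phi>\<close>, \<open>S = sech \<phi>\<close>;
  the two triples are \<open>(y, y', y'')\<close> and \<open>(y', y'', y''')\<close> for \<open>y = cosh \<phi> - 2\<close>, divided by \<open>cosh \<phi>\<close>.\<close>
lemma perturbed_speed_bound:
  fixes S T U P Q k d :: real
  assumes TS: "T\<^sup>2 + S\<^sup>2 = 1" "0 \<le> T" "0 \<le> S"
    and P: "\<bar>P\<bar> \<le> k" "k \<le> 1 / 8" and Q: "\<bar>Q\<bar> \<le> d * \<bar>U\<bar>" "d \<ge> 0"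
    and low: "(1 + U\<^sup>2) / 4 \<le> norm (1 - 2 * S, U * T, U\<^sup>2 + P * T)"
  shows "norm (sph_deriv (1 - 2 * S, U * T, U\<^sup>2 + P * T) (T * U, U\<^sup>2 + P * T, T * U^3 + 3 * U * P + Q * T))
    \<le> \<bar>P\<bar> * norm (sph_deriv (std U) (std' U)) + 16 * S + 16 * k\<^sup>2 + 4 * d"
proof -
  let ?w = "(1 - 2 * S, U * T, U\<^sup>2 + P * T)"
  let ?V = "(T * U, U\<^sup>2 + P * T, T * U^3 + 3 * U * P + Q * T)"
  define E where "E = (2 * S * T * U, P * (T - 1) + U\<^sup>2 * S\<^sup>2, U * P * S\<^sup>2 + Q * T)"
  let ?g = "1 + U\<^sup>2"
  have g1: "?g \<ge> 1" and gp: "0 < ?g" by (simp_all add: add_pos_nonneg)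
  have S1: "S \<le> 1" "T \<le> 1"
    using TS abs_square_le_1[of S] abs_square_le_1[of T] by (smt (verit) zero_le_power2)+
  have S2: "S\<^sup>2 \<le> S" using S1 TS by (simp add: power2_eq_square mult_left_le)
  have T1: "1 - T \<le> S"
  proof -
    have "(1 - S)\<^sup>2 \<le> T\<^sup>2"
      using TS(1) S2 by (simp add: power2_eq_square algebra_simps)
    then show ?thesis using power2_le_imp_le[of "1 - S" T] TS by simp
  qed
  have u2: "2 * \<bar>U\<bar> \<le> ?g" using sum_squares_bound[of 1 "\<bar>U\<bar>"] by simp
  have k0: "0 \<le> k" using P by linarith
  have P1: "\<bar>P\<bar> \<le> 1" using P by linarith
  \<comment> \<open>Splitting off the radial part \<open>(U * T) *\<^sub>R ?w\<close> leaves the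
    velocity of the limiting boundary curve, \<open>P *\<^sub>R std' U\<close>, and a remainder
    \<open>E\<close> controlled by \<open>S\<close> and \<open>d\<close>.\<close>
  have V: "?V = (U * T) *\<^sub>R ?w + (P *\<^sub>R std' U + E)"
  proof -
    have "T\<^sup>2 = 1 - S\<^sup>2" using TS by simp
    moreover have "T * U = U * T * (1 - 2 * S) + 2 * S * T * U" by algebra
    moreover have "U\<^sup>2 + P * T = U * T * (U * T) + (P + (P * (T - 1) + U\<^sup>2 * (1 - T\<^sup>2)))" by algebra
    moreover have "T * U^3 + 3 * U * P + Q * T = U * T * (U\<^sup>2 + P * T) + (P * (2 * U) + (U * P * (1 - T\<^sup>2) + Q * T))"
      by algebra
    ultimately show ?thesis by (simp add: std'_def E_def)
  qed
  have w: "norm ?w > 0"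
    by (rule less_le_trans[OF _ low]) (simp add: add_pos_nonneg)
  then have wn: "?w \<noteq> 0" by auto
  have z: "?g / 2 \<le> norm (std U)"
    using abs_fst_le_norm[of 1 U "U\<^sup>2"] abs_thd_le_norm[of "U\<^sup>2" 1 U] unfolding std_def by simp
  then have zn: "std U \<noteq> 0" by (auto simp: std_def zero_prod_def)
  have "sph_deriv ?w ?V = P *\<^sub>R sph_deriv ?w (std' U) + sph_deriv ?w E"
    unfolding V by (simp only: sph_deriv_add sph_deriv_scaleR sph_deriv_self) simp
  then have "norm (sph_deriv ?w ?V) \<le> \<bar>P\<bar> * norm (sph_deriv ?w (std' U)) + norm (sph_deriv ?w E)"
    using norm_triangle_ineq[of "P *\<^sub>R sph_deriv ?w (std' U)" "sph_deriv ?w E"] by simp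
  \<comment> \<open>\<open>E\<close> has norm at most \<open>(5 / 2 * S + d) * ?g\<close>, and
    \<open>low\<close> bounds the base point below by \<open>?g / 4\<close>; this multiplies the
    constants by 4.\<close>
  moreover have "norm (sph_deriv ?w E) \<le> 10 * S + 4 * d"
  proof -
    have a1: "\<bar>2 * S * T * U\<bar> \<le> S * (2 * \<bar>U\<bar>)"
    proof -
      have "\<bar>2 * S * T * U\<bar> = (S * (2 * \<bar>U\<bar>)) * T" using TS by (simp add: abs_mult)
      also have "\<dots> \<le> (S * (2 * \<bar>U\<bar>)) * 1" using S1 TS by (intro mult_left_mono) auto
      finally show ?thesis by simp
    qed
    have a2: "\<bar>P * (T - 1) + U\<^sup>2 * S\<^sup>2\<bar> \<le> S * ?g"
    proof -
      have "\<bar>P * (T - 1)\<bar> \<le> 1 * S" unfolding abs_mult using P1 T1 S1 by (intro mult_mono) auto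
      moreover have "\<bar>U\<^sup>2 * S\<^sup>2\<bar> \<le> U\<^sup>2 * S" using S2 by (simp add: abs_mult mult_left_mono)
      ultimately have "\<bar>P * (T - 1) + U\<^sup>2 * S\<^sup>2\<bar> \<le> 1 * S + U\<^sup>2 * S" by linarith
      then show ?thesis by (simp add: algebra_simps)
    qed
    have a3: "\<bar>U * P * S\<^sup>2 + Q * T\<bar> \<le> S * \<bar>U\<bar> + d * \<bar>U\<bar>"
    proof -
      have "\<bar>U * P * S\<^sup>2\<bar> = \<bar>U\<bar> * (\<bar>P\<bar> * S\<^sup>2)" by (simp add: abs_mult)
      also have "\<dots> \<le> \<bar>U\<bar> * (1 * S)" using P1 S2 by (intro mult_left_mono mult_mono) auto
      finally have "\<bar>U * P * S\<^sup>2\<bar> \<le> S * \<bar>U\<bar>" by (simp add: mult_ac)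
      moreover have "\<bar>Q * T\<bar> \<le> (d * \<bar>U\<bar>) * 1" unfolding abs_mult using Q S1 TS by (intro mult_mono) auto
      ultimately show ?thesis by linarith
    qed
    have b1: "S * (2 * \<bar>U\<bar>) + S * \<bar>U\<bar> \<le> S * (3/2 * ?g)"
      using mult_left_mono[OF u2 TS(3)] by (simp add: algebra_simps)
    have b2: "d * \<bar>U\<bar> \<le> d * ?g"
      using u2 Q(2) by (intro mult_left_mono) auto
    have "norm E \<le> \<bar>2 * S * T * U\<bar> + \<bar>P * (T - 1) + U\<^sup>2 * S\<^sup>2\<bar> + \<bar>U * P * S\<^sup>2 + Q * T\<bar>"
      unfolding E_def by (rule norm_triple_le)
    also have "\<dots> \<le> S * (3/2 * ?g) + S * ?g + d * ?g" using a1 a2 a3 b1 b2 by linarith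
    also have "\<dots> = (10 * S + 4 * d) * (?g / 4)" by (simp add: field_simps)
    also have "\<dots> \<le> (10 * S + 4 * d) * norm ?w" using low TS Q by (intro mult_left_mono) auto
    finally have "norm E / norm ?w \<le> 10 * S + 4 * d" using w by (simp add: pos_divide_le_eq)
    then show ?thesis using norm_sph_deriv_le[of ?w E] by linarith
  qed
  \<comment> \<open>The 16 is \<open>2 * ?g * ?g\<close> over the product of the lower bounds
    \<open>?g / 4\<close> and \<open>?g / 2\<close> for the two base points.\<close>
  moreover have "norm (sph_deriv ?w (std' U)) \<le> norm (sph_deriv (std U) (std' U)) + 16 * (3 * S + k)"
  proof -
    have d: "norm (std' U) \<le> 2 * ?g"
    proof -
      have "norm (std' U) \<le> 1 + 2 * \<bar>U\<bar>"
        using norm_triple_le[of 0 1 "2 * U"] unfolding std'_def by (simp add: abs_mult)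
      also have "\<dots> \<le> 1 + ?g" using u2 by simp
      also have "\<dots> \<le> 2 * ?g" by simp
      finally show ?thesis .
    qed
    have diff: "norm (?w - std U) \<le> ?g * (3 * S + k)"
    proof -
      have "?w - std U = (- 2 * S, - U * (1 - T), P * T)" by (simp add: std_def algebra_simps)
      then have "norm (?w - std U) \<le> \<bar>- 2 * S\<bar> + \<bar>- U * (1 - T)\<bar> + \<bar>P * T\<bar>"
        by (simp only: norm_triple_le)
      also have "\<dots> \<le> 2 * S + \<bar>U\<bar> * S + k * 1"
        unfolding abs_mult using TS S1 T1 P k0 by (intro add_mono mult_mono) auto
      also have "\<dots> \<le> 2 * (S * ?g) + S * ?g + k * ?g"
      proof -
        have "S * 1 \<le> S * ?g" "k * 1 \<le> k * ?g" using TS k0 g1 by (intro mult_left_mono; simp)+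
        moreover have "\<bar>U\<bar> * S \<le> S * ?g" using u2 TS(3) mult_left_mono[of "\<bar>U\<bar>" ?g S] by (simp add: mult.commute)
        ultimately show ?thesis by linarith
      qed
      finally show ?thesis by (simp add: algebra_simps)
    qed
    have "norm (std' U) * norm (?w - std U) / (norm ?w * norm (std U)) \<le> (2 * ?g) * (?g * (3 * S + k)) / (?g / 4 * (?g / 2))"
    proof (rule frac_le)
      show "norm (std' U) * norm (?w - std U) \<le> (2 * ?g) * (?g * (3 * S + k))"
        using d diff g1 by (intro mult_mono) auto
      show "?g / 4 * (?g / 2) \<le> norm ?w * norm (std U)"
        using low z g1 by (intro mult_mono) auto
    qed (use TS k0 in \<open>auto intro!: mult_pos_pos add_pos_nonneg\<close>)
    also have "\<dots> = 16 * (3 * S + k)"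
    proof -
      have "(2 * g) * (g * c) / (g / 4 * (g / 2)) = 16 * c" if "g \<noteq> 0" for g c :: real
        using that by (simp add: field_simps)
      from this[OF less_imp_neq[OF gp, symmetric]] show ?thesis .
    qed
    finally show ?thesis using norm_sph_deriv_perturb[OF wn zn, of "std' U"] by linarith
  qed
  then have "\<bar>P\<bar> * norm (sph_deriv ?w (std' U)) \<le> \<bar>P\<bar> * (norm (sph_deriv (std U) (std' U)) + 16 * (3 * S + k))"
    by (intro mult_left_mono) auto
  \<comment> \<open>Here \<open>k \<le> 1 / 8\<close> turns \<open>48 * k * S\<close> into
    \<open>6 * S\<close>, which adds to the \<open>10 * S\<close> above to give
    \<open>16 * S\<close>.\<close>
  moreover have "\<bar>P\<bar> * (16 * (3 * S + k)) \<le> 6 * S + 16 * k\<^sup>2"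
  proof -
    have "\<bar>P\<bar> * (16 * (3 * S + k)) \<le> k * (16 * (3 * S + k))" using P TS k0 by (intro mult_right_mono) auto
    moreover have "k * (48 * S) \<le> 1/8 * (48 * S)" using P TS by (intro mult_right_mono) auto
    ultimately show ?thesis by (simp add: power2_eq_square algebra_simps)
  qed
  ultimately show ?thesis by (simp add: distrib_left)
qed

section \<open>Sharpness\<close>

lemma integral_le_antiderivative:
  fixes f B B' :: "real \<Rightarrow> real"
  assumes "a \<le> b" "continuous_on {a..b} f"
    and "\<And>t. t \<in> {a..b} \<Longrightarrow> (B has_real_derivative B' t) (at t)"
    and "\<And>t. t \<in> {a..b} \<Longrightarrow> f t \<le> B' t"
  shows "integral {a..b} f \<le> B b - B a"
proof (rule has_integral_le)
  show "(f has_integral integral {a..b} f) {a..b}"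
    using assms(2) by (intro integrable_integral integrable_continuous_interval)
  show "(B' has_integral (B b - B a)) {a..b}"
  proof (rule fundamental_theorem_of_calculus[OF assms(1)])
    fix t assume "t \<in> {a..b}"
    then show "(B has_vector_derivative B' t) (at t within {a..b})"
      using assms(3) has_field_derivative_at_within has_real_derivative_iff_has_vector_derivative by blast
  qed
qed (rule assms(4))

definition conic_arc :: "real \<Rightarrow> real" where
  "conic_arc x = integral {-2*pi..x} conic_speed"

lemma conic_arc_deriv:
  assumes "-2*pi < x" "x < 2*pi"
  shows "(conic_arc has_real_derivative conic_speed x) (at x)"
proof -
  have "(conic_arc has_real_derivative conic_speed x) (at x within {-2*pi..2*pi})"
    unfolding conic_arc_def[abs_def] using assms
    by (intro integral_has_real_derivative conic_speed_cont) auto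
  then show ?thesis using assms by (simp add: at_within_Icc_at)
qed

lemma conic_arc_diff_le:
  assumes "-2*pi \<le> x" "x \<le> z" "z \<le> 2*pi"
  shows "conic_arc z - conic_arc x \<le> L_Omega"
proof -
  have I: "conic_speed integrable_on {a..b}" for a b by (rule conic_speed_integrable)
  have nn: "integral {a..b} conic_speed \<ge> 0" for a b
    by (intro integral_nonneg I) (simp add: conic_speed_pos less_imp_le)
  have "conic_arc (2*pi) = conic_arc z + integral {z..2*pi} conic_speed"
    unfolding conic_arc_def using assms by (intro Henstock_Kurzweil_Integration.integral_combine[symmetric] I) auto
  moreover have "conic_arc (2*pi) = L_Omega"
    unfolding conic_arc_def using integral_conic_speed by simp
  moreover have "conic_arc x \<ge> 0" unfolding conic_arc_def by (rule nn)
  ultimately show ?thesis using nn[of z "2*pi"] by linarith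
qed

section \<open>The extremal example\<close>

text \<open>\<open>M\<close> is the maximal phase velocity. The bound on \<open>M * \<delta>\<close>
  keeps the phase acceleration within the range \<open>k \<le> 1 / 8\<close> of
  \<open>perturbed_speed_bound\<close>.\<close>

locale bouncing =
  fixes M \<delta> :: real
  assumes M: "2 \<le> M" and \<delta>: "0 < \<delta>" and M\<delta>: "M * \<delta> \<le> 1 / 8"
begin

definition ph where "ph t = M / \<delta> * sin (\<delta> * t)"
definition ph1 where "ph1 t = M * cos (\<delta> * t)"
definition ph2 where "ph2 t = - (M * \<delta>) * sin (\<delta> * t)"
definition ph3 where "ph3 t = - (M * \<delta>\<^sup>2) * cos (\<delta> * t)"

definition y where "y t = cosh (ph t) - 2"
definition y1 where "y1 t = sinh (ph t) * ph1 t"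
definition y2 where "y2 t = cosh (ph t) * (ph1 t)\<^sup>2 + sinh (ph t) * ph2 t"
definition y3 where "y3 t = sinh (ph t) * ph1 t ^ 3 + 3 * (cosh (ph t) * (ph1 t * ph2 t)) + sinh (ph t) * ph3 t"

definition X where "X t = (y t, y1 t, y2 t)"
definition X' where "X' t = (y1 t, y2 t, y3 t)"
definition sp where "sp t = norm (sph_deriv (X t) (X' t))"

text \<open>Half the period of the phase, but a full period of \<open>y\<close>, because shifting by
  it only reverses the sign of the phase.\<close>

definition H where "H = pi / \<delta>"
definition S where "S t = 1 / cosh (ph t)"
definition T where "T t = tanh (ph t)"

lemma H_pos: "H > 0" using \<delta> by (simp add: H_def)

lemma M_pos: "M > 0" using M by simp

lemma ph_derivs:
  "(ph has_real_derivative ph1 t) (at t within A)"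
  "(ph1 has_real_derivative ph2 t) (at t within A)"
  "(ph2 has_real_derivative ph3 t) (at t within A)"
proof -
  show "(ph has_real_derivative ph1 t) (at t within A)"
    unfolding ph_def[abs_def] ph1_def using \<delta>
    by (auto intro!: derivative_eq_intros)
  show "(ph1 has_real_derivative ph2 t) (at t within A)"
    unfolding ph1_def[abs_def] ph2_def
    by (auto intro!: derivative_eq_intros)
  show "(ph2 has_real_derivative ph3 t) (at t within A)"
    unfolding ph2_def[abs_def] ph3_def
    by (auto intro!: derivative_eq_intros simp: power2_eq_square)
qed

lemma sinh_ph_deriv: "((\<lambda>t. sinh (ph t)) has_real_derivative cosh (ph t) * ph1 t) (at t within A)"
  and cosh_ph_deriv: "((\<lambda>t. cosh (ph t)) has_real_derivative sinh (ph t) * ph1 t) (at t within A)"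
  by (rule has_field_derivative_sinh[OF ph_derivs(1)] has_field_derivative_cosh[OF ph_derivs(1)])+

lemma y_derivs:
  "(y has_real_derivative y1 t) (at t within A)"
  "(y1 has_real_derivative y2 t) (at t within A)"
  "(y2 has_real_derivative y3 t) (at t within A)"
proof -
  show "(y has_real_derivative y1 t) (at t within A)"
    unfolding y_def[abs_def] y1_def
    by (rule DERIV_cong, rule DERIV_diff[OF cosh_ph_deriv DERIV_const]) simp
  show "(y1 has_real_derivative y2 t) (at t within A)"
    unfolding y1_def[abs_def] y2_def
    by (rule DERIV_cong, rule DERIV_mult[OF sinh_ph_deriv ph_derivs(2)]) (simp add: power2_eq_square algebra_simps)
  have "((\<lambda>t. (ph1 t)\<^sup>2) has_real_derivative 2 * ph1 t * ph2 t) (at t within A)"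
    by (rule DERIV_cong, rule DERIV_power[OF ph_derivs(2)]) simp
  note d = DERIV_add[OF DERIV_mult[OF cosh_ph_deriv this] DERIV_mult[OF sinh_ph_deriv ph_derivs(3)]]
  show "(y2 has_real_derivative y3 t) (at t within A)"
    unfolding y2_def[abs_def] y3_def
    by (rule DERIV_cong, rule d) (simp add: power2_eq_square power3_eq_cube algebra_simps)
qed

lemma TS: "(T t)\<^sup>2 + (S t)\<^sup>2 = 1"
proof -
  have e: "(sinh (ph t))\<^sup>2 + 1 = (cosh (ph t))\<^sup>2" by (rule cosh_square_eq[symmetric])
  have "(T t)\<^sup>2 + (S t)\<^sup>2 = ((sinh (ph t))\<^sup>2 + 1) / (cosh (ph t))\<^sup>2"
    by (simp add: T_def S_def tanh_def power_divide add_divide_distrib)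
  also have "\<dots> = 1" unfolding e by simp
  finally show ?thesis .
qed

lemma S_pos: "0 < S t" by (simp add: S_def)

lemma ph1_sq: "(ph1 t)\<^sup>2 = M\<^sup>2 * (1 - (sin (\<delta> * t))\<^sup>2)"
  by (simp add: ph1_def power_mult_distrib cos_squared_eq)

lemma abs_ph2: "\<bar>ph2 t\<bar> \<le> M * \<delta>"
proof -
  have "\<bar>ph2 t\<bar> = (M * \<delta>) * \<bar>sin (\<delta> * t)\<bar>" using M_pos \<delta> by (simp add: ph2_def abs_mult)
  also have "\<dots> \<le> (M * \<delta>) * 1" using M_pos \<delta> by (intro mult_left_mono) auto
  finally show ?thesis by simp
qed

lemma cosh_ge_abs: "(1 + \<bar>x\<bar>) / 2 \<le> cosh x" for x :: real
proof -
  have "1 + \<bar>x\<bar> \<le> exp \<bar>x\<bar>" by (rule exp_ge_add_one_self)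
  also have "\<dots> \<le> exp x + exp (- x)" by (cases "x \<ge> 0") auto
  finally show ?thesis by (simp add: cosh_field_def)
qed

text \<open>Phase and velocity cannot both be small: the squares of \<open>\<delta> * ph t\<close>
  and \<open>ph1 t\<close> add up to \<open>M\<^sup>2\<close>.\<close>

lemma ph_large:
  assumes "(ph1 t)\<^sup>2 \<le> M\<^sup>2 / 4"
  shows "3 / 4 * (M / \<delta>) \<le> \<bar>ph t\<bar>"
proof -
  let ?s = "sin (\<delta> * t)"
  have "M\<^sup>2 * (1 - ?s\<^sup>2) \<le> M\<^sup>2 * (1 / 4)" using assms unfolding ph1_sq by simp
  then have "1 - ?s\<^sup>2 \<le> 1 / 4"
    by (rule mult_left_le_imp_le) (use M_pos in simp)
  moreover have "?s\<^sup>2 \<le> \<bar>?s\<bar>"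
  proof -
    have "\<bar>?s\<bar> * \<bar>?s\<bar> \<le> \<bar>?s\<bar> * 1" by (intro mult_left_mono) auto
    then show ?thesis by (simp add: power2_eq_square)
  qed
  ultimately have "3 / 4 \<le> \<bar>?s\<bar>" by linarith
  then have "(M / \<delta>) * (3 / 4) \<le> (M / \<delta>) * \<bar>?s\<bar>" using M_pos \<delta> by (intro mult_left_mono) auto
  then show ?thesis using M_pos \<delta> by (simp add: ph_def abs_mult mult.commute)
qed

lemma S_small:
  assumes "(ph1 t)\<^sup>2 \<le> M\<^sup>2 / 4"
  shows "S t \<le> 8 / 3 * (\<delta> / M)"
proof -
  have p: "0 < 3 / 8 * (M / \<delta>)" using M_pos \<delta> by simp
  have "3 / 8 * (M / \<delta>) \<le> cosh (ph t)"
  proof -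
    have "3 / 8 * x \<le> c" if "3 / 4 * x \<le> a" "(1 + a) / 2 \<le> c" for x a c :: real
      using that by (simp add: field_simps)
    then show ?thesis using ph_large[OF assms] cosh_ge_abs[of "ph t"] by blast
  qed
  then have "1 / cosh (ph t) \<le> 1 / (3 / 8 * (M / \<delta>))"
    using p by (intro divide_left_mono mult_pos_pos) auto
  then show ?thesis by (simp add: S_def field_simps)
qed

lemma \<delta>M: "\<delta> / M \<le> 1 / 32"
proof -
  have "2 * \<delta> \<le> M * \<delta>" using M \<delta> by (intro mult_right_mono) auto
  then have "\<delta> \<le> 1 / 16" using M\<delta> by linarith
  then have "\<delta> \<le> 1 / 32 * M" using M by linarith
  then show ?thesis using M_pos by (simp add: pos_divide_le_eq)
qed

text \<open>At small velocity the phase is large, so \<open>S\<close> is small and the first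
  coordinate is near 1; otherwise the last coordinate equals the squared velocity up to 1 /
  8.\<close>

lemma norm_lower:
  "(1 + (ph1 t)\<^sup>2) / 4 \<le> norm (1 - 2 * S t, ph1 t * T t, (ph1 t)\<^sup>2 + ph2 t * T t)"
    (is "_ \<le> norm ?w")
proof (cases "(ph1 t)\<^sup>2 \<le> 1")
  case True
  have "2 * 2 \<le> M * M" using M by (intro mult_mono) auto
  then have "(ph1 t)\<^sup>2 \<le> M\<^sup>2 / 4" using True by (simp add: power2_eq_square)
  then have "S t \<le> 1 / 4" using S_small[of t] \<delta>M by linarith
  then have "1 / 2 \<le> \<bar>1 - 2 * S t\<bar>" by linarith
  also have "\<dots> \<le> norm ?w" by (rule abs_fst_le_norm)
  finally have "1 / 2 \<le> norm ?w" .
  moreover have "(1 + (ph1 t)\<^sup>2) / 4 \<le> 1 / 2" using True by simp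
  ultimately show ?thesis by (rule order_trans[rotated])
next
  case False
  have "\<bar>T t\<bar> \<le> 1" using TS[of t] by (metis abs_square_le_1 le_add_same_cancel1 zero_le_power2)
  then have "\<bar>ph2 t * T t\<bar> \<le> M * \<delta> * 1"
    unfolding abs_mult using abs_ph2 M_pos \<delta> by (intro mult_mono) auto
  then have "\<bar>ph2 t * T t\<bar> \<le> 1 / 8" using M\<delta> by linarith
  then have "8 * \<bar>ph2 t * T t\<bar> \<le> 1" by simp
  moreover have "1 + p \<le> 4 * \<bar>p + r\<bar>" if "8 * \<bar>r\<bar> \<le> 1" "\<not> p \<le> 1" for p r :: real
    using that by argo
  ultimately have "1 + (ph1 t)\<^sup>2 \<le> 4 * \<bar>(ph1 t)\<^sup>2 + ph2 t * T t\<bar>" using False by blast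
  then have "(1 + (ph1 t)\<^sup>2) / 4 \<le> \<bar>(ph1 t)\<^sup>2 + ph2 t * T t\<bar>" by simp
  also have "\<dots> \<le> norm ?w" by (rule abs_thd_le_norm)
  finally show ?thesis .
qed

lemma X_eq: "X t = cosh (ph t) *\<^sub>R (1 - 2 * S t, ph1 t * T t, (ph1 t)\<^sup>2 + ph2 t * T t)"
proof -
  have "cosh (ph t) \<noteq> 0" by simp
  then show ?thesis
    by (simp add: X_def y_def y1_def y2_def S_def T_def tanh_def algebra_simps)
qed

lemma X'_eq: "X' t = cosh (ph t) *\<^sub>R (T t * ph1 t, (ph1 t)\<^sup>2 + ph2 t * T t, T t * ph1 t ^ 3 + 3 * ph1 t * ph2 t + ph3 t * T t)"
proof -
  have "cosh (ph t) \<noteq> 0" by simp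
  then show ?thesis
    by (simp add: X'_def y1_def y2_def y3_def T_def tanh_def algebra_simps)
qed

lemma X_nz: "X t \<noteq> 0"
proof -
  have "0 < (1 + (ph1 t)\<^sup>2) / 4" by (simp add: add_pos_nonneg)
  then have "(1 - 2 * S t, ph1 t * T t, (ph1 t)\<^sup>2 + ph2 t * T t) \<noteq> 0"
    using norm_lower[of t] by (metis norm_zero not_less)
  then show ?thesis unfolding X_eq by (simp only: scaleR_eq_0_iff) simp
qed

lemma sp_le:
  assumes "0 \<le> ph t"
  shows "sp t \<le> \<bar>ph2 t\<bar> * (4 * conic_speed (4 * arctan (ph1 t)) / (1 + (ph1 t)\<^sup>2))
     + 16 * S t + 16 * (M * \<delta>)\<^sup>2 + 4 * \<delta>\<^sup>2"
proof -
  have c: "cosh (ph t) > 0" by simp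
  have "sph_deriv (X t) (X' t) = sph_deriv (1 - 2 * S t, ph1 t * T t, (ph1 t)\<^sup>2 + ph2 t * T t)
     (T t * ph1 t, (ph1 t)\<^sup>2 + ph2 t * T t, T t * ph1 t ^ 3 + 3 * ph1 t * ph2 t + ph3 t * T t)"
    unfolding X_eq X'_eq sph_deriv_scaleR_base[OF c] sph_deriv_scaleR by simp
  moreover have "norm (sph_deriv (1 - 2 * S t, ph1 t * T t, (ph1 t)\<^sup>2 + ph2 t * T t)
     (T t * ph1 t, (ph1 t)\<^sup>2 + ph2 t * T t, T t * ph1 t ^ 3 + 3 * ph1 t * ph2 t + ph3 t * T t))
     \<le> \<bar>ph2 t\<bar> * norm (sph_deriv (std (ph1 t)) (std' (ph1 t))) + 16 * S t + 16 * (M * \<delta>)\<^sup>2 + 4 * \<delta>\<^sup>2"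
  proof (rule perturbed_speed_bound[OF TS])
    show "0 \<le> T t" using assms by (simp add: T_def)
    show "\<bar>ph3 t\<bar> \<le> \<delta>\<^sup>2 * \<bar>ph1 t\<bar>" using M_pos by (simp add: ph3_def ph1_def abs_mult)
  qed (use S_pos[of t] abs_ph2 M\<delta> norm_lower in auto)
  ultimately show ?thesis unfolding sp_def norm_sph_deriv_std by simp
qed

text \<open>Prepares the integration of \<open>S\<close>: at velocity above \<open>M / 2\<close> it
  is dominated by \<open>\<bar>ph1 t\<bar> * S t\<close>, which has an explicit antiderivative up to
  sign, and elsewhere \<open>S\<close> is uniformly small.\<close>

lemma S_le: "S t \<le> 2 / M * (\<bar>ph1 t\<bar> * S t) + 8 / 3 * (\<delta> / M)"
proof (cases "(ph1 t)\<^sup>2 \<le> M\<^sup>2 / 4")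
  case True
  have "0 \<le> 2 / M * (\<bar>ph1 t\<bar> * S t)" using M_pos S_pos[of t] by simp
  then show ?thesis using S_small[OF True] by linarith
next
  case False
  then have "(M / 2)\<^sup>2 < (\<bar>ph1 t\<bar>)\<^sup>2" by (simp add: power_divide)
  then have "M / 2 < \<bar>ph1 t\<bar>" by (rule power2_less_imp_less) simp
  then have "M / 2 * S t \<le> \<bar>ph1 t\<bar> * S t" using S_pos[of t] by (intro mult_right_mono) auto
  then have "2 / M * (M / 2 * S t) \<le> 2 / M * (\<bar>ph1 t\<bar> * S t)" using M_pos by (intro mult_left_mono) auto
  moreover have "2 / M * (M / 2 * S t) = S t" using M_pos by simp
  moreover have "0 \<le> 8 / 3 * (\<delta> / M)" using M_pos \<delta> by simp
  ultimately show ?thesis by linarith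
qed

text \<open>The constant part of the speed bound. The first term is 16 times the uniform part 8 / 3
  * (\<delta> / M) of \<open>S_le\<close>.\<close>

definition err where "err = 128 / 3 * (\<delta> / M) + 16 * (M * \<delta>)\<^sup>2 + 4 * \<delta>\<^sup>2"

text \<open>An antiderivative of the leading term of the speed: arc length along the boundary of
  \<open>\<Omega>\<^sub>+\<close>, with a minus sign because the velocity decreases on
  \<open>[0, H]\<close>.\<close>

definition G where "G t = - conic_arc (4 * arctan (ph1 t))"

lemma G_deriv: "(G has_real_derivative - ph2 t * (4 * conic_speed (4 * arctan (ph1 t)) / (1 + (ph1 t)\<^sup>2))) (at t)"
proof -
  have r: "-2*pi < 4 * arctan (ph1 t)" "4 * arctan (ph1 t) < 2*pi"
    using arctan_bounded[of "ph1 t"] by auto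
  have "((\<lambda>t. 4 * arctan (ph1 t)) has_real_derivative 4 * (inverse (1 + (ph1 t)\<^sup>2) * ph2 t)) (at t)"
    by (intro DERIV_cmult DERIV_chain2[OF DERIV_arctan ph_derivs(2)])
  from DERIV_minus[OF DERIV_chain2[OF conic_arc_deriv[OF r] this]] show ?thesis
    unfolding G_def[abs_def] by (rule DERIV_cong) (simp add: divide_inverse mult_ac)
qed

text \<open>The Gudermannian of the phase, whose derivative with respect to the phase is
  sech.\<close>

definition A where "A t = arctan (sinh (ph t))"

lemma A_deriv: "(A has_real_derivative ph1 t * S t) (at t)"
proof -
  have c: "cosh (ph t) \<noteq> 0" by simp
  have "1 + (sinh (ph t))\<^sup>2 = (cosh (ph t))\<^sup>2" using cosh_square_eq[of "ph t"] by simp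
  then have "inverse (1 + (sinh (ph t))\<^sup>2) * (cosh (ph t) * ph1 t) = ph1 t * S t"
    using c by (simp add: S_def power2_eq_square field_simps)
  then show ?thesis
    using DERIV_chain2[OF DERIV_arctan sinh_ph_deriv[of t UNIV]] unfolding A_def[abs_def] by metis
qed

lemma X_cont: "continuous_on B X" and X'_cont: "continuous_on B X'"
proof -
  have c: "continuous_on B ph" "continuous_on B ph1" "continuous_on B ph2" "continuous_on B ph3"
    unfolding ph_def[abs_def] ph1_def[abs_def] ph2_def[abs_def] ph3_def[abs_def] by (intro continuous_intros)+
  have ch: "continuous_on B (\<lambda>t. cosh (ph t))" "continuous_on B (\<lambda>t. sinh (ph t))"
    by (rule DERIV_continuous_on, rule cosh_ph_deriv) (rule DERIV_continuous_on, rule sinh_ph_deriv)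
  show "continuous_on B X" "continuous_on B X'"
    unfolding X_def[abs_def] X'_def[abs_def] y_def y1_def y2_def y3_def by (intro continuous_intros c ch)+
qed

lemma sp_cont: "continuous_on B sp"
  unfolding sp_def[abs_def] sph_deriv_def
  by (intro continuous_intros X_cont X'_cont) (use X_nz in auto)

lemma sin_nonneg: "0 \<le> t \<Longrightarrow> t \<le> H \<Longrightarrow> 0 \<le> sin (\<delta> * t)"
  using \<delta> by (intro sin_ge_zero) (auto simp: H_def field_simps)

lemma sp_le':
  assumes "0 \<le> t" "t \<le> H"
  shows "sp t \<le> - ph2 t * (4 * conic_speed (4 * arctan (ph1 t)) / (1 + (ph1 t)\<^sup>2))
     + 32 / M * (\<bar>ph1 t\<bar> * S t) + err"
proof -
  have "0 \<le> ph t" using sin_nonneg[OF assms] M_pos \<delta> by (simp add: ph_def)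
  moreover have "\<bar>ph2 t\<bar> = - ph2 t" using sin_nonneg[OF assms] M_pos \<delta> by (simp add: ph2_def abs_mult)
  ultimately show ?thesis
    using sp_le[of t] S_le[of t] unfolding err_def by (simp add: algebra_simps)
qed

text \<open>The interval is split at \<open>H / 2\<close>, where the velocity changes sign.
  \<open>A\<close> rises from 0 to at most pi / 2 and returns to 0, contributing at most pi; the
  leading term covers the part of the boundary with slopes between \<open>M\<close> and
  \<open>- M\<close>, of length at most \<open>L_Omega\<close>.\<close>

lemma length_bound: "integral {0..H} sp \<le> L_Omega + 32 * pi / M + err * H"
proof -
  have h: "0 < H / 2" "H / 2 < H" using H_pos by auto
  have 1: "integral {0..H / 2} sp \<le> (G (H / 2) + 32 / M * A (H / 2) + err * (H / 2)) - (G 0 + 32 / M * A 0 + err * 0)"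
  proof (rule integral_le_antiderivative)
    fix t assume t: "t \<in> {0..H / 2}"
    show "((\<lambda>t. G t + 32 / M * A t + err * t) has_real_derivative
        - ph2 t * (4 * conic_speed (4 * arctan (ph1 t)) / (1 + (ph1 t)\<^sup>2)) + 32 / M * (ph1 t * S t) + err * 1) (at t)"
      by (intro DERIV_add DERIV_cmult G_deriv A_deriv DERIV_ident)
    have "0 \<le> cos (\<delta> * t)" using t \<delta> by (intro cos_ge_zero) (auto simp: H_def field_simps intro: order_trans[of _ 0])
    then have "\<bar>ph1 t\<bar> = ph1 t" using M_pos by (simp add: ph1_def)
    then show "sp t \<le> - ph2 t * (4 * conic_speed (4 * arctan (ph1 t)) / (1 + (ph1 t)\<^sup>2)) + 32 / M * (ph1 t * S t) + err * 1"
      using sp_le'[of t] t h by simp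
  qed (use h sp_cont in auto)
  have 2: "integral {H / 2..H} sp \<le> (G H + 32 / M * - A H + err * H) - (G (H / 2) + 32 / M * - A (H / 2) + err * (H / 2))"
  proof (rule integral_le_antiderivative)
    fix t assume t: "t \<in> {H / 2..H}"
    show "((\<lambda>t. G t + 32 / M * - A t + err * t) has_real_derivative
        - ph2 t * (4 * conic_speed (4 * arctan (ph1 t)) / (1 + (ph1 t)\<^sup>2)) + 32 / M * - (ph1 t * S t) + err * 1) (at t)"
      by (intro DERIV_add DERIV_cmult DERIV_minus G_deriv A_deriv DERIV_ident)
    have "0 \<le> cos (pi - \<delta> * t)" using t \<delta> by (intro cos_ge_zero) (auto simp: H_def field_simps)
    then have "cos (\<delta> * t) \<le> 0" by (simp add: cos_diff)
    then have "ph1 t \<le> 0" using M_pos by (simp add: ph1_def mult_nonneg_nonpos)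
    then have "\<bar>ph1 t\<bar> * S t = - (ph1 t * S t)" by simp
    then show "sp t \<le> - ph2 t * (4 * conic_speed (4 * arctan (ph1 t)) / (1 + (ph1 t)\<^sup>2)) + 32 / M * - (ph1 t * S t) + err * 1"
      using sp_le'[of t] t h by simp
  qed (use h sp_cont in auto)
  have "integral {0..H} sp = integral {0..H / 2} sp + integral {H / 2..H} sp"
    using h by (intro Henstock_Kurzweil_Integration.integral_combine[symmetric] integrable_continuous_interval sp_cont) auto
  moreover have "A 0 = 0" "A H = 0" using \<delta> by (simp_all add: A_def ph_def H_def)
  moreover have "32 / M * A (H / 2) \<le> 32 / M * (pi / 2)"
    using M_pos arctan_ubound[of "sinh (ph (H / 2))"] by (intro mult_left_mono) (auto simp: A_def less_imp_le)
  moreover have "G H - G 0 \<le> L_Omega"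
  proof -
    have "ph1 0 = M" "ph1 H = - M" using \<delta> by (simp_all add: ph1_def H_def)
    then have "G H - G 0 = conic_arc (4 * arctan M) - conic_arc (- (4 * arctan M))"
      by (simp add: G_def arctan_minus)
    also have "\<dots> \<le> L_Omega"
      using arctan_bounded[of M] M_pos by (intro conic_arc_diff_le) auto
    finally show ?thesis .
  qed
  moreover have "32 / M * (pi / 2) + 32 / M * (pi / 2) = 32 * pi / M" by simp
  ultimately show ?thesis using 1 2 by (simp add: algebra_simps)
qed

lemma shift_H: "sin (\<delta> * (t + H)) = - sin (\<delta> * t)" "cos (\<delta> * (t + H)) = - cos (\<delta> * t)"
proof -
  have "\<delta> * (t + H) = \<delta> * t + pi" using \<delta> by (simp add: H_def algebra_simps)
  then show "sin (\<delta> * (t + H)) = - sin (\<delta> * t)" "cos (\<delta> * (t + H)) = - cos (\<delta> * t)" by simp_all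
qed

lemma y_periodic: "y (t + H) = y t"
  by (simp add: y_def ph_def shift_H)

text \<open>All phase derivatives change sign together, and \<open>y\<close> and its derivatives are
  even in them jointly.\<close>

lemma sp_periodic: "sp (t + H) = sp t"
proof -
  have "ph (t + H) = - ph t" "ph1 (t + H) = - ph1 t" "ph2 (t + H) = - ph2 t" "ph3 (t + H) = - ph3 t"
    by (simp_all add: ph_def ph1_def ph2_def ph3_def shift_H)
  then have "X (t + H) = X t" "X' (t + H) = X' t"
    by (simp_all add: X_def X'_def y_def y1_def y2_def y3_def)
  then show ?thesis by (simp add: sp_def)
qed

lemma integral_sp_step: "t \<ge> 0 \<Longrightarrow> integral {0..t + H} sp = integral {0..t} sp + integral {0..H} sp"
proof -
  assume t: "t \<ge> 0"
  have "integral {0..t} (sp \<circ> (\<lambda>x. x + H)) = integral {0 + H..t + H} sp"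
    using integral_shift[of 0 H t sp] sp_cont by simp
  moreover have "sp \<circ> (\<lambda>x. x + H) = sp" using sp_periodic by (simp add: fun_eq_iff)
  moreover have "integral {0..t + H} sp = integral {0..H} sp + integral {H..t + H} sp"
    using t H_pos
    by (intro Henstock_Kurzweil_Integration.integral_combine[symmetric] integrable_continuous_interval sp_cont) auto
  ultimately show ?thesis by simp
qed

text \<open>On this interval the phase is a single nonnegative arch, which crosses the level arcosh
  2 once on the way up and once on the way down. The interval is half-open so that consecutive
  periods do not overlap.\<close>

lemma zeros_in_period:
  obtains p q where "p \<noteq> q" "{t. 0 \<le> t \<and> t < H \<and> y t = 0} = {p, q}"
proof -
  define r where "r = \<delta> / M * arcosh 2"
  have ac: "0 < arcosh (2 :: real)" "arcosh (2 :: real) \<le> 3"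
  proof -
    have s: "0 < sqrt (2\<^sup>2 - 1 :: real)" "sqrt (2\<^sup>2 - 1 :: real) \<le> 2"
      by (auto intro: real_le_lsqrt)
    have e: "arcosh (2 :: real) = ln (2 + sqrt (2\<^sup>2 - 1))" by (simp add: arcosh_real_def)
    show "0 < arcosh (2 :: real)" unfolding e by (rule ln_gt_zero) (use s in linarith)
    have "ln (2 + sqrt (2\<^sup>2 - 1 :: real)) \<le> (2 + sqrt (2\<^sup>2 - 1)) - 1"
      by (rule ln_le_minus_one) (use s in linarith)
    then show "arcosh (2 :: real) \<le> 3" unfolding e using s by linarith
  qed
  have r: "0 < r" "r < 1"
  proof -
    show "0 < r" using ac M_pos \<delta> by (simp add: r_def)
    have "r \<le> 1 / 32 * 3" unfolding r_def using \<delta>M ac M_pos \<delta> by (intro mult_mono) auto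
    then show "r < 1" by simp
  qed
  have a: "0 < arcsin r" "arcsin r < pi / 2" "sin (arcsin r) = r"
    using r arcsin_less_arcsin[of 0 r] arcsin_less_arcsin[of r 1] sin_arcsin[of r] by simp_all
  have zero: "y t = 0 \<longleftrightarrow> sin (\<delta> * t) = r" if t: "0 \<le> t" "t \<le> H" for t
  proof -
    have p: "0 \<le> ph t" using sin_nonneg[OF t] M_pos \<delta> by (simp add: ph_def)
    have "cosh (arcosh 2) = (2 :: real)" by (rule cosh_arcosh_real) simp
    then have "y t = 0 \<longleftrightarrow> ph t = arcosh 2"
      using p arcosh_cosh_real[OF p] unfolding y_def by auto
    also have "\<dots> \<longleftrightarrow> sin (\<delta> * t) = r"
      using M_pos \<delta> by (auto simp: ph_def r_def field_simps)
    finally show ?thesis .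
  qed
  define p q where "p = arcsin r / \<delta>" and "q = (pi - arcsin r) / \<delta>"
  have pq: "0 \<le> p" "p < H" "0 \<le> q" "q < H" "p < q"
  proof -
    have b: "0 \<le> arcsin r" "arcsin r < pi" "0 \<le> pi - arcsin r" "pi - arcsin r < pi" "arcsin r < pi - arcsin r"
      using a pi_gt_zero by linarith+
    show "0 \<le> p" "0 \<le> q" unfolding p_def q_def using b \<delta> by simp_all
    show "p < H" "q < H" "p < q" unfolding p_def q_def H_def using b \<delta>
      by (simp_all only: divide_strict_right_mono)
  qed
  have "{t. 0 \<le> t \<and> t < H \<and> y t = 0} = {p, q}"
  proof (intro equalityI subsetI)
    fix t assume "t \<in> {t. 0 \<le> t \<and> t < H \<and> y t = 0}"
    then have t: "0 \<le> t" "t < H" "sin (\<delta> * t) = r" using zero[of t] by auto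
    have b: "0 \<le> \<delta> * t" "\<delta> * t < pi" using t \<delta> by (auto simp: H_def field_simps)
    show "t \<in> {p, q}"
    proof (cases "\<delta> * t \<le> pi / 2")
      case True
      have "arcsin (sin (\<delta> * t)) = \<delta> * t" using True b by (intro arcsin_sin) auto
      then show ?thesis using t \<delta> by (simp add: p_def)
    next
      case False
      have "arcsin (sin (pi - \<delta> * t)) = pi - \<delta> * t" using False b by (intro arcsin_sin) auto
      then show ?thesis using t \<delta> by (simp add: q_def)
    qed
  next
    fix t assume "t \<in> {p, q}"
    moreover have "sin (\<delta> * p) = r" "sin (\<delta> * q) = r" using a \<delta> by (simp_all add: p_def q_def)
    ultimately show "t \<in> {t. 0 \<le> t \<and> t < H \<and> y t = 0}" using zero pq by auto
  qed
  then show thesis using pq(5) by (intro that[of p q]) simp_all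
qed

abbreviation "Z t \<equiv> {s \<in> {0..t}. y s = 0}"

lemma Z_step:
  assumes "t \<ge> 0"
  shows "Z (t + H) = {s. 0 \<le> s \<and> s < H \<and> y s = 0} \<union> (\<lambda>s. s + H) ` Z t"
proof (intro equalityI subsetI)
  fix s assume s: "s \<in> Z (t + H)"
  show "s \<in> {s. 0 \<le> s \<and> s < H \<and> y s = 0} \<union> (\<lambda>s. s + H) ` Z t"
  proof (cases "s < H")
    case False
    have "s - H \<in> Z t" using False s y_periodic[of "s - H"] by auto
    then have "(s - H) + H \<in> (\<lambda>s. s + H) ` Z t" by (rule imageI)
    then show ?thesis by simp
  qed (use s in auto)
next
  fix s assume "s \<in> {s. 0 \<le> s \<and> s < H \<and> y s = 0} \<union> (\<lambda>s. s + H) ` Z t"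
  then show "s \<in> Z (t + H)" using assms H_pos y_periodic by auto
qed

lemma Z_finite: "finite (Z t)"
proof -
  obtain p q where pq: "{t. 0 \<le> t \<and> t < H \<and> y t = 0} = {p, q}" using zeros_in_period by metis
  have n: "finite (Z (real n * H))" for n
  proof (induction n)
    case 0
    have "Z (real 0 * H) \<subseteq> {0}" by auto
    then show ?case by (rule finite_subset) simp
  next
    case (Suc n)
    have "Z (real n * H + H) = {p, q} \<union> (\<lambda>s. s + H) ` Z (real n * H)"
      using Z_step[of "real n * H"] H_pos pq by simp
    then show ?case using Suc by (simp add: algebra_simps)
  qed
  obtain n :: nat where "t / H \<le> real n" using real_arch_simple by blast
  then have "t \<le> real n * H" using H_pos by (simp add: field_simps)
  then have "Z t \<subseteq> Z (real n * H)" by auto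
  then show ?thesis using n by (rule finite_subset)
qed

lemma nzeros_step:
  assumes "t \<ge> 0"
  shows "nzeros y (t + H) = nzeros y t + 2"
proof -
  obtain p q where pq: "p \<noteq> q" "{t. 0 \<le> t \<and> t < H \<and> y t = 0} = {p, q}" using zeros_in_period by metis
  have "p < H" "q < H" using pq(2) by blast+
  then have "{p, q} \<inter> (\<lambda>s. s + H) ` Z t = {}" by auto
  moreover have "card ((\<lambda>s. s + H) ` Z t) = card (Z t)" by (intro card_image) (simp add: inj_on_def)
  ultimately show ?thesis
    unfolding nzeros_def Z_step[OF assms] pq(2) using Z_finite[of t] pq(1)
    by (subst card_Un_disjoint) auto
qed

lemma nzeros_limit: "((\<lambda>t. pi / t * real (nzeros y t)) \<longlongrightarrow> 2 * \<delta>) at_top"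
proof -
  have "((\<lambda>t. real (nzeros y t) / t) \<longlongrightarrow> 2 / H) at_top"
  proof (rule quasi_periodic_linear_growth[OF H_pos])
    show "real (nzeros y (t + H)) = real (nzeros y t) + 2" if "t \<ge> 0" for t
      using nzeros_step[OF that] by simp
    show "\<bar>real (nzeros y t)\<bar> \<le> real (nzeros y H)" if "0 \<le> t" "t \<le> H" for t
      using that Z_finite[of H] unfolding nzeros_def by (auto intro!: card_mono)
  qed
  then have "((\<lambda>t. pi * (real (nzeros y t) / t)) \<longlongrightarrow> pi * (2 / H)) at_top" by (rule tendsto_mult_left)
  moreover have "pi * (2 / H) = 2 * \<delta>" using \<delta> by (simp add: H_def)
  ultimately show ?thesis by simp
qed

section \<open>Smooth coefficients for the example\<close>

definition N where "N t = (y t)\<^sup>2 + (y1 t)\<^sup>2 + (y2 t)\<^sup>2"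

lemma N_nz: "N t \<noteq> 0"
proof
  assume "N t = 0"
  then have "y t = 0" "y1 t = 0" "y2 t = 0"
    unfolding N_def by (simp_all add: add_nonneg_eq_0_iff)
  then show False using X_nz[of t] by (simp add: X_def zero_prod_def)
qed

text \<open>Including \<open>inverse (N t)\<close> places the coefficients in the generated algebra
  without leaving it under differentiation.\<close>

definition basis where
  "basis = {\<lambda>t. sin (\<delta> * t), \<lambda>t. cos (\<delta> * t), \<lambda>t. sinh (ph t), \<lambda>t. cosh (ph t), \<lambda>t. inverse (N t)}"

lemmas alg = fun_algebra.add fun_algebra.mult fun_algebra.const fun_algebra_uminus fun_algebra_diff fun_algebra_power

lemma basis_mem:
  "(\<lambda>t. sin (\<delta> * t)) \<in> fun_algebra basis" "(\<lambda>t. cos (\<delta> * t)) \<in> fun_algebra basis"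
  "(\<lambda>t. sinh (ph t)) \<in> fun_algebra basis" "(\<lambda>t. cosh (ph t)) \<in> fun_algebra basis"
  "(\<lambda>t. inverse (N t)) \<in> fun_algebra basis"
  unfolding basis_def by (rule fun_algebra.base, simp)+

lemma ph_mem: "(\<lambda>t. ph1 t) \<in> fun_algebra basis" "(\<lambda>t. ph2 t) \<in> fun_algebra basis" "(\<lambda>t. ph3 t) \<in> fun_algebra basis"
  unfolding ph1_def ph2_def ph3_def by (intro alg basis_mem)+

lemma y_mem: "(\<lambda>t. y t) \<in> fun_algebra basis" "(\<lambda>t. y1 t) \<in> fun_algebra basis" "(\<lambda>t. y2 t) \<in> fun_algebra basis"
  "(\<lambda>t. y3 t) \<in> fun_algebra basis"
  unfolding y_def y1_def y2_def y3_def by (intro alg basis_mem ph_mem)+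

lemma basis_deriv:
  assumes "f \<in> basis"
  shows "\<exists>f'\<in>fun_algebra basis. \<forall>t\<in>Rplus. (f has_real_derivative f' t) (at t within Rplus)"
proof -
  let ?P = "\<lambda>f f'. f' \<in> fun_algebra basis \<and> (\<forall>t\<in>Rplus. (f has_real_derivative f' t) (at t within Rplus))"
  have l: "((\<lambda>t. \<delta> * t) has_real_derivative \<delta>) (at t within Rplus)" for t
    by (rule derivative_eq_intros refl | simp)+
  have 1: "?P (\<lambda>t. sin (\<delta> * t)) (\<lambda>t. cos (\<delta> * t) * \<delta>)"
    by (intro conjI alg basis_mem ballI DERIV_chain2[OF DERIV_sin l])
  have 2: "?P (\<lambda>t. cos (\<delta> * t)) (\<lambda>t. - sin (\<delta> * t) * \<delta>)"
    by (intro conjI alg basis_mem ballI DERIV_chain2[OF DERIV_cos l])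
  have 3: "?P (\<lambda>t. sinh (ph t)) (\<lambda>t. cosh (ph t) * ph1 t)"
    by (intro conjI alg basis_mem ph_mem ballI sinh_ph_deriv)
  have 4: "?P (\<lambda>t. cosh (ph t)) (\<lambda>t. sinh (ph t) * ph1 t)"
    by (intro conjI alg basis_mem ph_mem ballI cosh_ph_deriv)
  have 5: "?P (\<lambda>t. inverse (N t)) (\<lambda>t. - (inverse (N t) * (2 * (y t * y1 t + y1 t * y2 t + y2 t * y3 t)) * inverse (N t)))"
  proof (intro conjI ballI)
    show "(\<lambda>t. - (inverse (N t) * (2 * (y t * y1 t + y1 t * y2 t + y2 t * y3 t)) * inverse (N t))) \<in> fun_algebra basis"
      by (intro alg basis_mem y_mem)
    fix t
    have sq: "((\<lambda>t. (f t)\<^sup>2) has_real_derivative 2 * (f t * g)) (at t within Rplus)"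
      if "(f has_real_derivative g) (at t within Rplus)" for f g
      by (rule DERIV_cong, rule DERIV_power[OF that]) simp
    have "(N has_real_derivative 2 * (y t * y1 t) + 2 * (y1 t * y2 t) + 2 * (y2 t * y3 t)) (at t within Rplus)"
      unfolding N_def[abs_def] by (intro DERIV_add sq y_derivs)
    then have "(N has_real_derivative 2 * (y t * y1 t + y1 t * y2 t + y2 t * y3 t)) (at t within Rplus)"
      by (simp only: distrib_left)
    then show "((\<lambda>t. inverse (N t)) has_real_derivative
        - (inverse (N t) * (2 * (y t * y1 t + y1 t * y2 t + y2 t * y3 t)) * inverse (N t))) (at t within Rplus)"
      by (rule DERIV_inverse'[where f = N, OF _ N_nz])
  qed
  have "f = (\<lambda>t. sin (\<delta> * t)) \<or> f = (\<lambda>t. cos (\<delta> * t)) \<or> f = (\<lambda>t. sinh (ph t)) \<or>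
      f = (\<lambda>t. cosh (ph t)) \<or> f = (\<lambda>t. inverse (N t))"
    using assms unfolding basis_def by simp
  then have "\<exists>f'. ?P f f'"
    by (elim disjE; hypsubst) (rule exI, rule 1 2 3 4 5)+
  then show ?thesis by blast
qed

text \<open>The three coefficients form the multiple of the state \<open>(y'', y', y)\<close> whose
  inner product with it is \<open>- y'''\<close>; this is possible because the state never
  vanishes.\<close>

definition ca where "ca t = - (y3 t * y2 t) * inverse (N t)"
definition cb where "cb t = - (y3 t * y1 t) * inverse (N t)"
definition cc where "cc t = - (y3 t * y t) * inverse (N t)"

lemma smooth: "smooth_on_Rplus ca" "smooth_on_Rplus cb" "smooth_on_Rplus cc" "smooth_on_Rplus y"
proof -
  have "(\<lambda>t. ca t) \<in> fun_algebra basis" "(\<lambda>t. cb t) \<in> fun_algebra basis" "(\<lambda>t. cc t) \<in> fun_algebra basis"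
    unfolding ca_def cb_def cc_def by (intro alg basis_mem y_mem)+
  then show "smooth_on_Rplus ca" "smooth_on_Rplus cb" "smooth_on_Rplus cc" "smooth_on_Rplus y"
    using fun_algebra_smooth[OF basis_deriv] y_mem(1) by simp_all
qed

lemmas y_D = derivatives_unique[OF y_derivs[unfolded has_real_derivative_iff_has_vector_derivative]]

lemma sol: "is_solution ca cb cc y"
  unfolding is_solution_def
proof (intro ballI conjI y_D)
  fix t :: real assume t: "t \<in> Rplus"
  have "y3 t + ca t * y2 t + cb t * y1 t + cc t * y t = y3 t - y3 t * (N t * inverse (N t))"
    unfolding ca_def cb_def cc_def N_def by (simp add: power2_eq_square algebra_simps)
  then show "D3 y t + ca t * D2 y t + cb t * D1 y t + cc t * y t = 0"
    using y_D(1-3)[OF t] N_nz[of t] by simp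
qed

lemma nontrivial: "y 0 \<noteq> 0" by (simp add: y_def ph_def)

sublocale ode: ode3 ca cb cc y
proof
  show "\<exists>t\<in>Rplus. y t \<noteq> 0" using nontrivial by auto
qed (use smooth smooth_imp_continuous sol in auto)

lemma gamma3_sp: "gamma3 y t = integral {0..t} sp"
  unfolding ode.gamma3_eq
proof (rule integral_cong)
  fix s assume "s \<in> {0..t}"
  then have s: "s \<in> Rplus" by auto
  show "norm (sph_deriv (xvec y s) (ode.xvec' s)) = sp s"
    by (simp add: xvec_def ode.xvec'_def sp_def X_def X'_def y_D(1-3)[OF s])
qed

lemma gamma3_limit: "((\<lambda>t. gamma3 y t / t) \<longlongrightarrow> integral {0..H} sp / H) at_top"
proof (rule quasi_periodic_linear_growth[OF H_pos])
  show "gamma3 y (t + H) = gamma3 y t + integral {0..H} sp" if "t \<ge> 0" for t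
    unfolding gamma3_sp by (rule integral_sp_step[OF that])
  show "\<bar>gamma3 y t\<bar> \<le> integral {0..H} sp" if "0 \<le> t" "t \<le> H" for t
  proof -
    have I: "sp integrable_on {c..d}" for c d by (intro integrable_continuous_interval sp_cont)
    have "0 \<le> integral {0..t} sp" by (intro integral_nonneg I) (simp add: sp_def)
    moreover have "integral {0..t} sp \<le> integral {0..H} sp"
      using that by (intro integral_subset_le I) (auto simp: sp_def)
    ultimately show ?thesis unfolding gamma3_sp by simp
  qed
qed

lemma freq: "lower_zero_freq y = ereal (2 * \<delta>)" "upper_zero_freq y = ereal (2 * \<delta>)"
  and speed: "lower_wander y = ereal (integral {0..H} sp / H)" "upper_wander y = ereal (integral {0..H} sp / H)"
  unfolding lower_zero_freq_def upper_zero_freq_def lower_wander_def upper_wander_def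
  using nzeros_limit gamma3_limit
  by (auto intro!: lim_imp_Liminf lim_imp_Limsup)

end

theorem theorem2:
  shows
  "(\<forall>a b c y :: real \<Rightarrow> real.
      continuous_on Rplus a \<and> continuous_on Rplus b \<and> continuous_on Rplus c \<and>
      is_solution a b c y \<and> (\<exists>t\<in>Rplus. y t \<noteq> 0) \<longrightarrow>
        upper_wander y \<ge> ereal (L_Omega / (2 * pi)) * upper_zero_freq y \<and>
        lower_wander y \<ge> ereal (L_Omega / (2 * pi)) * lower_zero_freq y)
   \<and>
   (\<forall>\<epsilon>::real. \<epsilon> > 0 \<longrightarrow>
      (\<exists>a b c y :: real \<Rightarrow> real.
         smooth_on_Rplus a \<and> smooth_on_Rplus b \<and> smooth_on_Rplus c \<and> smooth_on_Rplus y \<and>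
         is_solution a b c y \<and> (\<exists>t\<in>Rplus. y t \<noteq> 0) \<and>
         (\<exists>nu mu :: real.
            lower_zero_freq y = ereal nu \<and> upper_zero_freq y = ereal nu \<and>
            lower_wander y = ereal mu \<and> upper_wander y = ereal mu \<and>
            mu < (L_Omega / (2 * pi) + \<epsilon>) * nu)))"
proof (intro conjI allI impI)
  fix a b c y :: "real \<Rightarrow> real"
  assume "continuous_on Rplus a \<and> continuous_on Rplus b \<and> continuous_on Rplus c \<and>
      is_solution a b c y \<and> (\<exists>t\<in>Rplus. y t \<noteq> 0)"
  then interpret ode3 a b c y by unfold_locales auto
  show "upper_wander y \<ge> ereal (L_Omega / (2 * pi)) * upper_zero_freq y"
    "lower_wander y \<ge> ereal (L_Omega / (2 * pi)) * lower_zero_freq y"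
    by (rule wander_ge)+
next
  fix \<epsilon> :: real assume \<epsilon>: "\<epsilon> > 0"
  \<comment> \<open>The excess length will be at most \<open>92 * pi / M\<close>, to be kept below
    \<open>2 * pi * \<epsilon>\<close>; 48 exceeds 92 / 2. The summand 3 gives
    \<open>M\<^sup>2 \<ge> 9\<close>, hence \<open>M * \<delta> \<le> 1 / 8\<close>.\<close>
  define M where "M = 3 + 48 / \<epsilon>"
  have M_ge: "3 \<le> M" "48 / \<epsilon> \<le> M" using \<epsilon> by (simp_all add: M_def)
  define \<delta> where "\<delta> = 1 / M ^ 3"
  have M2: "9 \<le> M\<^sup>2" using power_mono[OF M_ge(1), of 2] by simp
  have \<delta>_pos: "0 < \<delta>" using M_ge(1) by (simp add: \<delta>_def)
  have M\<delta>_eq: "M * \<delta> = 1 / M\<^sup>2" using M_ge(1) by (simp add: \<delta>_def power2_eq_square power3_eq_cube)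
  interpret bouncing M \<delta>
  proof
    show "M * \<delta> \<le> 1 / 8" unfolding M\<delta>_eq using M2 by (intro divide_left_mono) auto
  qed (use M_ge \<delta>_pos in auto)
  let ?len = "integral {0..H} sp"
  have "err * H = pi * (128 / 3 * (1 / M) + 16 * (M * \<delta>) * M + 4 * \<delta>)"
    using M_ge(1) \<delta>_pos by (simp add: err_def H_def power2_eq_square field_simps)
  also have "\<dots> = pi * ((128 / 3 + 16 + 4 / M\<^sup>2) / M)"
    unfolding M\<delta>_eq \<delta>_def using M_ge(1) by (simp add: power2_eq_square power3_eq_cube field_simps)
  \<comment> \<open>60 exceeds 128 / 3 + 16 + 4 / 9; the 32 from the Gudermannian term then gives
    92.\<close>
  also have "\<dots> \<le> pi * (60 / M)"
  proof -
    have "4 / M\<^sup>2 \<le> 4 / 9" using M2 by (intro divide_left_mono) auto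
    then show ?thesis using M_ge(1) by (intro mult_left_mono divide_right_mono) auto
  qed
  finally have "err * H \<le> pi * (60 / M)" .
  have "?len \<le> L_Omega + pi * (92 / M)"
  proof -
    have "32 * pi / M + pi * (60 / M) = pi * (92 / M)" by (simp add: add_divide_distrib[symmetric])
    then show ?thesis using \<open>err * H \<le> pi * (60 / M)\<close> length_bound by linarith
  qed
  moreover have "pi * (92 / M) < pi * (2 * \<epsilon>)"
  proof -
    have "48 \<le> M * \<epsilon>" using M_ge(2) \<epsilon> by (simp add: pos_divide_le_eq)
    then have "92 < 2 * \<epsilon> * M" by (simp add: mult.commute)
    then have "92 / M < 2 * \<epsilon>" using M_ge(1) by (simp add: pos_divide_less_eq)
    then show ?thesis by (rule mult_strict_left_mono) simp
  qed
  ultimately have "?len < L_Omega + pi * (2 * \<epsilon>)" by linarith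
  then have "?len / H < (L_Omega + pi * (2 * \<epsilon>)) / H"
    using H_pos by (rule divide_strict_right_mono)
  also have "\<dots> = (L_Omega / (2 * pi) + \<epsilon>) * (2 * \<delta>)"
    using \<delta>_pos by (simp add: H_def field_simps)
  finally have "?len / H < (L_Omega / (2 * pi) + \<epsilon>) * (2 * \<delta>)" .
  moreover have "\<exists>t\<in>Rplus. y t \<noteq> 0" using nontrivial by auto
  ultimately show "\<exists>a b c y :: real \<Rightarrow> real.
         smooth_on_Rplus a \<and> smooth_on_Rplus b \<and> smooth_on_Rplus c \<and> smooth_on_Rplus y \<and>
         is_solution a b c y \<and> (\<exists>t\<in>Rplus. y t \<noteq> 0) \<and>
         (\<exists>nu mu :: real.
            lower_zero_freq y = ereal nu \<and> upper_zero_freq y = ereal nu \<and>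
            lower_wander y = ereal mu \<and> upper_wander y = ereal mu \<and>
            mu < (L_Omega / (2 * pi) + \<epsilon>) * nu)"
    using smooth sol freq speed
    by (intro exI[of _ ca] exI[of _ cb] exI[of _ cc] exI[of _ y] exI[of _ "2 * \<delta>"] exI[of _ "?len / H"] conjI)
qed

end
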